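(* Let $G$ be a 3-connected graph on $n\ge 6$ vertices, and let $p$ be the length of a longest path in $G$. Then there is a bond of $G$ meeting every path of $G$ of length at least $p-2$.
   Context: All graphs are finite, simple and undirected. The length of a path is its number of edges. A bond of $G$ is a minimal nonempty edge-cut, where an edge-cut is a set of edges of the form $\{xy\in E(G): x\in X, y\in V(G)\setminus X\}$ for some $X\subseteq V(G)$. A set of edges meets a path if the path contains at least one edge of the set. *)

theory Defs
  imports Main
begin

definition simple_graph :: "'a set \<Rightarrow> 'a set set \<Rightarrow> bool" where
  "simple_graph V E \<longleftrightarrow> finite V \<and> (\<forall>e\<in>E. e \<subseteq> V \<and> card e = 2)"

definition is_path :: "'a set \<Rightarrow> 'a set set \<Rightarrow> 'a list \<Rightarrow> bool" where
  "is_path V E xs \<longleftrightarrow> xs \<noteq> [] \<and> distinct xs \<and> set xs \<subseteq> V \<and>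
     (\<forall>i. Suc i < length xs \<longrightarrow> {xs ! i, xs ! Suc i} \<in> E)"

definition path_len :: "'a list \<Rightarrow> nat" where
  "path_len xs = length xs - 1"

definition path_edges :: "'a list \<Rightarrow> 'a set set" where
  "path_edges xs = {{xs ! i, xs ! Suc i} | i. Suc i < length xs}"

definition connected_minus :: "'a set \<Rightarrow> 'a set set \<Rightarrow> 'a set \<Rightarrow> bool" where
  "connected_minus V E S \<longleftrightarrow> V - S \<noteq> {} \<and>
     (\<forall>u\<in>V - S. \<forall>v\<in>V - S. \<exists>xs. is_path V E xs \<and> set xs \<subseteq> V - S \<and>
        hd xs = u \<and> last xs = v)"

definition k_connected :: "nat \<Rightarrow> 'a set \<Rightarrow> 'a set set \<Rightarrow> bool" where
  "k_connected k V E \<longleftrightarrow> card V > k \<and>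
     (\<forall>S. S \<subseteq> V \<and> card S < k \<longrightarrow> connected_minus V E S)"

definition edge_cut :: "'a set \<Rightarrow> 'a set set \<Rightarrow> 'a set \<Rightarrow> 'a set set" where
  "edge_cut V E X = {e \<in> E. \<exists>x y. e = {x, y} \<and> x \<in> X \<and> y \<in> V - X}"

definition is_edge_cut :: "'a set \<Rightarrow> 'a set set \<Rightarrow> 'a set set \<Rightarrow> bool" where
  "is_edge_cut V E F \<longleftrightarrow> (\<exists>X\<subseteq>V. F = edge_cut V E X)"

definition is_bond :: "'a set \<Rightarrow> 'a set set \<Rightarrow> 'a set set \<Rightarrow> bool" where
  "is_bond V E B \<longleftrightarrow> is_edge_cut V E B \<and> B \<noteq> {} \<and>
     (\<forall>F. is_edge_cut V E F \<and> F \<noteq> {} \<and> F \<subseteq> B \<longrightarrow> F = B)"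

definition meets :: "'a set set \<Rightarrow> 'a list \<Rightarrow> bool" where
  "meets F xs \<longleftrightarrow> path_edges xs \<inter> F \<noteq> {}"

end

theory Submission
  imports Defs "HOL-Library.Multiset"
begin

text \<open>
  A bond is the same as a partition \<open>(A, V - A)\<close> into two connected parts, and it meets a path unless
  the path lies in one part. So a partition is sought neither part of which contains a long path, i.e.
  one of length at least \<open>p - 2\<close>.

  By Menger's theorem two disjoint long paths are joined by three disjoint links, and passing from
  one path to the other along a suitable link produces a path longer than \<open>p\<close>. Hence at most one part
  contains a long path. Moving vertices one at a time from one part to the other, keeping both
  connected, one either finds the desired partition or arrives at two long paths, one on each side,
  which share just the vertex \<open>v\<close> that is being moved. For \<open>p \<ge> 7\<close> the latter is impossible: the two
  parts, being connected, link the two legs of each path, Menger's theorem in \<open>G - v\<close> yields two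
  disjoint links between the two paths, and 2-connectedness of \<open>G - v\<close> one more link that avoids a
  given end; every position of these links forces a path longer than \<open>p\<close>.

  If \<open>p \<le> 5\<close>, comparing the neighbourhoods of the ends of a longest path shows that the graph has a
  Hamiltonian path, and any partition with parts of sizes 3 and \<open>n - 3\<close> will do. If \<open>p = 6\<close> and there
  is no Hamiltonian path, then there are three vertices adjacent to all others such that the others
  are independent.
\<close>

section \<open>Menger's theorem\<close>

text \<open>Lengths decide almost everything: two long paths have at least \<open>2 * p - 2\<close>
  vertices together (counting a shared vertex twice), so a few paths made of their pieces and of
  links have more than \<open>p + 1\<close> vertices on average. Two obstacles shape the proof.
  First, the average can be exactly \<open>p + 1\<close> when all links in play are single edges.
  These tight configurations fall only to a further link, obtained by deleting a mark and looking at
  the rest of its leg; so every leg needs a second vertex, and \<open>7 \<le> p\<close> is what the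
  length bounds require for that. Second, the crossing step fails for \<open>p = 6\<close>: in
  K_{3,m} with m at least 6, two paths on five vertices, on different sides of a partition, can
  share just one vertex of the small class. This is why graphs without a Hamiltonian path are
  treated separately for \<open>p = 6\<close>. Moving a vertex while both parts stay connected is
  not automatic either; it needs 2-connectedness and a minimal choice among the pieces that a badly
  chosen vertex would cut off.\<close>

abbreviation walk_in :: "('a \<times> 'a) set \<Rightarrow> 'a list \<Rightarrow> bool" where
  "walk_in r \<equiv> successively (\<lambda>x y. (x, y) \<in> r)"

definition path_from_to :: "('a \<times> 'a) set \<Rightarrow> 'a set \<Rightarrow> 'a set \<Rightarrow> 'a list \<Rightarrow> bool" where
  "path_from_to r A B xs \<longleftrightarrow> xs \<noteq> [] \<and> distinct xs \<and> walk_in r xs \<and> hd xs \<in> A \<and> last xs \<in> B"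

definition separates :: "('a \<times> 'a) set \<Rightarrow> 'a set \<Rightarrow> 'a set \<Rightarrow> 'a set \<Rightarrow> bool" where
  "separates r A B S \<longleftrightarrow> (\<forall>xs. path_from_to r A B xs \<longrightarrow> set xs \<inter> S \<noteq> {})"

lemma walk_in_imp_path:
  assumes "walk_in r xs" "xs \<noteq> []"
  obtains ys where "path_from_to r {hd xs} {last xs} ys" "set ys \<subseteq> set xs"
  using assms
proof (induction "length xs" arbitrary: xs thesis rule: less_induct)
  case less
  show ?case
  proof (cases "distinct xs")
    case True
    with less.prems show ?thesis
      by (intro less.prems(1)[of xs]) (auto simp: path_from_to_def)
  next
    case False
    then obtain as z bs cs where xs: "xs = as @ [z] @ bs @ [z] @ cs"
      using not_distinct_decomp by blast
    have "walk_in r (as @ [z] @ cs)"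
      using less.prems(2) unfolding xs by (auto simp: successively_append_iff successively_Cons)
    then obtain ys where "path_from_to r {hd (as @ [z] @ cs)} {last (as @ [z] @ cs)} ys"
      "set ys \<subseteq> set (as @ [z] @ cs)"
      using less.hyps[of "as @ [z] @ cs"] xs by auto
    moreover have "hd (as @ [z] @ cs) = hd xs" "last (as @ [z] @ cs) = last xs"
      unfolding xs by (cases as; simp)+
    ultimately show ?thesis
      using less.prems(1)[of ys] unfolding xs by auto
  qed
qed

lemma path_from_to_mono:
  assumes "path_from_to r A B xs" "r \<subseteq> r'" "A \<subseteq> A'" "B \<subseteq> B'"
  shows "path_from_to r' A' B' xs"
  using assms successively_mono[of "\<lambda>x y. (x, y) \<in> r" xs "\<lambda>x y. (x, y) \<in> r'"]
  by (auto simp: path_from_to_def)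

lemma separatesD:
  assumes "separates r A B S" "walk_in r xs" "xs \<noteq> []" "hd xs \<in> A" "last xs \<in> B"
  shows "set xs \<inter> S \<noteq> {}"
proof -
  obtain ys where "path_from_to r {hd xs} {last xs} ys" "set ys \<subseteq> set xs"
    using walk_in_imp_path[OF assms(2,3)] .
  then have "path_from_to r A B ys" "set ys \<subseteq> set xs"
    using assms(4,5) path_from_to_mono[of r "{hd xs}" "{last xs}" ys r A B] by auto
  then show ?thesis
    using assms(1) by (auto simp: separates_def)
qed

lemma walk_in_converse: "walk_in (r\<inverse>) (rev xs) \<longleftrightarrow> walk_in r xs"
  by (simp add: successively_rev)

lemma path_from_to_converse: "path_from_to (r\<inverse>) B A (rev xs) \<longleftrightarrow> path_from_to r A B xs"
  by (auto simp: path_from_to_def walk_in_converse hd_rev last_rev successively_rev)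

lemma separates_converse: "separates (r\<inverse>) B A S \<longleftrightarrow> separates r A B S"
  unfolding separates_def by (metis path_from_to_converse rev_rev_ident set_rev)

text \<open>A walk uses \<open>(x, y)\<close> only by leaving \<open>x\<close>. The final vertex is
  never left, so \<open>z\<close> may be \<open>x\<close> itself, as happens in
  \<open>separates_through\<close>.\<close>

lemma walk_in_insertD:
  assumes "walk_in (insert (x, y) r) (ys @ [z])" "x \<notin> set ys"
  shows "walk_in r (ys @ [z])"
  using assms
proof (induction ys)
  case (Cons a ys)
  then show ?case
    by (cases ys) auto
qed simp

lemma separates_insert:
  assumes "separates r A B S"
  shows "separates (insert (x, y) r) A B (insert x S)"
  unfolding separates_def
proof (intro allI impI)
  fix xs assume xs: "path_from_to (insert (x, y) r) A B xs"
  show "set xs \<inter> insert x S \<noteq> {}"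
  proof (cases "x \<in> set xs")
    case False
    have "walk_in r xs"
      by (rule successively_mono[of "\<lambda>x' y'. (x', y') \<in> insert (x, y) r"])
        (use xs False in \<open>auto simp: path_from_to_def\<close>)
    then show ?thesis
      using separatesD[OF assms] xs by (fastforce simp: path_from_to_def)
  qed auto
qed

text \<open>A path first meets \<open>insert x S\<close> before it can use the edge \<open>(x, y)\<close>.\<close>

lemma separates_through:
  assumes S: "separates r A B S" and T: "separates r A (insert x S) T"
  shows "separates (insert (x, y) r) A B T"
  unfolding separates_def
proof (intro allI impI)
  fix xs assume xs: "path_from_to (insert (x, y) r) A B xs"
  then have "\<exists>z \<in> set xs. z \<in> insert x S"
    using separates_insert[OF S] unfolding separates_def by blast
  then obtain ys z zs where z: "xs = ys @ z # zs" "z \<in> insert x S" "\<forall>u \<in> set ys. u \<notin> insert x S"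
    using split_list_first_prop[of xs "\<lambda>z. z \<in> insert x S"] by blast
  have "walk_in (insert (x, y) r) (ys @ [z])"
    using xs successively_append_iff[of _ "ys @ [z]" zs] unfolding z(1) path_from_to_def by simp
  then have "walk_in r (ys @ [z])"
    by (rule walk_in_insertD) (use z(3) in blast)
  then have "set (ys @ [z]) \<inter> T \<noteq> {}"
    by (rule separatesD[OF T]) (use xs z in \<open>auto simp: path_from_to_def hd_append split: if_splits\<close>)
  then show "set xs \<inter> T \<noteq> {}"
    unfolding z(1) by auto
qed

definition linkage :: "('a \<times> 'a) set \<Rightarrow> 'a set \<Rightarrow> 'a set \<Rightarrow> 'a list set \<Rightarrow> bool" where
  "linkage r A B Ps \<longleftrightarrow> (\<forall>xs \<in> Ps. path_from_to r A B xs) \<and>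
     (\<forall>xs \<in> Ps. \<forall>ys \<in> Ps. xs \<noteq> ys \<longrightarrow> set xs \<inter> set ys = {})"

lemma linkage_converse: "linkage r A B Ps \<Longrightarrow> linkage (r\<inverse>) B A (rev ` Ps)"
  by (auto simp: linkage_def path_from_to_converse)

text \<open>Disjoint paths have different last vertices, so with as many paths as targets every
  target is hit exactly once. The paths can be indexed by their ends, and no path contains a second
  target, since that one lies on another path.\<close>

lemma linkage_onto:
  assumes l: "linkage r A B Ps" and "finite B" "card Ps = card B"
  obtains P where "\<And>b. b \<in> B \<Longrightarrow> path_from_to r A {b} (P b) \<and> set (P b) \<inter> B = {b}"
    "\<And>b c. b \<in> B \<Longrightarrow> c \<in> B \<Longrightarrow> b \<noteq> c \<Longrightarrow> set (P b) \<inter> set (P c) = {}"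
proof -
  have inj: "inj_on last Ps"
  proof (rule inj_onI)
    fix xs ys assume "xs \<in> Ps" "ys \<in> Ps" "last xs = last ys"
    then show "xs = ys"
      using l last_in_set unfolding linkage_def path_from_to_def
      by (metis disjoint_iff)
  qed
  have "last ` Ps \<subseteq> B"
    using l by (auto simp: linkage_def path_from_to_def)
  then have img: "last ` Ps = B"
    using inj assms(2,3) by (metis card_image card_subset_eq)
  define P where "P = the_inv_into Ps last"
  have P: "P b \<in> Ps" "last (P b) = b" if "b \<in> B" for b
    unfolding P_def using that img the_inv_into_into[OF inj, of b Ps] f_the_inv_into_f[OF inj, of b] by auto
  have disj: "set (P b) \<inter> set (P c) = {}" if "b \<in> B" "c \<in> B" "b \<noteq> c" for b c
    using l P[OF that(1)] P[OF that(2)] that(3) unfolding linkage_def by metis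
  have last: "b \<in> set (P b)" if "b \<in> B" for b
    using P[OF that] l last_in_set unfolding linkage_def path_from_to_def by metis
  show thesis
  proof (rule that[of P])
    fix b assume b: "b \<in> B"
    have "set (P b) \<inter> B = {b}"
      using disj[OF b] last b by blast
    then show "path_from_to r A {b} (P b) \<and> set (P b) \<inter> B = {b}"
      using P[OF b] l by (auto simp: linkage_def path_from_to_def)
  qed (rule disj)
qed

text \<open>Menger's theorem, by Goering's induction on the edges: if deleting \<open>(x, y)\<close> leaves a small
  separator \<open>S\<close>, then linkages to \<open>insert x S\<close> and from \<open>insert y S\<close> can be glued along \<open>S\<close>.\<close>

theorem menger:
  assumes "finite r" "finite A"
    and "\<And>S. finite S \<Longrightarrow> separates r A B S \<Longrightarrow> k \<le> card S"
  shows "\<exists>Ps. finite Ps \<and> card Ps = k \<and> linkage r A B Ps"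
  using assms
proof (induction r arbitrary: A B rule: finite_induct)
  case empty
  have "separates {} A B (A \<inter> B)"
    unfolding separates_def
  proof (intro allI impI)
    fix xs assume xs: "path_from_to {} A B xs"
    then obtain a where "xs = [a]"
      by (cases xs) (auto simp: path_from_to_def successively_Cons)
    with xs show "set xs \<inter> (A \<inter> B) \<noteq> {}"
      by (auto simp: path_from_to_def)
  qed
  then have "k \<le> card (A \<inter> B)"
    using empty by blast
  then obtain C where "C \<subseteq> A \<inter> B" "finite C" "card C = k"
    by (metis obtain_subset_with_card_n)
  then show ?case
    by (intro exI[of _ "(\<lambda>a. [a]) ` C"]) (auto simp: linkage_def path_from_to_def card_image inj_on_def)
next
  case (insert e r)
  obtain x y where e: "e = (x, y)"
    by fastforce
  note small = insert.prems(2)[unfolded e]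
  show ?case
  proof (cases "\<forall>S. finite S \<longrightarrow> separates r A B S \<longrightarrow> k \<le> card S")
    case True
    then obtain Ps where "finite Ps" "card Ps = k" "linkage r A B Ps"
      using insert.IH[OF insert.prems(1)] by blast
    moreover from this(3) have "linkage (insert e r) A B Ps"
      using path_from_to_mono[of r A B _ "insert e r" A B] by (auto simp: linkage_def)
    ultimately show ?thesis by blast
  next
    case False
    then obtain S where S: "finite S" "separates r A B S" "card S < k"
      by (auto simp: not_le)
    have S': "separates (r\<inverse>) B A S"
      using S(2) by (simp add: separates_converse)
    have conv: "(insert (y, x) (r\<inverse>)) = (insert (x, y) r)\<inverse>"
      by auto
    \<comment> \<open>\<open>S\<close> is too small but becomes large enough with one more vertex,
      so \<open>insert x S\<close> and \<open>insert y S\<close> both have exactly \<open>k\<close>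
      elements, as \<open>linkage_onto\<close> requires.\<close>
    have "k \<le> card (insert x S)"
      using small S(1) separates_insert[OF S(2)] by blast
    then have x: "card (insert x S) = k" "x \<notin> S"
      using S by (auto simp: card_insert_if split: if_splits)
    have "separates (insert (x, y) r) A B (insert y S)"
      using separates_insert[OF S', of y x] by (simp only: conv separates_converse)
    then have "k \<le> card (insert y S)"
      using small S(1) by blast
    then have y: "card (insert y S) = k" "y \<notin> S"
      using S by (auto simp: card_insert_if split: if_splits)
    have "\<exists>Ps. finite Ps \<and> card Ps = k \<and> linkage r A (insert x S) Ps"
      by (rule insert.IH[OF insert.prems(1)]) (use small separates_through[OF S(2)] in blast)
    then obtain P where P: "\<And>s. s \<in> insert x S \<Longrightarrow> path_from_to r A {s} (P s) \<and> set (P s) \<inter> insert x S = {s}"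
      "\<And>s t. s \<in> insert x S \<Longrightarrow> t \<in> insert x S \<Longrightarrow> s \<noteq> t \<Longrightarrow> set (P s) \<inter> set (P t) = {}"
      using linkage_onto[of r A "insert x S"] S(1) x(1) by (metis finite_insert)
    have "\<exists>Ps. finite Ps \<and> card Ps = k \<and> linkage r (insert y S) B Ps"
    proof (rule insert.IH)
      show "finite (insert y S)" using S(1) by simp
      fix T assume T: "finite T" "separates r (insert y S) B T"
      then have "separates (r\<inverse>) B (insert y S) T"
        by (simp add: separates_converse)
      from separates_through[OF S' this, of x] have "separates (insert (x, y) r) A B T"
        by (simp only: conv separates_converse)
      then show "k \<le> card T" using small T(1) by blast
    qed
    then obtain Qs where "finite Qs" "card Qs = k" "linkage r (insert y S) B Qs"
      by blast
    \<comment> \<open>\<open>linkage_onto\<close> indexes paths by their last vertices; reversal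
      makes it index these paths by their starts in \<open>insert y S\<close>.\<close>
    then have "linkage (r\<inverse>) B (insert y S) (rev ` Qs)" "card (rev ` Qs) = card (insert y S)"
      using linkage_converse y(1) by (auto simp: card_image)
    from linkage_onto[OF this(1) _ this(2)] S(1)
    obtain Q' where Q': "\<And>s. s \<in> insert y S \<Longrightarrow> path_from_to (r\<inverse>) B {s} (Q' s) \<and> set (Q' s) \<inter> insert y S = {s}"
      "\<And>s t. s \<in> insert y S \<Longrightarrow> t \<in> insert y S \<Longrightarrow> s \<noteq> t \<Longrightarrow> set (Q' s) \<inter> set (Q' t) = {}"
      by (metis finite_insert)
    define Q where "Q s = rev (Q' s)" for s
    have Q: "path_from_to r {s} B (Q s)" "set (Q s) \<inter> insert y S = {s}" if "s \<in> insert y S" for s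
      using Q'(1)[OF that] path_from_to_converse[of r B "{s}" "Q s"] by (auto simp: Q_def)
    have Qd: "set (Q s) \<inter> set (Q t) = {}" if "s \<in> insert y S" "t \<in> insert y S" "s \<noteq> t" for s t
      using Q'(2)[OF that] by (simp add: Q_def)
    \<comment> \<open>Follow \<open>P s\<close> up to a common vertex \<open>z\<close> and continue
      along \<open>Q t\<close>. This walk in \<open>r\<close> must meet \<open>S\<close>; but
      \<open>P s\<close> can do so only at its end and \<open>Q t\<close> only at its start, so it
      happens at \<open>z\<close>.\<close>
    have meet: "z \<in> S \<and> z = s \<and> z = t"
      if st: "s \<in> insert x S" "t \<in> insert y S" and z: "z \<in> set (P s)" "z \<in> set (Q t)" for s t z
    proof -
      obtain p1 p2 where p: "P s = p1 @ z # p2"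
        using z by (meson split_list)
      obtain q1 q2 where q: "Q t = q1 @ z # q2"
        using z by (meson split_list)
      note Ps = P(1)[OF st(1), unfolded p path_from_to_def] and Qt = Q[OF st(2), unfolded q path_from_to_def]
      have "last (z # p2) = s" "hd (q1 @ [z]) = t"
        using Ps Qt(1) by (auto simp: hd_append)
      have "walk_in r (p1 @ z # q2)"
        using Ps Qt(1) by (auto simp: successively_append_iff successively_Cons)
      moreover have "hd (p1 @ z # q2) \<in> A" "last (p1 @ z # q2) \<in> B"
        using Ps Qt(1) by (auto simp: hd_append)
      ultimately have "set (p1 @ z # q2) \<inter> S \<noteq> {}"
        using separatesD[OF S(2), of "p1 @ z # q2"] by auto
      then obtain w where w: "w \<in> S" "w \<in> set p1 \<or> w = z \<or> w \<in> set q2"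
        by auto
      have "w = z"
      proof (rule ccontr)
        assume "w \<noteq> z"
        with w consider "w \<in> set p1" | "w \<in> set q2" by blast
        then show False
        proof cases
          case 1
          then have "w = s" using Ps w by auto
          moreover have "s \<in> set (z # p2)" using \<open>last (z # p2) = s\<close> last_in_set by blast
          ultimately show False using 1 Ps by auto
        next
          case 2
          then have "w = t" using Qt w by auto
          moreover have "t \<in> set (q1 @ [z])" using \<open>hd (q1 @ [z]) = t\<close> hd_in_set by blast
          ultimately show False using 2 Qt(1) by auto
        qed
      qed
      then show ?thesis
        using w(1) z P(1)[OF st(1)] Q(2)[OF st(2)] by auto
    qed
    \<comment> \<open>The path ending in \<open>x\<close> continues over the restored edge to the
      path starting in \<open>y\<close>. In all other cases the two paths share \<open>s\<close>,
      and \<open>tl\<close> removes the duplicate.\<close>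
    define F where "F s = (if s = x then P x @ Q y else P s @ tl (Q s))" for s
    define g where "g s = (if s = x then y else s)" for s
    have g: "g s \<in> insert y S" if "s \<in> insert x S" for s
      using that by (auto simp: g_def)
    have Qt: "Q s = s # tl (Q s)" if "s \<in> S" for s
      using Q(1)[of s] that by (cases "Q s") (auto simp: path_from_to_def)
    have setF: "set (F s) = set (P s) \<union> set (Q (g s))" if "s \<in> insert x S" for s
    proof (cases "s = x")
      case False
      then have "s \<in> S" "s \<in> set (P s)"
        using that P(1)[OF that] by auto
      then show ?thesis
        using False arg_cong[OF Qt[of s], of set] by (auto simp: F_def g_def)
    qed (simp add: F_def g_def)
    have F: "path_from_to (insert e r) A B (F s)" if s: "s \<in> insert x S" for s
    proof (cases "s = x")
      case True
      have "set (P x) \<inter> set (Q y) = {}"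
        using meet[of x y] x(2) by auto
      then show ?thesis
        using True P(1)[of x] Q(1)[of y] unfolding e
        by (auto simp: F_def path_from_to_def successively_append_iff elim!: successively_mono)
    next
      case False
      then have sS: "s \<in> S" using s by auto
      have "set (P s) \<inter> set (tl (Q s)) = {}"
      proof -
        have "distinct (Q s)" using Q(1)[of s] sS by (auto simp: path_from_to_def)
        then have "s \<notin> set (tl (Q s))" by (metis Qt[OF sS] distinct.simps(2))
        moreover have "set (tl (Q s)) \<subseteq> set (Q s)" by (metis Qt[OF sS] set_subset_Cons)
        ultimately show ?thesis using meet[OF s, of s] sS by blast
      qed
      moreover have "path_from_to r A {s} (P s)" "path_from_to r {s} B (s # tl (Q s))"
        using P(1)[OF s] Q(1)[of s] sS Qt[OF sS] by auto
      ultimately show ?thesis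
        using False unfolding e
        by (cases "tl (Q s)") (auto simp: F_def path_from_to_def successively_append_iff elim!: successively_mono)
    qed
    have Fd: "set (F s) \<inter> set (F t) = {}" if "s \<in> insert x S" "t \<in> insert x S" "s \<noteq> t" for s t
    proof -
      have "g s \<noteq> g t"
        using that x(2) y(2) by (auto simp: g_def)
      then have "set (Q (g s)) \<inter> set (Q (g t)) = {}"
        using Qd g that by blast
      moreover have "set (P s) \<inter> set (P t) = {}"
        using P(2) that by blast
      moreover have "set (P u) \<inter> set (Q (g w)) = {}"
        if uw: "u \<in> insert x S" "w \<in> insert x S" "u \<noteq> w" for u w
      proof (rule ccontr)
        assume "set (P u) \<inter> set (Q (g w)) \<noteq> {}"
        then obtain z where "z \<in> S" "z = u" "z = g w"
          using meet[OF uw(1) g[OF uw(2)]] by blast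
        then show False
          using uw(3) y(2) by (simp add: g_def split: if_splits)
      qed
      ultimately show ?thesis
        using that unfolding setF[OF that(1)] setF[OF that(2)] by blast
    qed
    have "inj_on F (insert x S)"
    proof (rule inj_onI, rule ccontr)
      fix s t assume st: "s \<in> insert x S" "t \<in> insert x S" "F s = F t" "s \<noteq> t"
      then have "set (F s) = {}" using Fd[OF st(1,2,4)] by simp
      then show False using F[OF st(1)] by (simp add: path_from_to_def)
    qed
    then have "card (F ` insert x S) = k"
      by (simp only: card_image x(1))
    moreover have "linkage (insert e r) A B (F ` insert x S)"
      unfolding linkage_def
    proof (intro conjI ballI impI)
      fix xs ys assume "xs \<in> F ` insert x S" "ys \<in> F ` insert x S" "xs \<noteq> ys"
      then show "set xs \<inter> set ys = {}"
        using Fd by (metis imageE)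
    qed (use F in blast)
    ultimately show ?thesis
      by (intro exI[of _ "F ` insert x S"] conjI finite_imageI finite.insertI S(1))
  qed
qed

section \<open>Walks in a graph without long paths\<close>

text \<open>A path of length \<open>p\<close> is a list of \<open>p + 1\<close> vertices, hence
  \<open>Suc p\<close>. The locale only bounds lengths; lemmas that need a path attaining the bound
  assume one.\<close>

locale bounded_graph =
  fixes V :: "'a set" and E :: "'a set set" and p :: nat
  assumes simple: "simple_graph V E"
    and bounded: "is_path V E xs \<Longrightarrow> length xs \<le> Suc p"
begin

definition adj :: "'a \<Rightarrow> 'a \<Rightarrow> bool" where
  "adj x y \<longleftrightarrow> {x, y} \<in> E"

lemma adj_commute: "adj x y \<longleftrightarrow> adj y x"
  by (simp add: adj_def insert_commute)

lemma adj_sym: "adj x y \<Longrightarrow> adj y x"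
  by (simp add: adj_commute)

abbreviation walk :: "'a list \<Rightarrow> bool" where
  "walk \<equiv> successively adj"

text \<open>The inner vertices of a link are kept apart from its ends: the ends belong to legs or to
  other links, while \<open>S\<close> has to be disjoint from these. An empty \<open>S\<close> means
  an edge.\<close>

definition seg :: "'a \<Rightarrow> 'a list \<Rightarrow> 'a \<Rightarrow> bool" where
  "seg x S y \<longleftrightarrow> walk (x # S @ [y])"

lemma walk_rev [simp]: "walk (rev xs) \<longleftrightarrow> walk xs"
proof -
  have "(\<lambda>x y. adj y x) = adj"
    using adj_commute by blast
  then show ?thesis
    by (metis successively_rev)
qed

lemma seg_Nil [simp]: "seg x [] y \<longleftrightarrow> adj x y"
  by (simp add: seg_def)

lemma seg_rev [simp]: "seg x (rev S) y \<longleftrightarrow> seg y S x"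
  using walk_rev[of "x # rev S @ [y]"] by (simp add: seg_def)

lemma walk_seg: "walk (x # S @ y # zs) \<longleftrightarrow> seg x S y \<and> walk (y # zs)"
  using successively_append_iff[of adj "x # S @ [y]" zs]
  by (cases zs) (auto simp: seg_def successively_append_iff successively_Cons)

lemma seg_append [simp]: "seg x (S @ y # T) z \<longleftrightarrow> seg x S y \<and> seg y T z"
  using walk_seg[of x S y "T @ [z]"] by (simp add: seg_def)

text \<open>Legs are listed outwards, so a path that comes in along one leg and goes out along
  another has the shape \<open>rev T @ x # zs\<close>.\<close>

lemma walk_rev_start: "walk (rev T @ x # zs) \<longleftrightarrow> walk (x # T) \<and> walk (x # zs)"
  using walk_rev[of "x # T"]
  by (auto simp: successively_append_iff successively_Cons last_rev)

lemma is_path_iff_walk: "is_path V E xs \<longleftrightarrow> xs \<noteq> [] \<and> distinct xs \<and> set xs \<subseteq> V \<and> walk xs"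
  by (simp add: is_path_def successively_conv_nth adj_def)

lemma walk_length_le:
  assumes "walk xs" "distinct xs" "set xs \<subseteq> V"
  shows "length xs \<le> Suc p"
proof (cases "xs = []")
  case False
  then show ?thesis
    using assms by (intro bounded) (simp add: is_path_iff_walk)
qed simp

text \<open>The form in which explicit paths are checked: the simplifier cancels the two multisets.\<close>

lemma walk_length_le_mset:
  assumes "distinct ys" "set ys \<subseteq> V" and sub: "mset xs \<subseteq># mset ys" and "walk xs"
  shows "length xs \<le> Suc p"
proof (rule walk_length_le)
  have "count (mset xs) x \<le> 1" for x
    using mset_subset_eq_count[OF sub, of x] assms(1)[unfolded distinct_count_atmost_1]
    by (metis (full_types) le_trans le_numeral_extra(4) zero_le)
  then show "distinct xs"
    unfolding distinct_count_atmost_1 by (metis count_mset_0_iff le_neq_implies_less less_one)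
  show "set xs \<subseteq> V"
    using set_mset_mono[OF sub] assms(2) by (simp only: set_mset_mset)
qed fact

section \<open>Links between the legs of two crossing paths\<close>

text \<open>
  Two paths meeting in the single vertex \<open>v\<close> are cut there into four legs, listed outwards from \<open>v\<close>:
  \<open>A\<close>, \<open>B\<close> belong to the first path and \<open>C\<close>, \<open>D\<close> to the second. The last two conjuncts say that
  both paths have length at least \<open>p - 2\<close>. The list \<open>L\<close> collects the inner vertices of all links
  between legs under consideration.
\<close>

definition frame :: "'a \<Rightarrow> 'a list \<Rightarrow> 'a list \<Rightarrow> 'a list \<Rightarrow> 'a list \<Rightarrow> 'a list \<Rightarrow> bool" where
  "frame v A B C D L \<longleftrightarrow> distinct (v # A @ B @ C @ D @ L) \<and> set (v # A @ B @ C @ D @ L) \<subseteq> V \<and>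
     walk (v # A) \<and> walk (v # B) \<and> walk (v # C) \<and> walk (v # D) \<and>
     p \<le> length A + length B + 2 \<and> p \<le> length C + length D + 2"

lemma frame_walks:
  assumes "frame v A B C D L"
  shows "walk (v # A)" "walk (v # B)" "walk (v # C)" "walk (v # D)"
  using assms by (simp_all add: frame_def)

lemma frame_walk_length:
  assumes "frame v A B C D L" "mset xs \<subseteq># mset (v # A @ B @ C @ D @ L)" "walk xs"
  shows "length xs \<le> Suc p"
  by (rule walk_length_le_mset[OF _ _ assms(2,3)]) (use assms(1) in \<open>unfold frame_def, blast+\<close>)

section \<open>One link across, by the position of its ends\<close>

text \<open>
  In each of the following lemmas \<open>\<alpha>\<close>, \<open>\<beta>\<close>, \<open>\<gamma>\<close>, \<open>\<delta>\<close> are the ends of a link between \<open>A\<close> and \<open>B\<close> and of one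
  between \<open>C\<close> and \<open>D\<close>, and the suffixes tell whether the further ends of links precede or follow these
  marks on their legs. The listed paths are the support of a dual solution of the linear program
  which asks for leg segments and links such that no path is longer than \<open>p\<close>.
\<close>

lemma link_off_marks_lt_lt:
  assumes F: "frame v (A1 @ a # A2 @ \<alpha> # A3) (B1 @ \<beta> # B2) (C1 @ c # C2 @ \<gamma> # C3) (D1 @ \<delta> # D2) (R @ S @ L)"
    and l: "seg \<alpha> R \<beta>" "seg \<gamma> S \<delta>" "seg a L c"
  shows False
proof -
  note * = frame_walks[OF F, unfolded walk_seg] l walk_seg walk_rev_start
  \<comment> \<open>The three lengths add up to at least \<open>3 * p + 5\<close>, against an upper
    bound of \<open>3 * p + 3\<close>. The contradictions in the following lemmas arise in the same
    way, by weighted sums.\<close>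
  have "length (rev A3 @ \<alpha> # rev A2 @ a # L @ c # C2 @ \<gamma> # S @ \<delta> # rev D1 @ v # B1 @ \<beta> # B2) \<le> Suc p"
       "length (rev A3 @ \<alpha> # R @ \<beta> # rev B1 @ v # A1 @ a # L @ c # C2 @ \<gamma> # S @ \<delta> # D2) \<le> Suc p"
       "length (rev B2 @ \<beta> # rev R @ \<alpha> # rev A2 @ a # rev A1 @ v # C1 @ c # C2 @ \<gamma> # C3) \<le> Suc p"
    by (rule frame_walk_length[OF F]; simp add: *)+
  then show False
    using F by (simp add: frame_def)
qed

lemma link_off_marks_lt_gt:
  assumes F: "frame v (A1 @ a # A2 @ \<alpha> # A3) (B1 @ \<beta> # B2) (C1 @ \<gamma> # C2 @ c # C3) (D1 @ \<delta> # D2) (R @ S @ L)"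
    and l: "seg \<alpha> R \<beta>" "seg \<gamma> S \<delta>" "seg a L c"
  shows False
proof -
  note * = frame_walks[OF F, unfolded walk_seg] l walk_seg walk_rev_start
  have "length (rev A3 @ \<alpha> # rev A2 @ a # L @ c # rev C2 @ \<gamma> # S @ \<delta> # rev D1 @ v # B1 @ \<beta> # B2) \<le> Suc p"
       "length (rev A3 @ \<alpha> # R @ \<beta> # rev B1 @ v # A1 @ a # L @ c # rev C2 @ \<gamma> # S @ \<delta> # D2) \<le> Suc p"
       "length (rev B2 @ \<beta> # rev R @ \<alpha> # rev A2 @ a # rev A1 @ v # C1 @ \<gamma> # C2 @ c # C3) \<le> Suc p"
    by (rule frame_walk_length[OF F]; simp add: *)+
  then show False
    using F by (simp add: frame_def)
qed

lemma link_off_marks_gt_gt: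
  assumes F: "frame v (A1 @ \<alpha> # A2 @ a # A3) (B1 @ \<beta> # B2) (C1 @ \<gamma> # C2 @ c # C3) (D1 @ \<delta> # D2) (R @ S @ L)"
    and l: "seg \<alpha> R \<beta>" "seg \<gamma> S \<delta>" "seg a L c"
  shows False
proof -
  note * = frame_walks[OF F, unfolded walk_seg] l walk_seg walk_rev_start
  have "length (rev A3 @ a # rev A2 @ \<alpha> # R @ \<beta> # rev B1 @ v # D1 @ \<delta> # rev S @ \<gamma> # C2 @ c # C3) \<le> Suc p"
       "length (rev A3 @ a # L @ c # rev C2 @ \<gamma> # rev C1 @ v # A1 @ \<alpha> # R @ \<beta> # B2) \<le> Suc p"
       "length (rev B2 @ \<beta> # rev B1 @ v # A1 @ \<alpha> # A2 @ a # L @ c # rev C2 @ \<gamma> # S @ \<delta> # D2) \<le> Suc p"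
    by (rule frame_walk_length[OF F]; simp add: *)+
  then show False
    using F by (simp add: frame_def)
qed

lemma link_from_link_lt:
  assumes F: "frame v (A1 @ \<alpha> # A2) (B1 @ \<beta> # B2) (C1 @ c # C2 @ \<gamma> # C3) (D1 @ \<delta> # D2) ((R1 @ x # R2) @ S @ L)"
    and l: "seg \<alpha> (R1 @ x # R2) \<beta>" "seg \<gamma> S \<delta>" "seg x L c"
  shows False
proof -
  note * = frame_walks[OF F, unfolded walk_seg] l[unfolded seg_append] walk_seg walk_rev_start
  have "length (rev A2 @ \<alpha> # rev A1 @ v # C1 @ c # C2 @ \<gamma> # S @ \<delta> # D2) \<le> Suc p"
       "length (rev A2 @ \<alpha> # R1 @ x # L @ c # C2 @ \<gamma> # S @ \<delta> # rev D1 @ v # B1 @ \<beta> # B2) \<le> Suc p"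
       "length (rev B2 @ \<beta> # rev B1 @ v # A1 @ \<alpha> # R1 @ x # L @ c # C2 @ \<gamma> # C3) \<le> Suc p"
    by (rule frame_walk_length[OF F]; simp add: *)+
  then show False
    using F by (simp add: frame_def)
qed

lemma link_from_link_eq:
  assumes F: "frame v (A1 @ \<alpha> # A2) (B1 @ \<beta> # B2) (C1 @ \<gamma> # C2) (D1 @ \<delta> # D2) ((R1 @ x # R2) @ S @ L)"
    and l: "seg \<alpha> (R1 @ x # R2) \<beta>" "seg \<gamma> S \<delta>" "seg x L \<gamma>"
  shows False
proof -
  note * = frame_walks[OF F, unfolded walk_seg] l[unfolded seg_append] walk_seg walk_rev_start
  have "length (rev A2 @ \<alpha> # rev A1 @ v # D1 @ \<delta> # rev S @ \<gamma> # rev L @ x # R2 @ \<beta> # B2) \<le> Suc p"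
       "length (rev A2 @ \<alpha> # R1 @ x # R2 @ \<beta> # rev B1 @ v # C1 @ \<gamma> # S @ \<delta> # D2) \<le> Suc p"
       "length (rev B2 @ \<beta> # rev B1 @ v # A1 @ \<alpha> # R1 @ x # L @ \<gamma> # C2) \<le> Suc p"
    by (rule frame_walk_length[OF F]; simp add: *)+
  then show False
    using F by (simp add: frame_def)
qed

lemma link_from_link_gt:
  assumes F: "frame v (A1 @ \<alpha> # A2) (B1 @ \<beta> # B2) (C1 @ \<gamma> # C2 @ c # C3) (D1 @ \<delta> # D2) ((R1 @ x # R2) @ S @ L)"
    and l: "seg \<alpha> (R1 @ x # R2) \<beta>" "seg \<gamma> S \<delta>" "seg x L c"
  shows False
proof -
  note * = frame_walks[OF F, unfolded walk_seg] l[unfolded seg_append] walk_seg walk_rev_start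
  have "length (rev A2 @ \<alpha> # rev A1 @ v # C1 @ \<gamma> # C2 @ c # C3) \<le> Suc p"
       "length (rev A2 @ \<alpha> # R1 @ x # L @ c # rev C2 @ \<gamma> # S @ \<delta> # rev D1 @ v # B1 @ \<beta> # B2) \<le> Suc p"
       "length (rev B2 @ \<beta> # rev B1 @ v # A1 @ \<alpha> # R1 @ x # L @ c # rev C2 @ \<gamma> # S @ \<delta> # D2) \<le> Suc p"
    by (rule frame_walk_length[OF F]; simp add: *)+
  then show False
    using F by (simp add: frame_def)
qed

lemma link_from_link_to_link:
  assumes F: "frame v (A1 @ \<alpha> # A2) (B1 @ \<beta> # B2) (C1 @ \<gamma> # C2) (D1 @ \<delta> # D2) ((R1 @ x # R2) @ (S1 @ y # S2) @ L)"
    and l: "seg \<alpha> (R1 @ x # R2) \<beta>" "seg \<gamma> (S1 @ y # S2) \<delta>" "seg x L y"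
  shows False
proof -
  note * = frame_walks[OF F, unfolded walk_seg] l[unfolded seg_append] walk_seg walk_rev_start
  have "length (rev A2 @ \<alpha> # rev A1 @ v # D1 @ \<delta> # rev S2 @ y # rev L @ x # R2 @ \<beta> # B2) \<le> Suc p"
       "length (rev A2 @ \<alpha> # R1 @ x # R2 @ \<beta> # rev B1 @ v # C1 @ \<gamma> # S1 @ y # S2 @ \<delta> # D2) \<le> Suc p"
       "length (rev B2 @ \<beta> # rev B1 @ v # A1 @ \<alpha> # R1 @ x # L @ y # rev S1 @ \<gamma> # C2) \<le> Suc p"
    by (rule frame_walk_length[OF F]; simp add: *)+
  then show False
    using F by (simp add: frame_def)
qed

text \<open>Here the inequalities have no slack: the five lengths sum to at least
  \<open>5 * p + 5\<close> plus \<open>2 * length R + 4 * length S + 2 * length L\<close>, and at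
  most \<open>5 * p + 5\<close>. Hence only the inner vertices are excluded, not the
  configuration.\<close>

lemma link_from_mark_lt:
  assumes F: "frame v (A1 @ \<alpha> # A2) (B1 @ \<beta> # B2) (C1 @ c # C2 @ \<gamma> # C3) (D1 @ \<delta> # D2) (R @ S @ L)"
    and l: "seg \<alpha> R \<beta>" "seg \<gamma> S \<delta>" "seg \<alpha> L c"
  shows "R = [] \<and> S = [] \<and> L = []"
proof (rule ccontr)
  assume n: "\<not> ?thesis"
  note * = frame_walks[OF F, unfolded walk_seg] l walk_seg walk_rev_start
  have "length (rev A2 @ \<alpha> # rev A1 @ v # D1 @ \<delta> # rev S @ \<gamma> # C3) \<le> Suc p"
       "length (rev A2 @ \<alpha> # R @ \<beta> # rev B1 @ v # C1 @ c # C2 @ \<gamma> # S @ \<delta> # D2) \<le> Suc p"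
       "length (rev A2 @ \<alpha> # L @ c # C2 @ \<gamma> # S @ \<delta> # rev D1 @ v # B1 @ \<beta> # B2) \<le> Suc p"
       "length (rev B2 @ \<beta> # rev B1 @ v # A1 @ \<alpha> # L @ c # C2 @ \<gamma> # S @ \<delta> # D2) \<le> Suc p"
       "length (rev B2 @ \<beta> # rev R @ \<alpha> # rev A1 @ v # C1 @ c # C2 @ \<gamma> # C3) \<le> Suc p"
    by (rule frame_walk_length[OF F]; simp add: *)+
  then show False
    using F n by (auto simp: frame_def simp flip: length_0_conv)
qed

lemma link_from_mark_gt:
  assumes F: "frame v (A1 @ \<alpha> # A2) (B1 @ \<beta> # B2) (C1 @ \<gamma> # C2 @ c # C3) (D1 @ \<delta> # D2) (R @ S @ L)"
    and l: "seg \<alpha> R \<beta>" "seg \<gamma> S \<delta>" "seg \<alpha> L c"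
  shows "R = [] \<and> S = [] \<and> L = []"
proof (rule ccontr)
  assume n: "\<not> ?thesis"
  note * = frame_walks[OF F, unfolded walk_seg] l walk_seg walk_rev_start
  have "length (rev A2 @ \<alpha> # rev A1 @ v # C1 @ \<gamma> # S @ \<delta> # D2) \<le> Suc p"
       "length (rev A2 @ \<alpha> # rev A1 @ v # D1 @ \<delta> # rev S @ \<gamma> # C2 @ c # C3) \<le> Suc p"
       "length (rev A2 @ \<alpha> # R @ \<beta> # rev B1 @ v # C1 @ \<gamma> # C2 @ c # C3) \<le> Suc p"
       "length (rev A2 @ \<alpha> # L @ c # rev C2 @ \<gamma> # S @ \<delta> # rev D1 @ v # B1 @ \<beta> # B2) \<le> Suc p"
       "length (rev B2 @ \<beta> # rev B1 @ v # A1 @ \<alpha> # L @ c # rev C2 @ \<gamma> # S @ \<delta> # D2) \<le> Suc p"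
       "length (rev B2 @ \<beta> # rev R @ \<alpha> # rev A1 @ v # C1 @ \<gamma> # C2 @ c # C3) \<le> Suc p"
    by (rule frame_walk_length[OF F]; simp add: *)+
  then show False
    using F n by (auto simp: frame_def simp flip: length_0_conv)
qed

section \<open>Two links across, the first joining two marks\<close>

lemma two_mark_links:
  assumes F: "frame v (A1 @ \<alpha> # A2) (B1 @ \<beta> # B2) (C1 @ \<gamma> # C2) (D1 @ \<delta> # D2) (R @ S @ L @ M)"
    and l: "seg \<alpha> R \<beta>" "seg \<gamma> S \<delta>" "seg \<alpha> L \<gamma>" "seg \<beta> M \<delta>"
  shows "R = [] \<and> S = [] \<and> L = [] \<and> M = []"
proof (rule ccontr)
  assume n: "\<not> ?thesis"
  note * = frame_walks[OF F, unfolded walk_seg] l walk_seg walk_rev_start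
  \<comment> \<open>Another tight case: the sum is at least \<open>3 * p + 3\<close> plus all inner
    vertices, those of \<open>S\<close> counted three times.\<close>
  have "length (rev A2 @ \<alpha> # rev A1 @ v # C1 @ \<gamma> # S @ \<delta> # rev M @ \<beta> # B2) \<le> Suc p"
       "length (rev A2 @ \<alpha> # R @ \<beta> # rev B1 @ v # D1 @ \<delta> # rev S @ \<gamma> # C2) \<le> Suc p"
       "length (rev B2 @ \<beta> # rev B1 @ v # A1 @ \<alpha> # L @ \<gamma> # S @ \<delta> # D2) \<le> Suc p"
    by (rule frame_walk_length[OF F]; simp add: *)+
  then show False
    using F n by (auto simp: frame_def simp flip: length_0_conv)
qed

text \<open>The four lengths sum to at least \<open>4 * p + 4 + 2 * length L\<close>, so the bound
  is attainable only if the link is an edge.\<close>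

lemma mark_link_and_edge_lt:
  assumes F: "frame v (A1 @ \<alpha> # A2) (B1 @ \<beta> # B2) (C1 @ c # C2 @ \<gamma> # C3) (D1 @ \<delta> # D2) L"
    and l: "adj \<alpha> \<beta>" "adj \<gamma> \<delta>" "seg \<alpha> L \<gamma>" "adj \<beta> c"
  shows "L = []"
proof (rule ccontr)
  assume n: "\<not> ?thesis"
  note * = frame_walks[OF F, unfolded walk_seg] l l(1,2,4)[THEN adj_sym] walk_seg walk_rev_start
  have "length (rev A2 @ \<alpha> # rev A1 @ v # B1 @ \<beta> # c # C2 @ \<gamma> # \<delta> # D2) \<le> Suc p"
       "length (rev A2 @ \<alpha> # rev A1 @ v # D1 @ \<delta> # \<gamma> # rev C2 @ c # \<beta> # B2) \<le> Suc p"
       "length (rev A2 @ \<alpha> # L @ \<gamma> # rev C2 @ c # rev C1 @ v # B1 @ \<beta> # B2) \<le> Suc p"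
       "length (rev B2 @ \<beta> # rev B1 @ v # A1 @ \<alpha> # L @ \<gamma> # C3) \<le> Suc p"
    by (rule frame_walk_length[OF F]; simp add: *)+
  then show False
    using F n by (auto simp: frame_def simp flip: length_0_conv)
qed

lemma mark_link_and_edge_gt:
  assumes F: "frame v (A1 @ \<alpha> # A2) (B1 @ \<beta> # B2) (C1 @ \<gamma> # C2 @ c # C3) (D1 @ \<delta> # D2) L"
    and l: "adj \<alpha> \<beta>" "adj \<gamma> \<delta>" "seg \<alpha> L \<gamma>" "adj \<beta> c"
  shows "L = []"
proof (rule ccontr)
  assume n: "\<not> ?thesis"
  note * = frame_walks[OF F, unfolded walk_seg] l l(1,2,4)[THEN adj_sym] walk_seg walk_rev_start
  have "length (rev A2 @ \<alpha> # rev A1 @ v # B1 @ \<beta> # c # rev C2 @ \<gamma> # \<delta> # D2) \<le> Suc p"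
       "length (rev A2 @ \<alpha> # rev A1 @ v # D1 @ \<delta> # \<gamma> # C2 @ c # \<beta> # B2) \<le> Suc p"
       "length (rev A2 @ \<alpha> # L @ \<gamma> # rev C1 @ v # B1 @ \<beta> # B2) \<le> Suc p"
       "length (rev B2 @ \<beta> # rev B1 @ v # A1 @ \<alpha> # L @ \<gamma> # C2 @ c # C3) \<le> Suc p"
    by (rule frame_walk_length[OF F]; simp add: *)+
  then show False
    using F n by (auto simp: frame_def simp flip: length_0_conv)
qed

lemma mark_link_and_far_edge_lt:
  assumes F: "frame v (A1 @ \<alpha> # A2) (B1 @ \<beta> # B2) (C1 @ \<gamma> # C2) (D1 @ d # D2 @ \<delta> # D3) L"
    and l: "adj \<alpha> \<beta>" "adj \<gamma> \<delta>" "seg \<alpha> L \<gamma>" "adj \<beta> d"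
  shows False
proof -
  note * = frame_walks[OF F, unfolded walk_seg] l l(1,2,4)[THEN adj_sym] walk_seg walk_rev_start
  have "length (rev A2 @ \<alpha> # rev A1 @ v # B1 @ \<beta> # d # D2 @ \<delta> # \<gamma> # C2) \<le> Suc p"
       "length (rev A2 @ \<alpha> # rev A1 @ v # C1 @ \<gamma> # \<delta> # rev D2 @ d # \<beta> # B2) \<le> Suc p"
       "length (rev A2 @ \<alpha> # L @ \<gamma> # \<delta> # rev D2 @ d # rev D1 @ v # B1 @ \<beta> # B2) \<le> Suc p"
       "length (rev B2 @ \<beta> # rev B1 @ v # A1 @ \<alpha> # L @ \<gamma> # \<delta> # D3) \<le> Suc p"
    by (rule frame_walk_length[OF F]; simp add: *)+
  then show False
    using F by (simp add: frame_def)
qed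

lemma mark_link_and_far_edge_gt:
  assumes F: "frame v (A1 @ \<alpha> # A2) (B1 @ \<beta> # B2) (C1 @ \<gamma> # C2) (D1 @ \<delta> # D2 @ d # D3) L"
    and l: "adj \<alpha> \<beta>" "adj \<gamma> \<delta>" "seg \<alpha> L \<gamma>" "adj \<beta> d"
  shows False
proof -
  note * = frame_walks[OF F, unfolded walk_seg] l l(1,2,4)[THEN adj_sym] walk_seg walk_rev_start
  have "length (rev A2 @ \<alpha> # rev A1 @ v # B1 @ \<beta> # d # rev D2 @ \<delta> # \<gamma> # C2) \<le> Suc p"
       "length (rev A2 @ \<alpha> # L @ \<gamma> # rev C1 @ v # D1 @ \<delta> # D2 @ d # \<beta> # B2) \<le> Suc p"
       "length (rev B2 @ \<beta> # rev B1 @ v # A1 @ \<alpha> # L @ \<gamma> # \<delta> # D2 @ d # D3) \<le> Suc p"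
    by (rule frame_walk_length[OF F]; simp add: *)+
  then show False
    using F by (simp add: frame_def)
qed

section \<open>Two edges across, each with exactly one marked end\<close>

lemma edges_same_leg_lt_lt:
  assumes F: "frame v (A1 @ \<alpha> # A2) (B1 @ \<beta> # B2) (C1 @ c # C2 @ c' # C3 @ \<gamma> # C4) (D1 @ \<delta> # D2) []"
    and l: "adj \<alpha> \<beta>" "adj \<gamma> \<delta>" "adj \<alpha> c" "adj \<beta> c'"
  shows False
proof -
  note * = frame_walks[OF F, unfolded walk_seg] l l(1,2,3,4)[THEN adj_sym] walk_seg walk_rev_start
  have "length (rev A2 @ \<alpha> # rev A1 @ v # D1 @ \<delta> # \<gamma> # rev C3 @ c' # \<beta> # B2) \<le> Suc p"
       "length (rev A2 @ \<alpha> # \<beta> # rev B1 @ v # C1 @ c # C2 @ c' # C3 @ \<gamma> # \<delta> # D2) \<le> Suc p"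
       "length (rev B2 @ \<beta> # rev B1 @ v # A1 @ \<alpha> # c # C2 @ c' # C3 @ \<gamma> # C4) \<le> Suc p"
    by (rule frame_walk_length[OF F]; simp add: *)+
  then show False
    using F by (simp add: frame_def)
qed

lemma edges_same_leg_lt_gt:
  assumes F: "frame v (A1 @ \<alpha> # A2) (B1 @ \<beta> # B2) (C1 @ c # C2 @ \<gamma> # C3 @ c' # C4) (D1 @ \<delta> # D2) []"
    and l: "adj \<alpha> \<beta>" "adj \<gamma> \<delta>" "adj \<alpha> c" "adj \<beta> c'"
  shows False
proof -
  note * = frame_walks[OF F, unfolded walk_seg] l l(1,2,3,4)[THEN adj_sym] walk_seg walk_rev_start
  have "length (rev A2 @ \<alpha> # rev A1 @ v # B1 @ \<beta> # c' # rev C3 @ \<gamma> # \<delta> # D2) \<le> Suc p"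
       "length (rev A2 @ \<alpha> # c # rev C1 @ v # D1 @ \<delta> # \<gamma> # C3 @ c' # \<beta> # B2) \<le> Suc p"
       "length (rev B2 @ \<beta> # rev B1 @ v # A1 @ \<alpha> # c # C2 @ \<gamma> # C3 @ c' # C4) \<le> Suc p"
    by (rule frame_walk_length[OF F]; simp add: *)+
  then show False
    using F by (simp add: frame_def)
qed

lemma edges_same_leg_gt_gt:
  assumes F: "frame v (A1 @ \<alpha> # A2) (B1 @ \<beta> # B2) (C1 @ \<gamma> # C2 @ c # C3 @ c' # C4) (D1 @ \<delta> # D2) []"
    and l: "adj \<alpha> \<beta>" "adj \<gamma> \<delta>" "adj \<alpha> c" "adj \<beta> c'"
  shows False
proof -
  note * = frame_walks[OF F, unfolded walk_seg] l l(1,2,3,4)[THEN adj_sym] walk_seg walk_rev_start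
  \<comment> \<open>The last of the five paths has to be counted twice; then the sum is at least
    \<open>6 * p + 8\<close>, against \<open>6 * p + 6\<close>.\<close>
  have "length (rev A2 @ \<alpha> # rev A1 @ v # C1 @ \<gamma> # C2 @ c # C3 @ c' # C4) \<le> Suc p"
       "length (rev A2 @ \<alpha> # rev A1 @ v # D1 @ \<delta> # \<gamma> # C2 @ c # C3 @ c' # \<beta> # B2) \<le> Suc p"
       "length (rev A2 @ \<alpha> # \<beta> # rev B1 @ v # D1 @ \<delta> # \<gamma> # C2 @ c # C3 @ c' # C4) \<le> Suc p"
       "length (rev A2 @ \<alpha> # c # rev C2 @ \<gamma> # rev C1 @ v # B1 @ \<beta> # B2) \<le> Suc p"
       "length (rev B2 @ \<beta> # rev B1 @ v # A1 @ \<alpha> # c # rev C2 @ \<gamma> # \<delta> # D2) \<le> Suc p"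
    by (rule frame_walk_length[OF F]; simp add: *)+
  then show False
    using F by (simp add: frame_def)
qed

lemma edges_to_legs_lt_lt:
  assumes F: "frame v (A1 @ \<alpha> # A2) (B1 @ \<beta> # B2) (C1 @ c # C2 @ \<gamma> # C3) (D1 @ d # D2 @ \<delta> # D3) []"
    and l: "adj \<alpha> \<beta>" "adj \<gamma> \<delta>" "adj \<alpha> c" "adj \<beta> d"
  shows False
proof -
  note * = frame_walks[OF F, unfolded walk_seg] l l(1,2,3,4)[THEN adj_sym] walk_seg walk_rev_start
  have "length (rev A2 @ \<alpha> # rev A1 @ v # B1 @ \<beta> # d # D2 @ \<delta> # D3) \<le> Suc p"
       "length (rev A2 @ \<alpha> # rev A1 @ v # C1 @ c # C2 @ \<gamma> # \<delta> # rev D2 @ d # \<beta> # B2) \<le> Suc p"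
       "length (rev A2 @ \<alpha> # c # C2 @ \<gamma> # \<delta> # rev D2 @ d # rev D1 @ v # B1 @ \<beta> # B2) \<le> Suc p"
       "length (rev B2 @ \<beta> # rev B1 @ v # A1 @ \<alpha> # c # C2 @ \<gamma> # C3) \<le> Suc p"
    by (rule frame_walk_length[OF F]; simp add: *)+
  then show False
    using F by (simp add: frame_def)
qed

lemma edges_to_legs_lt_gt:
  assumes F: "frame v (A1 @ \<alpha> # A2) (B1 @ \<beta> # B2) (C1 @ c # C2 @ \<gamma> # C3) (D1 @ \<delta> # D2 @ d # D3) []"
    and l: "adj \<alpha> \<beta>" "adj \<gamma> \<delta>" "adj \<alpha> c" "adj \<beta> d"
  shows False
proof -
  note * = frame_walks[OF F, unfolded walk_seg] l l(1,2,3,4)[THEN adj_sym] walk_seg walk_rev_start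
  have "length (rev A2 @ \<alpha> # rev A1 @ v # C1 @ c # C2 @ \<gamma> # \<delta> # D2 @ d # \<beta> # B2) \<le> Suc p"
       "length (rev A2 @ \<alpha> # c # C2 @ \<gamma> # \<delta> # rev D1 @ v # B1 @ \<beta> # d # D3) \<le> Suc p"
       "length (rev B2 @ \<beta> # rev B1 @ v # A1 @ \<alpha> # c # C2 @ \<gamma> # C3) \<le> Suc p"
    by (rule frame_walk_length[OF F]; simp add: *)+
  then show False
    using F by (simp add: frame_def)
qed

lemma edges_to_legs_gt_gt:
  assumes F: "frame v (A1 @ \<alpha> # A2) (B1 @ \<beta> # B2) (C1 @ \<gamma> # C2 @ c # C3) (D1 @ \<delta> # D2 @ d # D3) []"
    and l: "adj \<alpha> \<beta>" "adj \<gamma> \<delta>" "adj \<alpha> c" "adj \<beta> d"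
  shows False
proof -
  note * = frame_walks[OF F, unfolded walk_seg] l l(1,2,3,4)[THEN adj_sym] walk_seg walk_rev_start
  have "length (rev A2 @ \<alpha> # rev A1 @ v # B1 @ \<beta> # d # rev D2 @ \<delta> # \<gamma> # C2 @ c # C3) \<le> Suc p"
       "length (rev A2 @ \<alpha> # c # rev C2 @ \<gamma> # rev C1 @ v # D1 @ \<delta> # D2 @ d # \<beta> # B2) \<le> Suc p"
       "length (rev B2 @ \<beta> # rev B1 @ v # A1 @ \<alpha> # c # rev C2 @ \<gamma> # \<delta> # D2 @ d # D3) \<le> Suc p"
    by (rule frame_walk_length[OF F]; simp add: *)+
  then show False
    using F by (simp add: frame_def)
qed

lemma edges_from_leg_lt_lt:
  assumes F: "frame v (A1 @ a # A2 @ \<alpha> # A3) (B1 @ \<beta> # B2) (C1 @ c # C2 @ \<gamma> # C3) (D1 @ \<delta> # D2) []"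
    and l: "adj \<alpha> \<beta>" "adj \<gamma> \<delta>" "adj \<alpha> c" "adj a \<delta>"
  shows False
proof -
  note * = frame_walks[OF F, unfolded walk_seg] l l(1,2,3,4)[THEN adj_sym] walk_seg walk_rev_start
  have "length (rev A3 @ \<alpha> # rev A2 @ a # rev A1 @ v # D1 @ \<delta> # \<gamma> # C3) \<le> Suc p"
       "length (rev A3 @ \<alpha> # rev A2 @ a # \<delta> # \<gamma> # rev C2 @ c # rev C1 @ v # B1 @ \<beta> # B2) \<le> Suc p"
       "length (rev B2 @ \<beta> # rev B1 @ v # A1 @ a # A2 @ \<alpha> # c # C2 @ \<gamma> # \<delta> # D2) \<le> Suc p"
    by (rule frame_walk_length[OF F]; simp add: *)+
  then show False
    using F by (simp add: frame_def)
qed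

lemma edges_from_leg_lt_gt:
  assumes F: "frame v (A1 @ \<alpha> # A2 @ a # A3) (B1 @ \<beta> # B2) (C1 @ c # C2 @ \<gamma> # C3) (D1 @ \<delta> # D2) []"
    and l: "adj \<alpha> \<beta>" "adj \<gamma> \<delta>" "adj \<alpha> c" "adj a \<delta>"
  shows False
proof -
  note * = frame_walks[OF F, unfolded walk_seg] l l(1,2,3,4)[THEN adj_sym] walk_seg walk_rev_start
  have "length (rev A3 @ a # rev A2 @ \<alpha> # rev A1 @ v # C1 @ c # C2 @ \<gamma> # \<delta> # D2) \<le> Suc p"
       "length (rev A3 @ a # rev A2 @ \<alpha> # c # C2 @ \<gamma> # \<delta> # rev D1 @ v # B1 @ \<beta> # B2) \<le> Suc p"
       "length (rev B2 @ \<beta> # rev B1 @ v # A1 @ \<alpha> # A2 @ a # \<delta> # \<gamma> # C3) \<le> Suc p"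
    by (rule frame_walk_length[OF F]; simp add: *)+
  then show False
    using F by (simp add: frame_def)
qed

lemma edges_from_leg_gt_lt:
  assumes F: "frame v (A1 @ a # A2 @ \<alpha> # A3) (B1 @ \<beta> # B2) (C1 @ \<gamma> # C2 @ c # C3) (D1 @ \<delta> # D2) []"
    and l: "adj \<alpha> \<beta>" "adj \<gamma> \<delta>" "adj \<alpha> c" "adj a \<delta>"
  shows False
proof -
  note * = frame_walks[OF F, unfolded walk_seg] l l(1,2,3,4)[THEN adj_sym] walk_seg walk_rev_start
  have "length (rev A3 @ \<alpha> # rev A2 @ a # \<delta> # rev D1 @ v # C1 @ \<gamma> # C2 @ c # C3) \<le> Suc p"
       "length (rev B2 @ \<beta> # rev B1 @ v # A1 @ a # A2 @ \<alpha> # c # rev C2 @ \<gamma> # \<delta> # D2) \<le> Suc p"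
    by (rule frame_walk_length[OF F]; simp add: *)+
  then show False
    using F by (simp add: frame_def)
qed

lemma edges_from_leg_gt_gt:
  assumes F: "frame v (A1 @ \<alpha> # A2 @ a # A3) (B1 @ \<beta> # B2) (C1 @ \<gamma> # C2 @ c # C3) (D1 @ \<delta> # D2) []"
    and l: "adj \<alpha> \<beta>" "adj \<gamma> \<delta>" "adj \<alpha> c" "adj a \<delta>"
  shows False
proof -
  note * = frame_walks[OF F, unfolded walk_seg] l l(1,2,3,4)[THEN adj_sym] walk_seg walk_rev_start
  have "length (rev A3 @ a # rev A2 @ \<alpha> # c # rev C2 @ \<gamma> # rev C1 @ v # D1 @ \<delta> # D2) \<le> Suc p"
       "length (rev B2 @ \<beta> # rev B1 @ v # A1 @ \<alpha> # A2 @ a # \<delta> # \<gamma> # C2 @ c # C3) \<le> Suc p"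
    by (rule frame_walk_length[OF F]; simp add: *)+
  then show False
    using F by (simp add: frame_def)
qed

lemma edges_opposite_lt_lt:
  assumes F: "frame v (A1 @ \<alpha> # A2) (B1 @ b # B2 @ \<beta> # B3) (C1 @ c # C2 @ \<gamma> # C3) (D1 @ \<delta> # D2) []"
    and l: "adj \<alpha> \<beta>" "adj \<gamma> \<delta>" "adj \<alpha> c" "adj b \<delta>"
  shows False
proof -
  note * = frame_walks[OF F, unfolded walk_seg] l l(1,2,3,4)[THEN adj_sym] walk_seg walk_rev_start
  have "length (rev A2 @ \<alpha> # rev A1 @ v # B1 @ b # \<delta> # \<gamma> # C3) \<le> Suc p"
       "length (rev A2 @ \<alpha> # rev A1 @ v # C1 @ c # C2 @ \<gamma> # \<delta> # b # B2 @ \<beta> # B3) \<le> Suc p"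
       "length (rev A2 @ \<alpha> # c # C2 @ \<gamma> # \<delta> # rev D1 @ v # B1 @ b # B2 @ \<beta> # B3) \<le> Suc p"
       "length (rev B3 @ \<beta> # rev B2 @ b # rev B1 @ v # A1 @ \<alpha> # c # C2 @ \<gamma> # \<delta> # D2) \<le> Suc p"
    by (rule frame_walk_length[OF F]; simp add: *)+
  then show False
    using F by (simp add: frame_def)
qed

lemma edges_opposite_lt_gt:
  assumes F: "frame v (A1 @ \<alpha> # A2) (B1 @ \<beta> # B2 @ b # B3) (C1 @ c # C2 @ \<gamma> # C3) (D1 @ \<delta> # D2) []"
    and l: "adj \<alpha> \<beta>" "adj \<gamma> \<delta>" "adj \<alpha> c" "adj b \<delta>"
  shows False
proof -
  note * = frame_walks[OF F, unfolded walk_seg] l l(1,2,3,4)[THEN adj_sym] walk_seg walk_rev_start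
  have "length (rev A2 @ \<alpha> # \<beta> # B2 @ b # \<delta> # rev D1 @ v # C1 @ c # C2 @ \<gamma> # C3) \<le> Suc p"
       "length (rev B3 @ b # rev B2 @ \<beta> # rev B1 @ v # A1 @ \<alpha> # c # C2 @ \<gamma> # \<delta> # D2) \<le> Suc p"
    by (rule frame_walk_length[OF F]; simp add: *)+
  then show False
    using F by (simp add: frame_def)
qed

lemma edges_opposite_gt_gt:
  assumes F: "frame v (A1 @ \<alpha> # A2) (B1 @ \<beta> # B2 @ b # B3) (C1 @ \<gamma> # C2 @ c # C3) (D1 @ \<delta> # D2) []"
    and l: "adj \<alpha> \<beta>" "adj \<gamma> \<delta>" "adj \<alpha> c" "adj b \<delta>"
  shows False
proof -
  note * = frame_walks[OF F, unfolded walk_seg] l l(1,2,3,4)[THEN adj_sym] walk_seg walk_rev_start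
  have "length (rev A2 @ \<alpha> # rev A1 @ v # B1 @ \<beta> # B2 @ b # \<delta> # \<gamma> # C2 @ c # C3) \<le> Suc p"
       "length (rev A2 @ \<alpha> # rev A1 @ v # C1 @ \<gamma> # \<delta> # b # B3) \<le> Suc p"
       "length (rev A2 @ \<alpha> # c # rev C2 @ \<gamma> # \<delta> # rev D1 @ v # B1 @ \<beta> # B2 @ b # B3) \<le> Suc p"
       "length (rev B3 @ b # rev B2 @ \<beta> # rev B1 @ v # A1 @ \<alpha> # c # rev C2 @ \<gamma> # \<delta> # D2) \<le> Suc p"
    by (rule frame_walk_length[OF F]; simp add: *)+
  then show False
    using F by (simp add: frame_def)
qed

section \<open>Symmetries: exchanging the legs of a path, or the two paths\<close>

lemma frame_swap_left: "frame v A B C D L \<Longrightarrow> frame v B A C D L"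
  by (auto simp: frame_def)

lemma frame_swap_right: "frame v A B C D L \<Longrightarrow> frame v A B D C L"
  by (auto simp: frame_def)

lemma frame_swap_sides: "frame v A B C D L \<Longrightarrow> frame v C D A B L"
  by (auto simp: frame_def)

lemma frame_replace_links:
  assumes "frame v A B C D L" "distinct L'" "set L' \<subseteq> set L"
  shows "frame v A B C D L'"
  using assms by (auto simp: frame_def)

lemma frame_distinct_links: "frame v A B C D L \<Longrightarrow> distinct L"
  by (simp add: frame_def)

text \<open>\<open>R\<close> and \<open>S\<close> are links within the two paths. \<open>L\<close>
  reserves vertices for links across, so that their disjointness from everything else is already
  part of the frame.\<close>

definition linked ::
  "'a \<Rightarrow> 'a list \<Rightarrow> 'a list \<Rightarrow> 'a list \<Rightarrow> 'a list \<Rightarrow> 'a \<Rightarrow> 'a list \<Rightarrow> 'a \<Rightarrow> 'a \<Rightarrow> 'a list \<Rightarrow> 'a \<Rightarrow> 'a list \<Rightarrow> bool"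
  where "linked v A B C D \<alpha> R \<beta> \<gamma> S \<delta> L \<longleftrightarrow> frame v A B C D (R @ S @ L) \<and>
    \<alpha> \<in> set A \<and> \<beta> \<in> set B \<and> \<gamma> \<in> set C \<and> \<delta> \<in> set D \<and> seg \<alpha> R \<beta> \<and> seg \<gamma> S \<delta>"

lemma linked_swap_left:
  assumes "linked v A B C D \<alpha> R \<beta> \<gamma> S \<delta> L"
  shows "linked v B A C D \<beta> (rev R) \<alpha> \<gamma> S \<delta> L"
proof -
  have F: "frame v B A C D (R @ S @ L)"
    using assms by (simp add: linked_def frame_swap_left)
  have "frame v B A C D (rev R @ S @ L)"
    by (rule frame_replace_links[OF F]) (use frame_distinct_links[OF F] in auto)
  then show ?thesis
    using assms by (simp add: linked_def)
qed

lemma linked_swap_right: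
  assumes "linked v A B C D \<alpha> R \<beta> \<gamma> S \<delta> L"
  shows "linked v A B D C \<alpha> R \<beta> \<delta> (rev S) \<gamma> L"
proof -
  have F: "frame v A B D C (R @ S @ L)"
    using assms by (simp add: linked_def frame_swap_right)
  have "frame v A B D C (R @ rev S @ L)"
    by (rule frame_replace_links[OF F]) (use frame_distinct_links[OF F] in auto)
  then show ?thesis
    using assms by (simp add: linked_def)
qed

lemma linked_swap_sides:
  assumes "linked v A B C D \<alpha> R \<beta> \<gamma> S \<delta> L"
  shows "linked v C D A B \<gamma> S \<delta> \<alpha> R \<beta> L"
proof -
  have F: "frame v C D A B (R @ S @ L)"
    using assms by (simp add: linked_def frame_swap_sides)
  have "frame v C D A B (S @ R @ L)"
    by (rule frame_replace_links[OF F]) (use frame_distinct_links[OF F] in auto)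
  then show ?thesis
    using assms by (simp add: linked_def)
qed

lemma linked_replace_links:
  assumes "linked v A B C D \<alpha> R \<beta> \<gamma> S \<delta> L" "distinct L'" "set L' \<subseteq> set L"
  shows "linked v A B C D \<alpha> R \<beta> \<gamma> S \<delta> L'"
proof -
  have F: "frame v A B C D (R @ S @ L)"
    using assms by (simp add: linked_def)
  have "frame v A B C D (R @ S @ L')"
    by (rule frame_replace_links[OF F]) (use assms frame_distinct_links[OF F] in auto)
  then show ?thesis
    using assms by (simp add: linked_def)
qed

lemma split_list_two:
  assumes "x \<in> set xs" "y \<in> set xs" "x \<noteq> y"
  obtains xs1 xs2 xs3 where "xs = xs1 @ x # xs2 @ y # xs3"
    | xs1 xs2 xs3 where "xs = xs1 @ y # xs2 @ x # xs3"
proof -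
  obtain ys zs where xs: "xs = ys @ x # zs"
    using assms(1) by (meson split_list)
  with assms consider "y \<in> set ys" | "y \<in> set zs"
    by auto
  then show thesis
  proof cases
    case 1
    then obtain ys1 ys2 where "ys = ys1 @ y # ys2"
      by (meson split_list)
    then show thesis
      using xs that(2) by simp
  next
    case 2
    then obtain zs1 zs2 where "zs = zs1 @ y # zs2"
      by (meson split_list)
    then show thesis
      using xs that(1) by simp
  qed
qed

section \<open>The excluded links, independently of the order along the legs\<close>

lemma link_between_first_legs:
  assumes l: "linked v A B C D \<alpha> R \<beta> \<gamma> S \<delta> L" and L: "seg x L y"
    and xy: "x \<in> set A" "y \<in> set C"
  shows "(x = \<alpha> \<or> y = \<gamma>) \<and> (x = \<alpha> \<and> y = \<gamma> \<or> R = [] \<and> S = [] \<and> L = [])"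
proof -
  note F = l[unfolded linked_def]
  obtain B1 B2 D1 D2 where BD: "B = B1 @ \<beta> # B2" "D = D1 @ \<delta> # D2"
    using F by (meson split_list)
  have F': "frame v C D A B (S @ R @ rev L)" "seg y (rev L) x"
    using linked_replace_links[OF linked_swap_sides[OF l], of "rev L"] frame_distinct_links[of v A B C D "R @ S @ L"] F L
    by (auto simp: linked_def)
  consider "x = \<alpha>" "y = \<gamma>" | "x = \<alpha>" "y \<noteq> \<gamma>" | "x \<noteq> \<alpha>" "y = \<gamma>" | "x \<noteq> \<alpha>" "y \<noteq> \<gamma>"
    by blast
  then show ?thesis
  proof cases
    case 2
    obtain A1 A2 where A: "A = A1 @ \<alpha> # A2"
      using F by (meson split_list)
    from xy F 2 have "y \<in> set C" "\<gamma> \<in> set C" "y \<noteq> \<gamma>" by auto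
    then show ?thesis
    proof (cases rule: split_list_two)
      case 1
      then show ?thesis
        using link_from_mark_lt F L A BD \<open>x = \<alpha>\<close> by blast
    next
      case 2
      then show ?thesis
        using link_from_mark_gt F L A BD \<open>x = \<alpha>\<close> by blast
    qed
  next
    case 3
    obtain C1 C2 where C: "C = C1 @ \<gamma> # C2"
      using F by (meson split_list)
    from xy F 3 have "x \<in> set A" "\<alpha> \<in> set A" "x \<noteq> \<alpha>" by auto
    then show ?thesis
    proof (cases rule: split_list_two)
      case 1
      then show ?thesis
        using link_from_mark_lt F F' C BD \<open>y = \<gamma>\<close> by (metis rev_is_Nil_conv)
    next
      case 2
      then show ?thesis
        using link_from_mark_gt F F' C BD \<open>y = \<gamma>\<close> by (metis rev_is_Nil_conv)
    qed
  next
    case 4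
    from xy F 4 have x: "x \<in> set A" "\<alpha> \<in> set A" "x \<noteq> \<alpha>" and y: "y \<in> set C" "\<gamma> \<in> set C" "y \<noteq> \<gamma>" by auto
    from x have False
    proof (cases rule: split_list_two)
      case A: 1
      from y show False
      proof (cases rule: split_list_two)
        case 1
        then show ?thesis using link_off_marks_lt_lt F L A BD by blast
      next
        case 2
        then show ?thesis using link_off_marks_lt_gt F L A BD by blast
      qed
    next
      case A: 2
      from y show False
      proof (cases rule: split_list_two)
        case 1
        \<comment> \<open>The mixed position with the two paths exchanged, hence the reversed
          link.\<close>
        then show ?thesis using link_off_marks_lt_gt[of v _ y _ \<gamma> _ D1 \<delta> D2 _ \<alpha> _ x _ B1 \<beta> B2 S R "rev L"] F F' A BD by blast
      next
        case 2
        then show ?thesis using link_off_marks_gt_gt F L A BD by blast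
      qed
    qed
    then show ?thesis ..
  qed auto
qed

lemma no_link_from_link_to_leg:
  assumes l: "linked v A B C D \<alpha> R \<beta> \<gamma> S \<delta> L" and L: "seg x L y"
    and xy: "x \<in> set R" "y \<in> set C"
  shows False
proof -
  note F = l[unfolded linked_def]
  obtain A1 A2 B1 B2 D1 D2 where ABD: "A = A1 @ \<alpha> # A2" "B = B1 @ \<beta> # B2" "D = D1 @ \<delta> # D2"
    using F by (meson split_list)
  obtain R1 R2 where R: "R = R1 @ x # R2"
    using xy by (meson split_list)
  note F' = F[unfolded ABD R]
  show False
  proof (cases "y = \<gamma>")
    case True
    obtain C1 C2 where "C = C1 @ \<gamma> # C2"
      using F by (meson split_list)
    then show ?thesis
      using link_from_link_eq F' L True by blast
  next
    case False
    with xy F have "y \<in> set C" "\<gamma> \<in> set C" "y \<noteq> \<gamma>" by auto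
    then show ?thesis
    proof (cases rule: split_list_two)
      case 1
      then show ?thesis using link_from_link_lt F' L by blast
    next
      case 2
      then show ?thesis using link_from_link_gt F' L by blast
    qed
  qed
qed

lemma no_link_between_links:
  assumes l: "linked v A B C D \<alpha> R \<beta> \<gamma> S \<delta> L" and L: "seg x L y"
    and xy: "x \<in> set R" "y \<in> set S"
  shows False
proof -
  note F = l[unfolded linked_def]
  obtain A1 A2 B1 B2 C1 C2 D1 D2 where
    ABCD: "A = A1 @ \<alpha> # A2" "B = B1 @ \<beta> # B2" "C = C1 @ \<gamma> # C2" "D = D1 @ \<delta> # D2"
    using F by (meson split_list)
  obtain R1 R2 S1 S2 where "R = R1 @ x # R2" "S = S1 @ y # S2"
    using xy by (meson split_list)
  then show False
    using link_from_link_to_link F[unfolded ABCD] L by blast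
qed

text \<open>The symmetries reduce all pairs of legs to \<open>A\<close> and \<open>C\<close>. The
  outcome drives everything after it: a link across either joins two marks, or has exactly one
  marked end and all three links are edges.\<close>

lemma cross_link:
  assumes l: "linked v A B C D \<alpha> R \<beta> \<gamma> S \<delta> L" and L: "seg x L y"
    and x: "x \<in> set A \<union> set B \<union> set R" and y: "y \<in> set C \<union> set D \<union> set S"
  shows "x \<in> set A \<union> set B \<and> y \<in> set C \<union> set D \<and> (x \<in> {\<alpha>, \<beta>} \<or> y \<in> {\<gamma>, \<delta>}) \<and>
    (x \<in> {\<alpha>, \<beta>} \<and> y \<in> {\<gamma>, \<delta>} \<or> R = [] \<and> S = [] \<and> L = [])"
proof -
  note l2 = linked_swap_left[OF l]
  note l3 = linked_swap_right[OF l]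
  note l4 = linked_swap_right[OF l2]
  have L': "seg y (rev L) x" "distinct (rev L)"
    using L l by (auto simp: linked_def frame_def)
  note s = linked_replace_links[OF linked_swap_sides[OF l] L'(2)] linked_replace_links[OF linked_swap_sides[OF l2] L'(2)]
  have "x \<notin> set R"
  proof
    assume xR: "x \<in> set R"
    consider "y \<in> set C" | "y \<in> set D" | "y \<in> set S"
      using y by blast
    then show False
      by cases (use no_link_from_link_to_leg[OF l L xR] no_link_from_link_to_leg[OF l3 L xR]
          no_link_between_links[OF l L xR] in blast)+
  qed
  moreover have "y \<notin> set S"
  proof
    assume yS: "y \<in> set S"
    consider "x \<in> set A" | "x \<in> set B" | "x \<in> set R"
      using x by blast
    then show False
      by cases (use no_link_from_link_to_leg[OF s(1) L'(1) yS] no_link_from_link_to_leg[OF s(2) L'(1) yS]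
          no_link_between_links[OF l L _ yS] in auto)+
  qed
  ultimately have "x \<in> set A \<or> x \<in> set B" "y \<in> set C \<or> y \<in> set D"
    using x y by blast+
  then show ?thesis
    using link_between_first_legs[OF l L] link_between_first_legs[OF l2 L]
      link_between_first_legs[OF l3 L] link_between_first_legs[OF l4 L] by auto
qed

lemma linked_edges:
  assumes "linked v A B C D \<alpha> [] \<beta> \<gamma> [] \<delta> []"
  shows "frame v A B C D []" "adj \<alpha> \<beta>" "adj \<gamma> \<delta>"
    "\<alpha> \<in> set A" "\<beta> \<in> set B" "\<gamma> \<in> set C" "\<delta> \<in> set D"
  using assms by (simp_all add: linked_def)

lemma no_edges_to_same_leg:
  assumes l: "linked v A B C D \<alpha> [] \<beta> \<gamma> [] \<delta> []" and "adj \<alpha> c" "adj \<beta> c'"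
    and c: "c \<in> set C" "c' \<in> set C" "c \<noteq> \<gamma>" "c' \<noteq> \<gamma>" "c \<noteq> c'"
  shows False
proof -
  note F = linked_edges[OF l] and F' = linked_edges[OF linked_swap_left[OF l, simplified]]
  obtain A1 A2 B1 B2 D1 D2 where "A = A1 @ \<alpha> # A2" "B = B1 @ \<beta> # B2" "D = D1 @ \<delta> # D2"
    using F by (meson split_list)
  note F = F(1-3)[unfolded this] assms(2,3) and F' = F'(1-3)[unfolded this] assms(3,2)
  obtain C1 C2 where C: "C = C1 @ \<gamma> # C2"
    using linked_edges(6)[OF l] by (meson split_list)
  with c consider "c \<in> set C1" "c' \<in> set C1" | "c \<in> set C1" "c' \<in> set C2"
    | "c \<in> set C2" "c' \<in> set C1" | "c \<in> set C2" "c' \<in> set C2"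
    by auto
  then show False
  proof cases
    case 1
    then show False using \<open>c \<noteq> c'\<close>
    proof (cases rule: split_list_two)
      case 1
      then show ?thesis using edges_same_leg_lt_lt F C by fastforce
    next
      case 2
      then show ?thesis using edges_same_leg_lt_lt F' C by fastforce
    qed
  next
    case 2
    then obtain X1 X2 X3 X4 where "C1 = X1 @ c # X2" "C2 = X3 @ c' # X4"
      by (meson split_list)
    then show False using edges_same_leg_lt_gt F C by fastforce
  next
    case 3
    then obtain X1 X2 X3 X4 where "C1 = X1 @ c' # X2" "C2 = X3 @ c # X4"
      by (meson split_list)
    then show False using edges_same_leg_lt_gt F' C by fastforce
  next
    case 4
    then show False using \<open>c \<noteq> c'\<close>
    proof (cases rule: split_list_two)
      case 1
      then show ?thesis using edges_same_leg_gt_gt F C by fastforce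
    next
      case 2
      then show ?thesis using edges_same_leg_gt_gt F' C by fastforce
    qed
  qed
qed

lemma no_edges_to_legs:
  assumes l: "linked v A B C D \<alpha> [] \<beta> \<gamma> [] \<delta> []" and "adj \<alpha> c" "adj \<beta> d"
    and c: "c \<in> set C" "c \<noteq> \<gamma>" and d: "d \<in> set D" "d \<noteq> \<delta>"
  shows False
proof -
  note F = linked_edges[OF l]
    and F' = linked_edges[OF linked_swap_right[OF linked_swap_left[OF l], simplified]]
  obtain A1 A2 B1 B2 where "A = A1 @ \<alpha> # A2" "B = B1 @ \<beta> # B2"
    using F by (meson split_list)
  note e = F(1-3)[unfolded this] assms(2,3) and e' = F'(1-3)[unfolded this] assms(3,2)
  from c(1) F(6) c(2) show False
  proof (cases rule: split_list_two)
    case C: 1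
    from d(1) F(7) d(2) show False
    proof (cases rule: split_list_two)
      case 1
      then show ?thesis using edges_to_legs_lt_lt e C by blast
    next
      case 2
      then show ?thesis using edges_to_legs_lt_gt e C by blast
    qed
  next
    case C: 2
    from d(1) F(7) d(2) show False
    proof (cases rule: split_list_two)
      case 1
      then show ?thesis using edges_to_legs_lt_gt e' C by blast
    next
      case 2
      then show ?thesis using edges_to_legs_gt_gt e C by blast
    qed
  qed
qed

lemma no_edges_from_leg:
  assumes l: "linked v A B C D \<alpha> [] \<beta> \<gamma> [] \<delta> []" and "adj \<alpha> c" "adj a \<delta>"
    and c: "c \<in> set C" "c \<noteq> \<gamma>" and a: "a \<in> set A" "a \<noteq> \<alpha>"
  shows False
proof -
  note F = linked_edges[OF l]
  obtain B1 B2 D1 D2 where "B = B1 @ \<beta> # B2" "D = D1 @ \<delta> # D2"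
    using F by (meson split_list)
  note e = F(1-3)[unfolded this] assms(2,3)
  from c(1) F(6) c(2) show False
  proof (cases rule: split_list_two)
    case C: 1
    from a(1) F(4) a(2) show False
    proof (cases rule: split_list_two)
      case 1
      then show ?thesis using edges_from_leg_lt_lt e C by blast
    next
      case 2
      then show ?thesis using edges_from_leg_lt_gt e C by blast
    qed
  next
    case C: 2
    from a(1) F(4) a(2) show False
    proof (cases rule: split_list_two)
      case 1
      then show ?thesis using edges_from_leg_gt_lt e C by blast
    next
      case 2
      then show ?thesis using edges_from_leg_gt_gt e C by blast
    qed
  qed
qed

lemma no_edges_at_partners:
  assumes l: "linked v A B C D \<alpha> [] \<beta> \<gamma> [] \<delta> []" and "adj \<alpha> c" "adj b \<gamma>"
    and c: "c \<in> set C" "c \<noteq> \<gamma>" and b: "b \<in> set B" "b \<noteq> \<beta>"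
  shows False
  using no_edges_from_leg[OF linked_swap_sides[OF linked_swap_left[OF l, simplified]], of b c]
    assms adj_sym by blast

lemma no_edges_opposite:
  assumes l: "linked v A B C D \<alpha> [] \<beta> \<gamma> [] \<delta> []" and "adj \<alpha> c" "adj b \<delta>"
    and c: "c \<in> set C" "c \<noteq> \<gamma>" and b: "b \<in> set B" "b \<noteq> \<beta>"
  shows False
proof -
  note F = linked_edges[OF l]
    and F' = linked_edges[OF linked_swap_sides[OF linked_swap_right[OF linked_swap_left[OF l]], simplified]]
  obtain A1 A2 D1 D2 where "A = A1 @ \<alpha> # A2" "D = D1 @ \<delta> # D2"
    using F by (meson split_list)
  note e = F(1-3)[unfolded this] assms(2,3)
    and e' = F'(1-3)[unfolded this] adj_sym[OF assms(3)] adj_sym[OF assms(2)]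
  from c(1) F(6) c(2) show False
  proof (cases rule: split_list_two)
    case C: 1
    from b(1) F(5) b(2) show False
    proof (cases rule: split_list_two)
      case 1
      then show ?thesis using edges_opposite_lt_lt e C by blast
    next
      case 2
      then show ?thesis using edges_opposite_lt_gt e C by blast
    qed
  next
    case C: 2
    from b(1) F(5) b(2) show False
    proof (cases rule: split_list_two)
      case 1
      then show ?thesis using edges_opposite_lt_gt e' C by blast
    next
      case 2
      then show ?thesis using edges_opposite_gt_gt e C by blast
    qed
  qed
qed

lemma mark_link_is_edge:
  assumes l: "linked v A B C D \<alpha> [] \<beta> \<gamma> [] \<delta> L" and "seg \<alpha> L \<gamma>" "adj \<beta> c"
    and c: "c \<in> set C" "c \<noteq> \<gamma>"
  shows "L = []"
proof -
  have F: "frame v A B C D L" "adj \<alpha> \<beta>" "adj \<gamma> \<delta>" "\<alpha> \<in> set A" "\<beta> \<in> set B" "\<gamma> \<in> set C" "\<delta> \<in> set D"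
    using l by (simp_all add: linked_def)
  obtain A1 A2 B1 B2 D1 D2 where "A = A1 @ \<alpha> # A2" "B = B1 @ \<beta> # B2" "D = D1 @ \<delta> # D2"
    using F by (meson split_list)
  note e = F(1-3)[unfolded this] assms(2,3)
  from c(1) F(6) c(2) show ?thesis
  proof (cases rule: split_list_two)
    case 1
    then show ?thesis using mark_link_and_edge_lt e by blast
  next
    case 2
    then show ?thesis using mark_link_and_edge_gt e by blast
  qed
qed

lemma no_mark_link_and_far_edge:
  assumes l: "linked v A B C D \<alpha> [] \<beta> \<gamma> [] \<delta> L" and "seg \<alpha> L \<gamma>" "adj \<beta> d"
    and d: "d \<in> set D" "d \<noteq> \<delta>"
  shows False
proof -
  have F: "frame v A B C D L" "adj \<alpha> \<beta>" "adj \<gamma> \<delta>" "\<alpha> \<in> set A" "\<beta> \<in> set B" "\<gamma> \<in> set C" "\<delta> \<in> set D"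
    using l by (simp_all add: linked_def)
  obtain A1 A2 B1 B2 C1 C2 where "A = A1 @ \<alpha> # A2" "B = B1 @ \<beta> # B2" "C = C1 @ \<gamma> # C2"
    using F by (meson split_list)
  note e = F(1-3)[unfolded this] assms(2,3)
  from d(1) F(7) d(2) show ?thesis
  proof (cases rule: split_list_two)
    case 1
    then show ?thesis using mark_link_and_far_edge_lt e by blast
  next
    case 2
    then show ?thesis using mark_link_and_far_edge_gt e by blast
  qed
qed

text \<open>The second part encodes that the graph without \<open>v\<close> is 2-connected, as far as the legs can see it.\<close>

definition tied :: "'a \<Rightarrow> 'a list \<Rightarrow> 'a list \<Rightarrow> 'a list \<Rightarrow> 'a list \<Rightarrow> bool" where
  "tied v A B C D \<longleftrightarrow> 2 \<le> length A \<and> 2 \<le> length B \<and> 2 \<le> length C \<and> 2 \<le> length D \<and>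
    (\<forall>z X. let U = set (A @ B @ C @ D) in
      z \<in> U \<longrightarrow> X \<subseteq> U - {z} \<longrightarrow> X \<noteq> {} \<longrightarrow> U - X - {z} \<noteq> {} \<longrightarrow>
      (\<exists>x \<in> X. \<exists>y \<in> U - X - {z}. \<exists>N. seg x N y \<and> frame v A B C D N))"

lemma tied_swap_left:
  assumes "tied v A B C D"
  shows "tied v B A C D"
proof -
  have U: "set (B @ A @ C @ D) = set (A @ B @ C @ D)"
    by auto
  have "frame v B A C D = frame v A B C D"
    using frame_swap_left by (intro ext iffI) blast+
  with assms show ?thesis
    unfolding tied_def U Let_def by simp
qed

lemma tied_swap_right:
  assumes "tied v A B C D"
  shows "tied v A B D C"
proof -
  have U: "set (A @ B @ D @ C) = set (A @ B @ C @ D)"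
    by auto
  have "frame v A B D C = frame v A B C D"
    using frame_swap_right by (intro ext iffI) blast+
  with assms show ?thesis
    unfolding tied_def U Let_def by simp
qed

lemma tied_swap_sides:
  assumes "tied v A B C D"
  shows "tied v C D A B"
proof -
  have U: "set (C @ D @ A @ B) = set (A @ B @ C @ D)"
    by auto
  have "frame v C D A B = frame v A B C D"
    using frame_swap_sides by (intro ext iffI) blast+
  with assms show ?thesis
    unfolding tied_def U Let_def by simp
qed

lemma tied_obtain:
  assumes "tied v A B C D" "z \<in> set (A @ B @ C @ D)" "X \<subseteq> set (A @ B @ C @ D) - {z}" "X \<noteq> {}"
    "set (A @ B @ C @ D) - X - {z} \<noteq> {}"
  obtains x y N where "x \<in> X" "y \<in> set A \<union> set B \<union> set C \<union> set D - X - {z}" "seg x N y" "frame v A B C D N"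
proof -
  have "\<exists>x \<in> X. \<exists>y \<in> set (A @ B @ C @ D) - X - {z}. \<exists>N. seg x N y \<and> frame v A B C D N"
    using assms unfolding tied_def Let_def by blast
  then show thesis
    using that by (auto simp: Un_assoc)
qed

lemma linked_swaps:
  assumes "linked v A B C D \<alpha> [] \<beta> \<gamma> [] \<delta> L"
  shows "linked v B A C D \<beta> [] \<alpha> \<gamma> [] \<delta> L" "linked v A B D C \<alpha> [] \<beta> \<delta> [] \<gamma> L"
    "linked v C D A B \<gamma> [] \<delta> \<alpha> [] \<beta> L"
  using linked_swap_left[OF assms] linked_swap_right[OF assms] linked_swap_sides[OF assms] by simp_all

lemma linked_disjoint:
  assumes "linked v A B C D \<alpha> R \<beta> \<gamma> S \<delta> L"
  shows "set A \<inter> set B = {}" "set A \<inter> set C = {}" "set A \<inter> set D = {}"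
    "set B \<inter> set C = {}" "set B \<inter> set D = {}" "set C \<inter> set D = {}"
    "\<alpha> \<in> set A" "\<beta> \<in> set B" "\<gamma> \<in> set C" "\<delta> \<in> set D"
proof -
  have "distinct (v # A @ B @ C @ D @ R @ S @ L)"
    using assms unfolding linked_def frame_def by blast
  then show "set A \<inter> set B = {}" "set A \<inter> set C = {}" "set A \<inter> set D = {}"
    "set B \<inter> set C = {}" "set B \<inter> set D = {}" "set C \<inter> set D = {}"
    by (simp_all add: Int_Un_distrib)
  show "\<alpha> \<in> set A" "\<beta> \<in> set B" "\<gamma> \<in> set C" "\<delta> \<in> set D"
    using assms by (simp_all add: linked_def)
qed

lemma frame_linked:
  assumes "frame v A B C D L" "linked v A B C D \<alpha> [] \<beta> \<gamma> [] \<delta> M"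
  shows "linked v A B C D \<alpha> [] \<beta> \<gamma> [] \<delta> L"
  using assms by (simp add: linked_def)

text \<open>A link between \<open>A\<close> and \<open>B\<close> found later may replace the chosen
  one. This moves the marks, so edges across that were harmless can lose their marked ends.\<close>

lemma relink:
  assumes "frame v A B C D N" "seg x N y" "x \<in> set A" "y \<in> set B"
    and "linked v A B C D \<alpha> [] \<beta> \<gamma> [] \<delta> M"
  shows "linked v A B C D x N y \<gamma> [] \<delta> []"
  using assms by (simp add: linked_def)

lemma leg_minus_nonempty:
  assumes "2 \<le> length A" "distinct A"
  shows "set A - {x} \<noteq> {}"
proof
  assume "set A - {x} = {}"
  then have "card (set A) \<le> card {x}"
    by (intro card_mono) auto
  with assms show False
    by (simp add: distinct_card)
qed

section \<open>Tight configurations, excluded by a further link\<close>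

text \<open>The inequalities of \<open>mark_link_is_edge\<close> stop at equality here. A link that
  leaves the rest of \<open>A\<close> without using \<open>\<alpha>\<close> decides: ending in
  \<open>B\<close>, it takes over the role of the edge \<open>\<alpha>\<beta>\<close>; ending on the
  other path, it is an edge to a mark. Either way a pair of edges excluded by length
  appears.\<close>

lemma no_mark_edge_and_edge:
  assumes l: "linked v A B C D \<alpha> [] \<beta> \<gamma> [] \<delta> []" and t: "tied v A B C D"
    and e: "adj \<alpha> \<gamma>" "adj \<beta> c" and c: "c \<in> set C" "c \<noteq> \<gamma>"
  shows False
proof -
  note d = linked_disjoint[OF l]
  have "set A - {\<alpha>} \<noteq> {}"
    using t l by (intro leg_minus_nonempty) (auto simp: tied_def linked_def frame_def)
  moreover have "\<beta> \<in> set (A @ B @ C @ D) - (set A - {\<alpha>}) - {\<alpha>}"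
    using d by auto
  ultimately obtain x y N where x: "x \<in> set A - {\<alpha>}"
    and y: "y \<in> set A \<union> set B \<union> set C \<union> set D - (set A - {\<alpha>}) - {\<alpha>}"
    and N: "seg x N y" "frame v A B C D N"
    using d by - (rule tied_obtain[OF t, of \<alpha> "set A - {\<alpha>}"]; auto)
  have partners: False if "linked v A B C D x [] \<beta> \<gamma> [] \<delta> []"
    using no_edges_at_partners[OF linked_swaps(1)[OF that] e(2) e(1)] c d x by blast
  consider "y \<in> set B" | "y \<in> set C \<union> set D"
    using y by blast
  then show False
  proof cases
    case 1
    have n: "linked v A B C D x N y \<gamma> [] \<delta> []"
      using relink N x 1 l by blast
    \<comment> \<open>After relinking, \<open>\<alpha>\<close> is no mark, so the edge
      \<open>\<alpha>\<gamma>\<close> has only one marked end and \<open>N\<close> must be empty. As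
      \<open>c\<close> is no mark, the edge \<open>\<beta>c\<close> then forces
      \<open>\<beta>\<close> to remain one.\<close>
    have "N = []"
      using cross_link[OF n, of \<alpha> \<gamma>] e x d 1 by auto
    moreover have "y = \<beta>"
      using cross_link[OF n, of \<beta> c] e x d 1 c by auto
    ultimately show False
      using n partners by simp
  next
    case 2
    have n: "linked v A B C D \<alpha> [] \<beta> \<gamma> [] \<delta> N"
      using frame_linked N l by blast
    have "N = []" "y = \<gamma> \<or> y = \<delta>"
      using cross_link[OF n, of x y] N x 2 d by auto
    then have "adj x \<gamma> \<or> adj x \<delta>"
      using N by auto
    then show False
      using no_edges_at_partners[OF linked_swaps(1)[OF l] e(2)] no_edges_opposite[OF linked_swaps(1)[OF l] e(2)]
        c x by blast
  qed
qed

text \<open>The marks form a 4-cycle, the tight case of \<open>two_mark_links\<close>. Again a link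
  leaves the rest of \<open>A\<close>; it replaces the edge \<open>\<alpha>\<beta>\<close> or is an
  edge to \<open>\<gamma>\<close> or \<open>\<delta>\<close>, and each alternative is already
  excluded.\<close>

lemma no_mark_edges:
  assumes l: "linked v A B C D \<alpha> [] \<beta> \<gamma> [] \<delta> []" and t: "tied v A B C D"
    and e: "adj \<alpha> \<gamma>" "adj \<beta> \<delta>"
  shows False
proof -
  note d = linked_disjoint[OF l]
  have "set A - {\<alpha>} \<noteq> {}"
    using t l by (intro leg_minus_nonempty) (auto simp: tied_def linked_def frame_def)
  moreover have "\<beta> \<in> set (A @ B @ C @ D) - (set A - {\<alpha>}) - {\<alpha>}"
    using d by auto
  ultimately obtain x y N where x: "x \<in> set A - {\<alpha>}"
    and y: "y \<in> set A \<union> set B \<union> set C \<union> set D - (set A - {\<alpha>}) - {\<alpha>}"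
    and N: "seg x N y" "frame v A B C D N"
    using d by - (rule tied_obtain[OF t, of \<alpha> "set A - {\<alpha>}"]; auto)
  have far: False if "linked v A B C D \<alpha>' [] \<beta> \<gamma> [] \<delta> []" "adj z \<gamma>" "z \<in> set A - {\<alpha>'}" for z \<alpha>'
  proof -
    \<comment> \<open>With \<open>D\<close> and \<open>C\<close> read as the first path, the edge
      \<open>\<delta>\<beta>\<close> joins marks and \<open>\<gamma>z\<close> goes to the far
      leg.\<close>
    have "linked v D C B A \<delta> [] \<gamma> \<beta> [] \<alpha>' []"
      using linked_swaps(1)[OF linked_swaps(3)[OF linked_swaps(1)[OF that(1)]]] .
    from no_mark_link_and_far_edge[OF this, of z] show False
      using that e adj_sym by auto
  qed
  consider "y \<in> set B" | "y \<in> set C \<union> set D"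
    using y by blast
  then show False
  proof cases
    case 1
    have n: "linked v A B C D x N y \<gamma> [] \<delta> []"
      using relink N x 1 l by blast
    have "N = []"
      using cross_link[OF n, of \<alpha> \<gamma>] e x d 1 by auto
    then have n: "linked v A B C D x [] y \<gamma> [] \<delta> []"
      using n by simp
    show False
    proof (cases "y = \<beta>")
      case True
      then show False
        using far[of x \<alpha>] n x d e by blast
    next
      case False
      then show False
        using no_edges_to_legs[OF linked_swaps(3)[OF n], of \<alpha> \<beta>] e adj_sym x d by blast
    qed
  next
    case 2
    have n: "linked v A B C D \<alpha> [] \<beta> \<gamma> [] \<delta> N"
      using frame_linked N l by blast
    have "N = []" "y = \<gamma> \<or> y = \<delta>"
      using cross_link[OF n, of x y] N x 2 d by auto
    then consider "adj x \<gamma>" | "adj x \<delta>"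
      using N by auto
    then show False
    proof cases
      case 1
      then show False
        using far l x by blast
    next
      case 2
      then show False
        using no_mark_edge_and_edge[OF linked_swaps(3)[OF l] tied_swap_sides[OF t], of x] e adj_sym x by blast
    qed
  qed
qed

text \<open>Up to symmetry, the only pair of vertex-disjoint edges with one marked end each that no
  length inequality above covers directly. The extra link leaves the whole leg \<open>B\<close> and
  avoids \<open>\<alpha>\<close>.\<close>

lemma no_crossed_edges:
  assumes l: "linked v A B C D \<alpha> [] \<beta> \<gamma> [] \<delta> []" and t: "tied v A B C D"
    and e: "adj \<alpha> c" "adj a \<gamma>" and c: "c \<in> set C" "c \<noteq> \<gamma>" and a: "a \<in> set A" "a \<noteq> \<alpha>"
  shows False
proof -
  note d = linked_disjoint[OF l]
  have "set B \<noteq> {}" "set B \<subseteq> set (A @ B @ C @ D) - {\<alpha>}" "\<gamma> \<in> set (A @ B @ C @ D) - set B - {\<alpha>}"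
    using d by auto
  then obtain x y N where x: "x \<in> set B"
    and y: "y \<in> set A \<union> set B \<union> set C \<union> set D - set B - {\<alpha>}"
    and N: "seg x N y" "frame v A B C D N"
    using d by - (rule tied_obtain[OF t, of \<alpha> "set B"]; auto)
  consider "y \<in> set A" | "y \<in> set C \<union> set D"
    using y by blast
  then show False
  proof cases
    case 1
    have "frame v B A C D N"
      using N frame_swap_left by blast
    then have n: "linked v B A C D x N y \<gamma> [] \<delta> []"
      using relink N x 1 linked_swaps(1)[OF l] by blast
    \<comment> \<open>With the marks moved to \<open>x\<close> and \<open>y\<close>, the edge
      \<open>\<alpha>c\<close> has no marked end.\<close>
    show False
      using cross_link[OF n, of \<alpha> c] e x y d c by auto
  next
    case y': 2
    have n: "linked v A B C D \<alpha> [] \<beta> \<gamma> [] \<delta> N"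
      using frame_linked N l by blast
    note cr = cross_link[OF n, of x y]
    show False
    proof (cases "x = \<beta>")
      case False
      have "N = []" "y = \<gamma> \<or> y = \<delta>"
        using cr N x y' d False by auto
      then have "adj x \<gamma> \<or> adj x \<delta>"
        using N by auto
      then show False
        using no_edges_at_partners[OF l e(1)] no_edges_opposite[OF l e(1)] c x False by blast
    next
      case True
      consider "y = \<gamma>" | "y = \<delta>" | "y \<in> set C" "y \<notin> {\<gamma>, \<delta>}" | "y \<in> set D" "y \<notin> {\<gamma>, \<delta>}"
        using y' by blast
      then show False
      proof cases
        case 1
        have "N = []"
          using mark_link_is_edge[OF linked_swaps(1)[OF n], of c] N True 1 e c by blast
        then have "adj \<beta> \<gamma>"
          using N True 1 by simp
        then show False
          using no_mark_edge_and_edge[OF linked_swaps(1)[OF l] tied_swap_left[OF t]] e c by blast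
      next
        case 2
        then show False
          using no_mark_link_and_far_edge[OF linked_swaps(2)[OF linked_swaps(1)[OF n]], of c] N True e c by blast
      next
        case 3
        then have "adj \<beta> y"
          using cr N x d True by auto
        then show False
          using no_edges_to_same_leg[OF l e(1), of y] no_edges_at_partners[OF linked_swaps(1)[OF l], of c a]
            3 c e a by blast
      next
        case 4
        then have "adj \<beta> y"
          using cr N x d True by auto
        then show False
          using no_edges_to_legs[OF l e(1), of y] 4 c by blast
      qed
    qed
  qed
qed

text \<open>If the second link joins the two other marks, \<open>two_mark_links\<close> makes all
  links edges. Otherwise \<open>cross_link\<close> makes it an edge with exactly one marked end, and
  its position shows that the first link is an edge too or gives a contradiction at once.\<close>

lemma no_marked_link_and_link:
  assumes l: "linked v A B C D \<alpha> R \<beta> \<gamma> S \<delta> (L @ M)" and t: "tied v A B C D"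
    and L: "seg \<alpha> L \<gamma>" and M: "seg x M y"
    and x: "x \<in> set A \<union> set B" and y: "y \<in> set C \<union> set D"
    and ne: "x \<noteq> \<alpha>" "y \<noteq> \<gamma>"
  shows False
proof -
  note d = linked_disjoint[OF l]
  have "distinct (R @ S @ L @ M)"
    using frame_distinct_links[of v A B C D "R @ S @ L @ M"] l by (simp add: linked_def)
  then have lL: "linked v A B C D \<alpha> R \<beta> \<gamma> S \<delta> L" and lM: "linked v A B C D \<alpha> R \<beta> \<gamma> S \<delta> M"
    using linked_replace_links[OF l, of L] linked_replace_links[OF l, of M] by auto
  note cr = cross_link[OF lM M]
  consider "x = \<beta>" "y = \<delta>" | "\<not> (x = \<beta> \<and> y = \<delta>)" "R = []" "S = []" "M = []"
    using cr x y ne by blast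
  then show False
  proof cases
    case 1
    obtain A1 A2 B1 B2 C1 C2 D1 D2 where
      "A = A1 @ \<alpha> # A2" "B = B1 @ \<beta> # B2" "C = C1 @ \<gamma> # C2" "D = D1 @ \<delta> # D2"
      using d by (meson split_list)
    then have "R = [] \<and> S = [] \<and> L = [] \<and> M = []"
      using two_mark_links l L M 1 unfolding linked_def by blast
    then show False
      using no_mark_edges[of v A B C D \<alpha> \<beta> \<gamma> \<delta>] l t L M 1 by simp
  next
    case 2
    then have l': "linked v A B C D \<alpha> [] \<beta> \<gamma> [] \<delta> L" and e: "adj x y"
      using lL M by auto
    have l0: "linked v A B C D \<alpha> [] \<beta> \<gamma> [] \<delta> []"
      using linked_replace_links[OF l', of "[]"] by simp
    have L': "linked v A B C D \<alpha> [] \<beta> \<gamma> [] \<delta> (rev L)" "seg \<gamma> (rev L) \<alpha>"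
      using linked_replace_links[OF l', of "rev L"] frame_distinct_links[of v A B C D L] l' L
      by (auto simp: linked_def)
    note ls = linked_swaps(3)[OF L'(1)]
    consider "x = \<beta>" "y \<in> set C" | "x = \<beta>" "y \<in> set D" "y \<noteq> \<delta>"
      | "x \<in> set A" "y = \<delta>" | "x \<in> set B" "x \<noteq> \<beta>" "y = \<delta>"
      using cr x y ne 2(1) by blast
    then show False
    proof cases
      case 1
      have "L = []"
        using mark_link_is_edge[OF l' L, of y] e 1 ne by blast
      then show False
        using no_mark_edge_and_edge[OF l0 t, of y] L e 1 ne by simp
    next
      case 2
      then show False
        using no_mark_link_and_far_edge[OF l' L, of y] e by blast
    next
      case 3
      have "rev L = []"
        using mark_link_is_edge[OF ls L'(2), of x] e adj_sym 3 ne by blast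
      then show False
        using no_mark_edge_and_edge[OF linked_swaps(3)[OF l0] tied_swap_sides[OF t], of x] L e adj_sym 3 ne by simp
    next
      case 4
      then show False
        using no_mark_link_and_far_edge[OF ls L'(2), of x] e adj_sym by blast
    qed
  qed
qed

text \<open>Since \<open>x \<noteq> \<alpha>\<close>, the last assumption says that exactly one end
  of the edge \<open>xy\<close> is a mark. This collects all positions of two such edges.\<close>

lemma no_half_marked_links:
  assumes l: "linked v A B C D \<alpha> [] \<beta> \<gamma> [] \<delta> []" and t: "tied v A B C D"
    and e: "adj \<alpha> c" "adj x y" and c: "c \<in> set C" "c \<noteq> \<gamma>"
    and x: "x \<in> set A \<union> set B" and y: "y \<in> set C \<union> set D"
    and ne: "x \<noteq> \<alpha>" "y \<noteq> c" and xy: "x = \<beta> \<longleftrightarrow> y \<notin> {\<gamma>, \<delta>}"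
  shows False
proof -
  consider "x = \<beta>" "y \<in> set C" "y \<noteq> \<gamma>" | "x = \<beta>" "y \<in> set D" "y \<noteq> \<delta>"
    | "x \<in> set A" "y = \<gamma>" | "x \<in> set A" "y = \<delta>"
    | "x \<in> set B" "x \<noteq> \<beta>" "y = \<gamma>" | "x \<in> set B" "x \<noteq> \<beta>" "y = \<delta>"
    using x y xy by blast
  then show False
  proof cases
    case 1
    then show False using no_edges_to_same_leg[OF l e(1)] e c ne by blast
  next
    case 2
    then show False using no_edges_to_legs[OF l e(1)] e c by blast
  next
    case 3
    then show False using no_crossed_edges[OF l t e(1)] e c ne by blast
  next
    case 4
    then show False using no_edges_from_leg[OF l e(1)] e c ne by blast
  next
    case 5
    then show False using no_edges_at_partners[OF l e(1)] e c by blast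
  next
    case 6
    then show False using no_edges_opposite[OF l e(1)] e c by blast
  qed
qed

text \<open>By \<open>cross_link\<close> each link joins two marks or is an edge with exactly one
  marked end. The local fact \<open>marked\<close> deals with a link of the first kind,
  \<open>half\<close> with two of the second; the symmetries bring the given marks into standard
  position.\<close>

lemma no_two_cross_links:
  assumes l: "linked v A B C D \<alpha> R \<beta> \<gamma> S \<delta> (L @ M)" and t: "tied v A B C D"
    and L: "seg x L y" and M: "seg x' M y'"
    and x: "x \<in> set A \<union> set B \<union> set R" "x' \<in> set A \<union> set B \<union> set R"
    and y: "y \<in> set C \<union> set D \<union> set S" "y' \<in> set C \<union> set D \<union> set S"
    and ne: "x \<noteq> x'" "y \<noteq> y'"
  shows False
proof -
  have "distinct (R @ S @ L @ M)"
    using frame_distinct_links[of v A B C D "R @ S @ L @ M"] l by (simp add: linked_def)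
  then have lL: "linked v A B C D \<alpha> R \<beta> \<gamma> S \<delta> L" and lM: "linked v A B C D \<alpha> R \<beta> \<gamma> S \<delta> M"
    and lr: "linked v A B C D \<alpha> R \<beta> \<gamma> S \<delta> (M @ L)"
    using linked_replace_links[OF l, of L] linked_replace_links[OF l, of M] linked_replace_links[OF l, of "M @ L"]
    by auto
  note cL = cross_link[OF lL L x(1) y(1)] and cM = cross_link[OF lM M x(2) y(2)]
  have marked: False
    if l: "linked v A B C D \<alpha> R \<beta> \<gamma> S \<delta> (L @ M)" and "seg x L y" "seg x' M y'" "x \<in> {\<alpha>, \<beta>}" "y \<in> {\<gamma>, \<delta>}"
      "x' \<in> set A \<union> set B" "y' \<in> set C \<union> set D" "x \<noteq> x'" "y \<noteq> y'"
    for x y x' y' L M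
  proof -
    note l' = linked_swap_left[OF l] and t' = tied_swap_left[OF t]
    note no_marked_link_and_link[OF l t] no_marked_link_and_link[OF l' t']
      no_marked_link_and_link[OF linked_swap_right[OF l] tied_swap_right[OF t]]
      no_marked_link_and_link[OF linked_swap_right[OF l'] tied_swap_right[OF t']]
    with that show False
      by (metis Un_commute insertE singletonD)
  qed
  have "x \<in> {\<alpha>, \<beta>} \<and> y \<in> {\<gamma>, \<delta>} \<or> x' \<in> {\<alpha>, \<beta>} \<and> y' \<in> {\<gamma>, \<delta>} \<or>
    (R = [] \<and> S = [] \<and> L = [] \<and> M = [] \<and>
      (x \<in> {\<alpha>, \<beta>} \<longleftrightarrow> y \<notin> {\<gamma>, \<delta>}) \<and> (x' \<in> {\<alpha>, \<beta>} \<longleftrightarrow> y' \<notin> {\<gamma>, \<delta>}))"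
    using cL cM by argo
  then consider "x \<in> {\<alpha>, \<beta>}" "y \<in> {\<gamma>, \<delta>}" | "x' \<in> {\<alpha>, \<beta>}" "y' \<in> {\<gamma>, \<delta>}"
    | "R = []" "S = []" "L = []" "M = []" "x \<in> {\<alpha>, \<beta>} \<longleftrightarrow> y \<notin> {\<gamma>, \<delta>}" "x' \<in> {\<alpha>, \<beta>} \<longleftrightarrow> y' \<notin> {\<gamma>, \<delta>}"
    by argo
  then show False
  proof cases
    case 1
    then show False
      using marked[OF l L M] cM ne by blast
  next
    case 2
    then show False
      using marked[OF lr M L] cL ne by blast
  next
    case 3
    have l0: "linked v A B C D \<alpha> [] \<beta> \<gamma> [] \<delta> []" and e: "adj x y" "adj x' y'"
      using l L M 3 by auto
    have half: False
      if l: "linked v A B C D \<alpha> [] \<beta> \<gamma> [] \<delta> []" and t: "tied v A B C D" and e: "adj x y" "adj x' y'"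
        and x: "x \<in> {\<alpha>, \<beta>}" "x' \<in> set A \<union> set B"
        and y: "y \<in> set C \<union> set D" "y \<notin> {\<gamma>, \<delta>}" "y' \<in> set C \<union> set D"
        and ne: "x \<noteq> x'" "y \<noteq> y'" and m: "x' \<in> {\<alpha>, \<beta>} \<longleftrightarrow> y' \<notin> {\<gamma>, \<delta>}"
      for A B C D \<alpha> \<beta> \<gamma> \<delta> x y x' y'
    proof -
      note l' = linked_swaps(1)[OF l] and t' = tied_swap_left[OF t]
      note n = no_half_marked_links[OF l t _ e(2)] no_half_marked_links[OF l' t' _ e(2)]
        no_half_marked_links[OF linked_swaps(2)[OF l] tied_swap_right[OF t] _ e(2)]
        no_half_marked_links[OF linked_swaps(2)[OF l'] tied_swap_right[OF t'] _ e(2)]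
      consider "x = \<alpha>" "y \<in> set C" | "x = \<alpha>" "y \<in> set D" | "x = \<beta>" "y \<in> set C" | "x = \<beta>" "y \<in> set D"
        using x y by blast
      then show False
        by cases (use n[of y] e x y ne m in auto)
    qed
    have "x \<in> set A \<union> set B" "x' \<in> set A \<union> set B" "y \<in> set C \<union> set D" "y' \<in> set C \<union> set D"
      using cL cM by auto
    then show False
      using half[OF l0 t e] half[OF linked_swaps(3)[OF l0] tied_swap_sides[OF t] e[THEN adj_sym]] ne 3(5,6) by blast
  qed
qed

section \<open>Long paths intersect in more than one vertex\<close>

definition conn :: "'a set \<Rightarrow> bool" where
  "conn X \<longleftrightarrow> (\<forall>u \<in> X. \<forall>w \<in> X. \<exists>xs. is_path V E xs \<and> set xs \<subseteq> X \<and> hd xs = u \<and> last xs = w)"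

lemma finite_V: "finite V"
  using simple by (simp add: simple_graph_def)

lemma adj_in_V: "adj x y \<Longrightarrow> x \<in> V \<and> y \<in> V"
  using simple by (auto simp: adj_def simple_graph_def)

lemma adj_irrefl: "\<not> adj x x"
  using simple by (auto simp: adj_def simple_graph_def)

text \<open>Cut at the first vertex in \<open>Y\<close>, then at the last vertex in \<open>X\<close>
  before it.\<close>

lemma sub_link:
  assumes "walk xs" "distinct xs" "xs \<noteq> []" "hd xs \<in> X" "last xs \<in> Y" "X \<inter> Y = {}"
  obtains x N y where "x \<in> X" "y \<in> Y" "seg x N y" "distinct N" "set N \<inter> (X \<union> Y) = {}"
    "x \<in> set xs" "y \<in> set xs" "set N \<subseteq> set xs"
proof -
  have "\<exists>z \<in> set xs. z \<in> Y"
    using assms(3,5) last_in_set by blast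
  then obtain ys y zs where y: "xs = ys @ y # zs" "y \<in> Y" "\<forall>u \<in> set ys. u \<notin> Y"
    using split_list_first_prop[of xs "\<lambda>z. z \<in> Y"] by blast
  have "ys \<noteq> []"
    using y assms(4,6) by auto
  then have "\<exists>z \<in> set ys. z \<in> X"
    using y(1) assms(4) by (metis hd_append hd_in_set)
  then obtain as x N where x: "ys = as @ x # N" "x \<in> X" "\<forall>u \<in> set N. u \<notin> X"
    using split_list_last_prop[of ys "\<lambda>z. z \<in> X"] by blast
  have "walk (as @ (x # N @ y # zs))"
    using assms(1) x y by simp
  then have "seg x N y"
    using walk_seg[of x N y zs] by (simp only: successively_append_iff)
  then show thesis
    using that[of x y N] x y assms(2) by auto
qed

lemma conn_link:
  assumes "conn W" "X \<subseteq> W" "Y \<subseteq> W" "X \<noteq> {}" "Y \<noteq> {}" "X \<inter> Y = {}"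
  obtains x N y where "x \<in> X" "y \<in> Y" "seg x N y" "distinct N" "set N \<inter> (X \<union> Y) = {}" "set N \<subseteq> W \<inter> V"
proof -
  obtain u w where uw: "u \<in> X" "w \<in> Y"
    using assms by blast
  then obtain xs where "is_path V E xs" "set xs \<subseteq> W" "hd xs = u" "last xs = w"
    using assms(1-3) unfolding conn_def by (metis subsetD)
  then have xs: "walk xs" "distinct xs" "xs \<noteq> []" "hd xs \<in> X" "last xs \<in> Y" "set xs \<subseteq> W \<inter> V"
    using uw by (auto simp: is_path_iff_walk)
  obtain x N y where "x \<in> X" "y \<in> Y" "seg x N y" "distinct N" "set N \<inter> (X \<union> Y) = {}" "set N \<subseteq> set xs"
    by (rule sub_link[OF xs(1-5) assms(6)])
  then show thesis
    using that[of x y N] xs(6) by blast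
qed

lemma walk_start: "walk (T @ x # zs) \<longleftrightarrow> walk (x # rev T) \<and> walk (x # zs)"
  using walk_rev_start[of "rev T"] by simp

text \<open>Two paths switch from \<open>P\<close> to \<open>Q\<close> in opposite directions.
  Together they cover \<open>P\<close> and \<open>Q\<close> once, and a second time the stretches
  from \<open>x\<close> to \<open>x'\<close> and from \<open>y\<close> to \<open>y'\<close>. As
  \<open>M\<close> is nonempty, these add at least 3 + 2 vertices, so the sum is at least
  \<open>2 * p + 3\<close>, more than \<open>2 * (p + 1)\<close>.\<close>

lemma far_links:
  assumes P: "walk (P1 @ x # M @ x' # P2)" and "M \<noteq> []"
    and Q: "walk Q" "y \<in> set Q" "y' \<in> set Q" "y \<noteq> y'"
    and N: "seg x N y" "seg x' N' y'"
    and dist: "distinct (P1 @ x # M @ x' # P2 @ Q @ N @ N')"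
    and V: "set (P1 @ x # M @ x' # P2 @ Q @ N @ N') \<subseteq> V"
    and long: "2 * p \<le> length (P1 @ x # M @ x' # P2) + length Q + 2"
  shows False
proof -
  have main: False
    if Q': "Q' = Q1 @ y # Q2 @ y' # Q3" "mset Q' = mset Q" "walk Q'" for Q' Q1 Q2 Q3
  proof -
    note * = P[unfolded walk_start walk_seg] Q'(3)[unfolded Q'(1) walk_start walk_seg] N walk_start walk_seg
    have m: "mset Q = mset (Q1 @ y # Q2 @ y' # Q3)" "length Q = length (Q1 @ y # Q2 @ y' # Q3)"
      using Q'(1,2) mset_eq_length[OF Q'(2)] by simp_all
    have "length (rev P2 @ x' # rev M @ x # N @ y # Q2 @ y' # Q3) \<le> Suc p"
      "length (P1 @ x # M @ x' # N' @ y' # rev Q2 @ y # rev Q1) \<le> Suc p"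
      by (rule walk_length_le_mset[OF dist V]; simp add: * m(1))+
    moreover obtain z M' where "M = z # M'"
      using \<open>M \<noteq> []\<close> by (cases M) auto
    ultimately show False
      using long by (simp add: m(2))
  qed
  from Q(2,3,4) show False
  proof (cases rule: split_list_two)
    case 1
    then show ?thesis
      using main[OF 1] Q(1) by simp
  next
    case (2 Q1 Q2 Q3)
    \<comment> \<open>If the links reach \<open>Q\<close> in the other order, \<open>Q\<close> is
      traversed backwards.\<close>
    have "rev Q = rev Q3 @ y # rev Q2 @ y' # rev Q1"
      using 2 by simp
    then show ?thesis
      by (rule main) (simp_all only: mset_rev walk_rev Q(1))
  qed
qed

text \<open>Of three vertices on a path, two are not consecutive, and \<open>far_links\<close>
  applies to the links at these two.\<close>

lemma three_links:
  assumes P: "walk P" and Q: "walk Q"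
    and N: "seg x1 N1 y1" "seg x2 N2 y2" "seg x3 N3 y3"
    and x: "x1 \<in> set P" "x2 \<in> set P" "x3 \<in> set P" and y: "y1 \<in> set Q" "y2 \<in> set Q" "y3 \<in> set Q"
    and ne: "x1 \<noteq> x2" "x1 \<noteq> x3" "x2 \<noteq> x3" "y1 \<noteq> y2" "y1 \<noteq> y3" "y2 \<noteq> y3"
    and dist: "distinct (P @ Q @ N1 @ N2 @ N3)" and V: "set (P @ Q @ N1 @ N2 @ N3) \<subseteq> V"
    and long: "2 * p \<le> length P + length Q + 2"
  shows False
proof -
  have far: False
    if "P = P1 @ x # M @ x' # P2" "M \<noteq> []" "seg x N y" "seg x' N' y'" "y \<in> set Q" "y' \<in> set Q" "y \<noteq> y'"
      "distinct (P @ Q @ N @ N')" "set (P @ Q @ N @ N') \<subseteq> V"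
    for P1 x M x' P2 N N' y y'
    using far_links[of P1 x M x' P2 Q y y' N N'] that P Q long by simp
  have ordered: False
    if P': "P = P1 @ x # M @ x' # P2" and N: "seg x N y" "seg x' N' y'" "seg z K w"
      and z: "z \<in> set P" "z \<noteq> x" "z \<noteq> x'" and Y: "y \<in> set Q" "y' \<in> set Q" "w \<in> set Q"
      and ne: "y \<noteq> y'" "y \<noteq> w" "y' \<noteq> w"
      and d: "distinct (P @ Q @ N @ N' @ K)" and V: "set (P @ Q @ N @ N' @ K) \<subseteq> V"
    for P1 x M x' P2 N y N' y' z K w
  proof (cases "M = []")
    case False
    then show False
      by (rule far[OF P' _ N(1,2)]) (use Y ne d V in auto)
  next
    case True
    with P' z consider "z \<in> set P1" | "z \<in> set P2"
      by auto
    then show False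
    proof cases
      case 1
      then obtain s t where "P1 = s @ z # t"
        by (meson split_list)
      then have "P = s @ z # (t @ [x]) @ x' # P2"
        using P' True by simp
      then show False
        by (rule far[OF _ _ N(3,2)]) (use Y ne d V in auto)
    next
      case 2
      then obtain s t where "P2 = s @ z # t"
        by (meson split_list)
      then have "P = P1 @ x # (x' # s) @ z # t"
        using P' True by simp
      then show False
        by (rule far[OF _ _ N(1,3)]) (use Y ne d V in auto)
    qed
  qed
  from x(1,2) ne(1) show False
  proof (cases rule: split_list_two)
    case 1
    then show False
      by (rule ordered[OF _ N]) (use x y ne dist V in auto)
  next
    case 2
    then show False
      by (rule ordered[OF _ N(2,1,3)]) (use x y ne dist V in auto)
  qed
qed

end

section \<open>Disjoint links in a 3-connected graph\<close>

locale three_connected_graph = bounded_graph +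
  assumes three_connected: "k_connected 3 V E"
begin

lemma conn_minus: "Z \<subseteq> V \<Longrightarrow> card Z < 3 \<Longrightarrow> conn (V - Z)"
  using three_connected by (simp add: k_connected_def connected_minus_def conn_def)

text \<open>Deleting \<open>Z\<close> is encoded by dropping all edges at \<open>Z\<close>. Its
  vertices remain as isolated points, so sets to be linked have to avoid \<open>Z\<close>.\<close>

definition rel_minus :: "'a set \<Rightarrow> ('a \<times> 'a) set" where
  "rel_minus Z = {(x, y). adj x y \<and> x \<notin> Z \<and> y \<notin> Z}"

lemma walk_in_rel_minus:
  "walk_in (rel_minus Z) xs \<Longrightarrow> walk xs"
  "walk xs \<Longrightarrow> set xs \<inter> Z = {} \<Longrightarrow> walk_in (rel_minus Z) xs"
proof -
  show "walk_in (rel_minus Z) xs \<Longrightarrow> walk xs"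
    by (rule successively_mono[of "\<lambda>x y. (x, y) \<in> rel_minus Z"]) (auto simp: rel_minus_def)
  show "walk xs \<Longrightarrow> set xs \<inter> Z = {} \<Longrightarrow> walk_in (rel_minus Z) xs"
    by (rule successively_mono[of adj]) (auto simp: rel_minus_def)
qed

lemma walk_in_rel_minus_set:
  assumes "walk_in (rel_minus Z) xs" "xs \<noteq> []" "hd xs \<in> V - Z"
  shows "set xs \<subseteq> V - Z"
  using assms
proof (induction xs)
  case (Cons a xs)
  then show ?case
    by (cases xs) (auto simp: rel_minus_def dest: adj_in_V)
qed simp

text \<open>A separator with fewer than \<open>k\<close> vertices can swallow neither
  \<open>X\<close> nor \<open>Y\<close>, and together with \<open>Z\<close> it has fewer than three
  vertices, so it separates nothing.\<close>

lemma disjoint_links: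
  assumes Z: "Z \<subseteq> V" "card Z + k \<le> 3" and X: "X \<subseteq> V - Z" "k \<le> card X" and Y: "Y \<subseteq> V - Z" "k \<le> card Y"
  obtains Ps where "finite Ps" "card Ps = k" "linkage (rel_minus Z) X Y Ps"
proof -
  have fin: "finite X" "finite Y" "finite Z"
    using X Y Z finite_V by (auto intro: finite_subset)
  have "rel_minus Z \<subseteq> V \<times> V"
    using adj_in_V by (auto simp: rel_minus_def)
  then have "finite (rel_minus Z)"
    using finite_V finite_subset by blast
  moreover have "k \<le> card S" if S: "finite S" "separates (rel_minus Z) X Y S" for S
  proof (rule ccontr)
    assume "\<not> k \<le> card S"
    then have k: "card S < k" by simp
    have "\<not> X \<subseteq> S" "\<not> Y \<subseteq> S"
      using k X(2) Y(2) card_mono[OF S(1), of X] card_mono[OF S(1), of Y] by linarith+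
    then obtain x y where xy: "x \<in> X - S" "y \<in> Y - S" by blast
    \<comment> \<open>Menger's theorem allows arbitrary finite separators, so only the part inside
      \<open>V\<close> counts.\<close>
    let ?W = "Z \<union> (S \<inter> V)"
    have "card (S \<inter> V) \<le> card S"
      using S(1) by (simp add: card_mono)
    then have "card ?W < 3"
      using card_Un_le[of Z "S \<inter> V"] k Z by linarith
    then have "conn (V - ?W)"
      using Z by (intro conn_minus) auto
    moreover have "x \<in> V - ?W" "y \<in> V - ?W"
      using xy X Y by auto
    ultimately obtain xs where xs: "is_path V E xs" "set xs \<subseteq> V - ?W" "hd xs = x" "last xs = y"
      unfolding conn_def by blast
    then have "walk_in (rel_minus Z) xs" "xs \<noteq> []"
      by (auto simp: is_path_iff_walk intro!: walk_in_rel_minus)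
    then have "set xs \<inter> S \<noteq> {}"
      using separatesD[OF S(2)] xs xy by blast
    with xs(2) show False by blast
  qed
  ultimately show thesis
    using menger[of "rel_minus Z" X Y k] fin(1) that by blast
qed

lemma no_disjoint_long_paths:
  assumes P: "is_path V E P" "p - 1 \<le> length P" and Q: "is_path V E Q" "p - 1 \<le> length Q"
    and disj: "set P \<inter> set Q = {}" and p: "4 \<le> p"
  shows False
proof -
  have PQ: "walk P" "walk Q" "distinct P" "distinct Q" "set P \<subseteq> V" "set Q \<subseteq> V"
    using P Q by (auto simp: is_path_iff_walk)
  \<comment> \<open>Three disjoint links need three vertices on each path; this is the origin of
    \<open>4 \<le> p\<close>.\<close>
  have len: "3 \<le> length P" "3 \<le> length Q"
    using P(2) Q(2) p by linarith+
  obtain Ps where Ps: "card Ps = 3" "linkage (rel_minus {}) (set P) (set Q) Ps"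
    by (rule disjoint_links[of "{}" 3 "set P" "set Q"]) (use PQ len in \<open>auto simp: distinct_card\<close>)
  then obtain w1 w2 w3 where w: "Ps = {w1, w2, w3}" "w1 \<noteq> w2" "w1 \<noteq> w3" "w2 \<noteq> w3"
    by (auto simp: card_Suc_eq numeral_3_eq_3)
  have link: "\<exists>x N y. x \<in> set P \<and> y \<in> set Q \<and> seg x N y \<and> distinct N \<and> set N \<inter> (set P \<union> set Q) = {} \<and>
      x \<in> set w \<and> y \<in> set w \<and> set N \<subseteq> set w \<and> set N \<subseteq> V" if "w \<in> Ps" for w
  proof -
    have "path_from_to (rel_minus {}) (set P) (set Q) w"
      using Ps that by (simp add: linkage_def)
    then have w: "w \<noteq> []" "distinct w" "walk_in (rel_minus {}) w" "hd w \<in> set P" "last w \<in> set Q"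
      by (auto simp: path_from_to_def)
    then have "set w \<subseteq> V"
      using walk_in_rel_minus_set[of "{}" w] PQ by auto
    moreover obtain x N y where "x \<in> set P" "y \<in> set Q" "seg x N y" "distinct N"
      "set N \<inter> (set P \<union> set Q) = {}" "x \<in> set w" "y \<in> set w" "set N \<subseteq> set w"
      by (rule sub_link[OF walk_in_rel_minus(1)[OF w(3)] w(2,1,4,5) disj])
    ultimately show ?thesis by blast
  qed
  obtain x1 N1 y1 where 1: "x1 \<in> set P" "y1 \<in> set Q" "seg x1 N1 y1" "distinct N1" "set N1 \<inter> (set P \<union> set Q) = {}"
      "x1 \<in> set w1" "y1 \<in> set w1" "set N1 \<subseteq> set w1" "set N1 \<subseteq> V"
    using link[of w1] w by blast
  obtain x2 N2 y2 where 2: "x2 \<in> set P" "y2 \<in> set Q" "seg x2 N2 y2" "distinct N2" "set N2 \<inter> (set P \<union> set Q) = {}"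
      "x2 \<in> set w2" "y2 \<in> set w2" "set N2 \<subseteq> set w2" "set N2 \<subseteq> V"
    using link[of w2] w by blast
  obtain x3 N3 y3 where 3: "x3 \<in> set P" "y3 \<in> set Q" "seg x3 N3 y3" "distinct N3" "set N3 \<inter> (set P \<union> set Q) = {}"
      "x3 \<in> set w3" "y3 \<in> set w3" "set N3 \<subseteq> set w3" "set N3 \<subseteq> V"
    using link[of w3] w by blast
  have d: "set w1 \<inter> set w2 = {}" "set w1 \<inter> set w3 = {}" "set w2 \<inter> set w3 = {}"
    using Ps(2) w unfolding linkage_def by auto
  show False
  proof (rule three_links[OF PQ(1,2) 1(3) 2(3) 3(3)])
    have "set N1 \<inter> set N2 = {}" "set N1 \<inter> set N3 = {}" "set N2 \<inter> set N3 = {}"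
      using d 1(8) 2(8) 3(8) by blast+
    then show "distinct (P @ Q @ N1 @ N2 @ N3)"
      using PQ disj 1(4,5) 2(4,5) 3(4,5) by (simp add: Int_Un_distrib Int_Un_distrib2 Int_commute)
    show "set (P @ Q @ N1 @ N2 @ N3) \<subseteq> V"
      using PQ 1(9) 2(9) 3(9) by simp
    show "2 * p \<le> length P + length Q + 2"
      using P(2) Q(2) p by linarith
  qed (use 1 2 3 d in blast)+
qed

end

section \<open>Long paths sharing exactly one vertex\<close>

context three_connected_graph
begin

lemma no_long_paths_meeting_once:
  assumes P: "is_path V E P" "p - 1 \<le> length P" and Q: "is_path V E Q" "p - 1 \<le> length Q"
    and v: "set P \<inter> set Q = {v}" and p: "7 \<le> p"
    and conn: "conn X" "conn Y" "X \<inter> Y = {}" "v \<notin> X \<union> Y"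
    and sub: "set P - {v} \<subseteq> X" "set Q - {v} \<subseteq> Y"
  shows False
proof -
  have "v \<in> set P" "v \<in> set Q"
    using v by auto
  then obtain P1 B Q1 D where split: "P = P1 @ v # B" "Q = Q1 @ v # D"
    by (meson split_list)
  define A C where "A = rev P1" and "C = rev Q1"
  have PA: "P = rev A @ v # B" and QC: "Q = rev C @ v # D"
    using split by (simp_all add: A_def C_def)
  have w: "walk (v # A)" "walk (v # B)" "walk (v # C)" "walk (v # D)"
    using P Q unfolding is_path_iff_walk PA QC walk_rev_start by auto
  have len: "p \<le> length A + length B + 2" "p \<le> length C + length D + 2"
    using P(2) Q(2) unfolding PA QC by auto
  have dPQ: "distinct P" "distinct Q" "set P \<subseteq> V" "set Q \<subseteq> V"
    using P Q by (auto simp: is_path_iff_walk)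
  have AB: "set A \<subseteq> X" "set B \<subseteq> X" "set C \<subseteq> Y" "set D \<subseteq> Y"
    using sub dPQ unfolding PA QC by auto
  have disj: "set A \<inter> set B = {}" "set C \<inter> set D = {}" "(set A \<union> set B) \<inter> (set C \<union> set D) = {}"
    "v \<notin> set A \<union> set B \<union> set C \<union> set D"
    using dPQ AB conn(3,4) unfolding PA QC by auto
  have dl: "distinct A" "distinct B" "distinct C" "distinct D" "set A \<union> set B \<union> set C \<union> set D \<subseteq> V - {v}" "v \<in> V"
    using dPQ disj unfolding PA QC by auto
  have frameI: "frame v A B C D L" if "distinct L" "set L \<inter> (set A \<union> set B \<union> set C \<union> set D \<union> {v}) = {}" "set L \<subseteq> V" for L
    using that w len disj dl unfolding frame_def by auto
  have frame: "frame v A B C D []"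
    by (rule frameI) auto
  have two: "length F + length G \<le> p" if "F \<in> {A, B}" "G \<in> {C, D}" for F G
  proof -
    have "length (rev F @ v # G) \<le> Suc p"
      by (rule frame_walk_length[OF frame]) (use that w in \<open>auto simp: walk_rev_start\<close>)
    then show ?thesis by simp
  qed
  \<comment> \<open>If a leg were empty, its partner would have at least \<open>p - 2\<close>
    vertices. By \<open>two\<close> each leg of the other path would then have at most two, but
    together these have at least \<open>p - 2 \<ge> 5\<close>.\<close>
  have ne: "A \<noteq> []" "B \<noteq> []" "C \<noteq> []" "D \<noteq> []"
    using two[of A C] two[of A D] two[of B C] two[of B D] len p by auto
  obtain \<alpha> R \<beta> where R: "\<alpha> \<in> set A" "\<beta> \<in> set B" "seg \<alpha> R \<beta>" "distinct R"
    "set R \<inter> (set A \<union> set B) = {}" "set R \<subseteq> X \<inter> V"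
    by (rule conn_link[OF conn(1) AB(1,2) _ _ disj(1)]) (use ne in auto)
  obtain \<gamma> S \<delta> where S: "\<gamma> \<in> set C" "\<delta> \<in> set D" "seg \<gamma> S \<delta>" "distinct S"
    "set S \<inter> (set C \<union> set D) = {}" "set S \<subseteq> Y \<inter> V"
    by (rule conn_link[OF conn(2) AB(3,4) _ _ disj(2)]) (use ne in auto)
  have RS: "set R \<inter> set S = {}" "v \<notin> set R \<union> set S" "set R \<inter> (set C \<union> set D) = {}" "set S \<inter> (set A \<union> set B) = {}"
    using R(6) S(6) AB conn(3,4) by auto
  have l0: "linked v A B C D \<alpha> R \<beta> \<gamma> S \<delta> []"
    unfolding linked_def
  proof (intro conjI R S)
    show "frame v A B C D (R @ S @ [])"
      by (rule frameI) (use R S RS in auto)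
  qed
  \<comment> \<open>From the leg \<open>F\<close> the link inside the other path can be used in both
    directions. The two resulting paths together cover \<open>G\<close> and \<open>H\<close> and
    contain \<open>F\<close> twice, so \<open>F\<close> has at most \<open>p div 2\<close>
    vertices.\<close>
  have short: "2 * length F + length G + length H + 2 \<le> 2 * p"
    if "linked v F F' G H \<alpha>' R' \<beta>' \<gamma>' S' \<delta>' []" for F F' G H \<alpha>' R' \<beta>' \<gamma>' S' \<delta>'
  proof -
    have F: "frame v F F' G H (R' @ S')" and s: "seg \<gamma>' S' \<delta>'" "\<gamma>' \<in> set G" "\<delta>' \<in> set H"
      using that by (simp_all add: linked_def)
    obtain G1 G2 H1 H2 where GH: "G = G1 @ \<gamma>' # G2" "H = H1 @ \<delta>' # H2"
      using s by (meson split_list)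
    note F = F[unfolded GH]
    note * = frame_walks[OF F, unfolded walk_seg] s walk_seg walk_rev_start
    have "length (rev F @ v # G1 @ \<gamma>' # S' @ \<delta>' # H2) \<le> Suc p"
      "length (rev F @ v # H1 @ \<delta>' # rev S' @ \<gamma>' # G2) \<le> Suc p"
      by (rule frame_walk_length[OF F]; simp add: *)+
    then show ?thesis
      by (simp add: GH)
  qed
  note l1 = linked_swap_left[OF l0] and l2 = linked_swap_sides[OF l0]
  note sh = short[OF l0] short[OF l1] short[OF l2] short[OF linked_swap_left[OF l2]]
  \<comment> \<open>No leg exceeds \<open>p div 2\<close>, and the two legs of a path have at least
    \<open>p - 2\<close> vertices; for \<open>7 \<le> p\<close> each is left with two.\<close>
  have two_le: "2 \<le> length A" "2 \<le> length B" "2 \<le> length C" "2 \<le> length D"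
    using sh len p by linarith+
  have tied: "tied v A B C D"
    unfolding tied_def Let_def
  proof (intro conjI allI impI two_le)
    fix z T
    let ?U = "set (A @ B @ C @ D)"
    assume z: "z \<in> ?U" and T: "T \<subseteq> ?U - {z}" "T \<noteq> {}" "?U - T - {z} \<noteq> {}"
    have "card {v, z} < 3"
      by (simp add: card_insert_if)
    then have "conn (V - {v, z})"
      by (rule conn_minus[rotated]) (use z dl in auto)
    moreover have "T \<subseteq> V - {v, z}" "?U - T - {z} \<subseteq> V - {v, z}"
      using T dl by auto
    ultimately obtain x N y where N: "x \<in> T" "y \<in> ?U - T - {z}" "seg x N y" "distinct N"
      "set N \<inter> (T \<union> (?U - T - {z})) = {}" "set N \<subseteq> (V - {v, z}) \<inter> V"
      using T(2,3) by (rule conn_link) auto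
    have "frame v A B C D N"
      by (rule frameI) (use N z T in auto)
    then show "\<exists>x \<in> T. \<exists>y \<in> ?U - T - {z}. \<exists>N. seg x N y \<and> frame v A B C D N"
      using N by blast
  qed
  \<comment> \<open>The inner vertices of \<open>R\<close> and \<open>S\<close> are included among
    the vertices to be linked, so that the links across avoid them inside.\<close>
  let ?X = "set A \<union> set B \<union> set R" and ?Y = "set C \<union> set D \<union> set S"
  have XY: "?X \<subseteq> V - {v}" "?Y \<subseteq> V - {v}" "?X \<inter> ?Y = {}"
    using dl R S RS disj by auto
  have "card (set A) \<le> card ?X" "card (set C) \<le> card ?Y"
    by (auto intro!: card_mono)
  then have card: "2 \<le> card ?X" "2 \<le> card ?Y"
    using two_le dl by (simp_all add: distinct_card)
  obtain Ps where Ps: "card Ps = 2" "linkage (rel_minus {v}) ?X ?Y Ps"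
    by (rule disjoint_links[of "{v}" 2 ?X ?Y]) (use XY card dl in auto)
  then obtain w1 w2 where w12: "Ps = {w1, w2}" "w1 \<noteq> w2"
    by (auto simp: card_Suc_eq numeral_2_eq_2)
  have link: "\<exists>x N y. x \<in> ?X \<and> y \<in> ?Y \<and> seg x N y \<and> distinct N \<and> set N \<inter> (?X \<union> ?Y) = {} \<and>
      x \<in> set w \<and> y \<in> set w \<and> set N \<subseteq> set w \<and> set N \<subseteq> V - {v}" if "w \<in> Ps" for w
  proof -
    have "path_from_to (rel_minus {v}) ?X ?Y w"
      using Ps that unfolding linkage_def by blast
    then have w: "w \<noteq> []" "distinct w" "walk_in (rel_minus {v}) w" "hd w \<in> ?X" "last w \<in> ?Y"
      unfolding path_from_to_def by blast+
    then have "set w \<subseteq> V - {v}"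
      using walk_in_rel_minus_set[of "{v}" w] XY by blast
    moreover obtain x N y where "x \<in> ?X" "y \<in> ?Y" "seg x N y" "distinct N"
      "set N \<inter> (?X \<union> ?Y) = {}" "x \<in> set w" "y \<in> set w" "set N \<subseteq> set w"
      by (rule sub_link[OF walk_in_rel_minus(1)[OF w(3)] w(2,1,4,5) XY(3)])
    ultimately show ?thesis by blast
  qed
  obtain x L y where 1: "x \<in> ?X" "y \<in> ?Y" "seg x L y" "distinct L" "set L \<inter> (?X \<union> ?Y) = {}"
      "x \<in> set w1" "y \<in> set w1" "set L \<subseteq> set w1" "set L \<subseteq> V - {v}"
    using link[of w1] w12 by blast
  obtain x' M y' where 2: "x' \<in> ?X" "y' \<in> ?Y" "seg x' M y'" "distinct M" "set M \<inter> (?X \<union> ?Y) = {}"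
      "x' \<in> set w2" "y' \<in> set w2" "set M \<subseteq> set w2" "set M \<subseteq> V - {v}"
    using link[of w2] w12 by blast
  have d: "set w1 \<inter> set w2 = {}"
    using Ps(2) w12 unfolding linkage_def by auto
  then have "set L \<inter> set M = {}"
    using 1(8) 2(8) by blast
  then have "frame v A B C D (R @ S @ L @ M)"
    by (intro frameI) (use 1(4,5,9) 2(4,5,9) R S RS in auto)
  then have "linked v A B C D \<alpha> R \<beta> \<gamma> S \<delta> (L @ M)"
    unfolding linked_def using R S by blast
  then show False
    by (rule no_two_cross_links[OF _ tied 1(3) 2(3) 1(1) 2(1) 1(2) 2(2)]) (use 1(6,7) 2(6,7) d in blast)+
qed

end

section \<open>Partitions into two connected parts\<close>

context bounded_graph
begin

definition joined :: "'a set \<Rightarrow> 'a set \<Rightarrow> bool" where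
  "joined X Y \<longleftrightarrow> (\<exists>x \<in> X. \<exists>y \<in> Y. adj x y)"

lemma conn_joined:
  assumes "conn W" "C \<subseteq> W" "C \<noteq> {}" "W - C \<noteq> {}"
  shows "joined C (W - C)"
proof -
  obtain x N y where N: "x \<in> C" "y \<in> W - C" "seg x N y" "set N \<inter> (C \<union> (W - C)) = {}" "set N \<subseteq> W \<inter> V"
    by (rule conn_link[OF assms(1,2) _ assms(3,4)]) auto
  then have "N = []"
    using assms(2) by (cases N) auto
  then show ?thesis
    using N by (auto simp: joined_def)
qed

text \<open>Were something out of reach of \<open>u\<close>, an edge would lead from the reachable
  vertices to the others and extend a path. With \<open>conn_joined\<close> this allows
  connectedness to be treated through cuts instead of paths.\<close>

lemma connI:
  assumes "W \<subseteq> V" and cut: "\<And>C. C \<subseteq> W \<Longrightarrow> C \<noteq> {} \<Longrightarrow> W - C \<noteq> {} \<Longrightarrow> joined C (W - C)"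
  shows "conn W"
  unfolding conn_def
proof (intro ballI)
  fix u w assume u: "u \<in> W" and w: "w \<in> W"
  define C where "C = {w \<in> W. \<exists>xs. is_path V E xs \<and> set xs \<subseteq> W \<and> hd xs = u \<and> last xs = w}"
  have "is_path V E [u]"
    using u assms(1) by (auto simp: is_path_iff_walk)
  then have "u \<in> C"
    unfolding C_def using u by force
  have "W - C = {}"
  proof (rule ccontr)
    assume "W - C \<noteq> {}"
    then have "joined C (W - C)"
      using \<open>u \<in> C\<close> by (intro cut) (auto simp: C_def)
    then obtain x y where xy: "x \<in> C" "y \<in> W" "y \<notin> C" "adj x y"
      by (auto simp: joined_def)
    then obtain xs where xs: "is_path V E xs" "set xs \<subseteq> W" "hd xs = u" "last xs = x"
      by (auto simp: C_def)
    have "y \<notin> set xs"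
    proof
      assume "y \<in> set xs"
      then obtain ys zs where ys: "xs = ys @ y # zs"
        by (meson split_list)
      have "walk (ys @ [y])"
        using xs(1) successively_append_iff[of adj "ys @ [y]" zs] by (simp add: is_path_iff_walk ys)
      moreover have "hd (ys @ [y]) = u"
        using xs(3) by (cases ys) (auto simp: ys)
      ultimately have "y \<in> C"
        using xs xy(2) unfolding C_def by (auto simp: is_path_iff_walk ys intro!: exI[of _ "ys @ [y]"])
      then show False using xy by blast
    qed
    then have "is_path V E (xs @ [y])" "hd (xs @ [y]) = u"
      using xs xy adj_in_V by (auto simp: is_path_iff_walk successively_append_iff hd_append)
    then have "y \<in> C"
      using xs(2) xy(2) unfolding C_def by (auto intro!: exI[of _ "xs @ [y]"])
    then show False using xy by blast
  qed
  then show "\<exists>xs. is_path V E xs \<and> set xs \<subseteq> W \<and> hd xs = u \<and> last xs = w"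
    using w by (auto simp: C_def)
qed

section \<open>Bonds from partitions into connected parts\<close>

definition halved :: "'a set \<Rightarrow> bool" where
  "halved X \<longleftrightarrow> X \<subseteq> V \<and> X \<noteq> {} \<and> V - X \<noteq> {} \<and> conn X \<and> conn (V - X)"

lemma edge_cut_iff: "e \<in> edge_cut V E X \<longleftrightarrow> (\<exists>x y. e = {x, y} \<and> adj x y \<and> x \<in> X \<and> y \<in> V - X)"
  by (auto simp: edge_cut_def adj_def)

text \<open>If \<open>Y\<close> split \<open>W\<close>, an edge inside \<open>W\<close> would belong
  to the cut of \<open>Y\<close>, hence to that of \<open>X\<close>; but \<open>X\<close> does not
  split \<open>W\<close>.\<close>

lemma conn_subset_or_disjoint:
  assumes "conn W" "W \<subseteq> V" "X \<inter> W = {} \<or> W \<subseteq> X" and sub: "edge_cut V E Y \<subseteq> edge_cut V E X" and "Y \<subseteq> V"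
  shows "W \<subseteq> Y \<or> W \<inter> Y = {}"
proof (rule ccontr)
  assume "\<not> ?thesis"
  then have "joined (W \<inter> Y) (W - W \<inter> Y)"
    using assms(1) by (intro conn_joined) auto
  then obtain x y where xy: "x \<in> W \<inter> Y" "y \<in> W - Y" "adj x y"
    by (auto simp: joined_def)
  then have "{x, y} \<in> edge_cut V E Y"
    using assms(2) by (auto simp: edge_cut_iff)
  then have "{x, y} \<in> edge_cut V E X"
    using sub by blast
  then show False
    using xy assms(3) by (auto simp: edge_cut_iff doubleton_eq_iff)
qed

text \<open>A smaller edge-cut given by \<open>Y\<close> splits neither part, so \<open>Y\<close> is
  empty, everything, or one of the two parts.\<close>

lemma halved_is_bond:
  assumes V: "conn V" and X: "halved X"
  shows "is_bond V E (edge_cut V E X)"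
  unfolding is_bond_def
proof (intro conjI allI impI)
  have X': "X \<subseteq> V" "X \<noteq> {}" "V - X \<noteq> {}" "conn X" "conn (V - X)"
    using X by (auto simp: halved_def)
  show "is_edge_cut V E (edge_cut V E X)"
    using X' by (auto simp: is_edge_cut_def)
  obtain x y where "x \<in> X" "y \<in> V - X" "adj x y"
    using conn_joined[OF V X'(1-3)] by (auto simp: joined_def)
  then show "edge_cut V E X \<noteq> {}"
    using edge_cut_iff[of "{x, y}" X] by blast
  fix F assume F: "is_edge_cut V E F \<and> F \<noteq> {} \<and> F \<subseteq> edge_cut V E X"
  then obtain Y where Y: "Y \<subseteq> V" "F = edge_cut V E Y"
    by (auto simp: is_edge_cut_def)
  have "X \<subseteq> Y \<or> X \<inter> Y = {}" "V - X \<subseteq> Y \<or> (V - X) \<inter> Y = {}"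
    using conn_subset_or_disjoint[of X X Y] conn_subset_or_disjoint[of "V - X" X Y] X' Y F by auto
  then have "Y = {} \<or> Y = V \<or> Y = X \<or> Y = V - X"
    using Y(1) X'(1) by blast
  moreover have "Y \<noteq> {}" "Y \<noteq> V"
    using F Y by (auto simp: edge_cut_def)
  moreover have "edge_cut V E (V - X) = edge_cut V E X"
    using X'(1) by (auto simp: edge_cut_iff doubleton_eq_iff) (metis adj_commute insert_commute subsetD)+
  ultimately show "F = edge_cut V E X"
    using Y by auto
qed

lemma path_on_one_side:
  assumes "is_path V E xs" "\<not> meets (edge_cut V E X) xs"
  shows "set xs \<subseteq> X \<or> set xs \<subseteq> V - X"
proof -
  have "successively (\<lambda>a b. a \<in> X \<longleftrightarrow> b \<in> X) xs"
    unfolding successively_conv_nth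
  proof (intro allI impI)
    fix i assume i: "Suc i < length xs"
    then have "{xs ! i, xs ! Suc i} \<in> path_edges xs"
      by (auto simp: path_edges_def)
    then have "{xs ! i, xs ! Suc i} \<notin> edge_cut V E X"
      using assms(2) by (auto simp: meets_def)
    moreover have "xs ! i \<in> V" "xs ! Suc i \<in> V" "adj (xs ! i) (xs ! Suc i)"
      using assms(1) i by (auto simp: is_path_def adj_def)
    ultimately show "xs ! i \<in> X \<longleftrightarrow> xs ! Suc i \<in> X"
      unfolding edge_cut_iff using adj_sym by (metis DiffI insert_commute)
  qed
  then have "set xs \<subseteq> X \<or> set xs \<inter> X = {}"
    by (induction xs rule: induct_list012) auto
  then show ?thesis
    using assms(1) by (auto simp: is_path_def)
qed

text \<open>A path of length at least \<open>p - 2\<close> has at least \<open>p - 1\<close>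
  vertices.\<close>

definition spacious :: "'a set \<Rightarrow> bool" where
  "spacious X \<longleftrightarrow> (\<exists>xs. is_path V E xs \<and> set xs \<subseteq> X \<and> p - 1 \<le> length xs)"

lemma not_spacious:
  assumes "card X < p - 1" "finite X"
  shows "\<not> spacious X"
proof
  assume "spacious X"
  then obtain xs where "distinct xs" "set xs \<subseteq> X" "p - 1 \<le> length xs"
    by (auto simp: spacious_def is_path_def)
  then show False
    using assms card_mono[of X "set xs"] by (simp add: distinct_card)
qed

lemma bond_of_halved:
  assumes "conn V" "halved X" "\<not> spacious X" "\<not> spacious (V - X)"
  shows "\<exists>B. is_bond V E B \<and> (\<forall>xs. is_path V E xs \<and> int (path_len xs) \<ge> int p - 2 \<longrightarrow> meets B xs)"
proof (intro exI conjI allI impI)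
  show "is_bond V E (edge_cut V E X)"
    using halved_is_bond assms by blast
  fix xs assume xs: "is_path V E xs \<and> int (path_len xs) \<ge> int p - 2"
  then have "xs \<noteq> []"
    by (auto simp: is_path_def)
  with xs have "p - 1 \<le> length xs"
    \<comment> \<open>\<open>path_len\<close> counts edges, compared over the integers;
      \<open>p - 1\<close> counts vertices, with truncated subtraction. For a nonempty list the
      first bound gives the second.\<close>
    by (cases xs) (auto simp: path_len_def)
  then show "meets (edge_cut V E X) xs"
    using path_on_one_side[of xs X] xs assms(3,4) unfolding spacious_def by blast
qed

end

section \<open>Growing one part of the partition\<close>

context three_connected_graph
begin

lemma card_V: "3 < card V"
  using three_connected by (simp add: k_connected_def)

lemma conn_V: "conn V"
  using conn_minus[of "{}"] by simp

lemma conn_insert: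
  assumes A: "conn A" "A \<subseteq> V" and w: "a \<in> A" "adj w a"
  shows "conn (insert w A)"
proof (rule connI)
  show "insert w A \<subseteq> V"
    using A w adj_in_V by auto
  fix C assume C: "C \<subseteq> insert w A" "C \<noteq> {}" "insert w A - C \<noteq> {}"
  show "joined C (insert w A - C)"
  proof (cases "C \<inter> A = {} \<or> A \<subseteq> C")
    case True
    then show ?thesis
      using C w adj_sym unfolding joined_def by blast
  next
    case False
    then have "joined (C \<inter> A) (A - C \<inter> A)"
      using A by (intro conn_joined) auto
    then show ?thesis
      unfolding joined_def by blast
  qed
qed

text \<open>Suppose every neighbour \<open>w\<close> of \<open>A\<close> disconnects
  \<open>B\<close> when removed, and choose such a \<open>w\<close> with the smallest piece
  \<open>C\<close> cut off. Since \<open>w\<close> does not separate the whole graph,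
  \<open>C\<close> contains another neighbour \<open>w'\<close> of \<open>A\<close>; removing
  \<open>w'\<close> cuts off a piece strictly inside \<open>C\<close>, against minimality.\<close>

lemma grow:
  assumes A: "halved A" and two: "2 \<le> card (V - A)"
  obtains w where "w \<in> V - A" "halved (insert w A)"
proof -
  define B where "B = V - A"
  have AB: "A \<subseteq> V" "A \<noteq> {}" "B \<noteq> {}" "conn A" "conn B" "B \<subseteq> V" "V - B = A"
    using A by (auto simp: halved_def B_def)
  define N where "N = {w \<in> B. \<exists>a \<in> A. adj w a}"
  \<comment> \<open>The pieces are unions of components: no edge joins \<open>C\<close> to the rest
    of \<open>B - {w}\<close>.\<close>
  define cuts where "cuts = (\<lambda>(w, C). w \<in> N \<and> C \<subseteq> B - {w} \<and> C \<noteq> {} \<and> B - {w} - C \<noteq> {} \<and> \<not> joined C (B - {w} - C))"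
  have "\<exists>w \<in> N. conn (B - {w})"
  proof (rule ccontr)
    assume none: "\<not> ?thesis"
    have cutE: "\<exists>C. C \<subseteq> B - {w} \<and> C \<noteq> {} \<and> B - {w} - C \<noteq> {} \<and> \<not> joined C (B - {w} - C)"
      if "w \<in> N" for w
    proof (rule ccontr)
      assume no_cut: "\<not> ?thesis"
      have "conn (B - {w})"
        by (rule connI) (use AB(6) no_cut in auto)
      then show False
        using none that by blast
    qed
    have "joined B A"
      using conn_joined[OF conn_V AB(6,3)] AB(2,7) by auto
    then obtain w0 where "w0 \<in> N"
      by (auto simp: joined_def N_def)
    then obtain C0 where "cuts (w0, C0)"
      using cutE[of w0] by (auto simp: cuts_def)
    then obtain wC where wC: "cuts wC" "\<And>wC'. cuts wC' \<Longrightarrow> card (snd wC) \<le> card (snd wC')"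
      using ex_has_least_nat[of cuts "(w0, C0)" "\<lambda>wC. card (snd wC)"] by blast
    obtain w C where wCeq: "wC = (w, C)"
      by fastforce
    have w: "w \<in> N" "C \<subseteq> B - {w}" "C \<noteq> {}" "B - {w} - C \<noteq> {}" "\<not> joined C (B - {w} - C)"
      using wC(1) by (auto simp: cuts_def wCeq)
    have "w \<in> V"
      using w(1) AB by (auto simp: N_def)
    then have "conn (V - {w})"
      by (intro conn_minus) auto
    then have "joined C (V - {w} - C)"
      by (rule conn_joined) (use w AB in auto)
    then obtain w' where w': "w' \<in> C" "w' \<in> N"
      using w(2,5) AB unfolding joined_def N_def by blast
    obtain C1 where C1: "C1 \<subseteq> B - {w'}" "C1 \<noteq> {}" "B - {w'} - C1 \<noteq> {}" "\<not> joined C1 (B - {w'} - C1)"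
      using cutE[OF w'(2)] by blast
    \<comment> \<open>Of the two sides of the cut at \<open>w'\<close>, the one without
      \<open>w\<close>.\<close>
    define C' where "C' = (if w \<in> C1 then B - {w'} - C1 else C1)"
    have "\<not> joined (B - {w'} - C1) C1"
      using C1(4) adj_sym unfolding joined_def by blast
    moreover have "B - {w'} - (B - {w'} - C1) = C1"
      using C1(1) by blast
    ultimately have C': "C' \<subseteq> B - {w'}" "C' \<noteq> {}" "B - {w'} - C' \<noteq> {}" "\<not> joined C' (B - {w'} - C')" "w \<notin> C'"
      using C1 by (auto simp: C'_def)
    have wB: "w \<in> B - {w'} - C'"
      using w(1,2) w'(1) C'(5) by (auto simp: N_def)
    \<comment> \<open>Inside \<open>B\<close>, edges leave \<open>C'\<close> only towards
      \<open>w'\<close>, which lies in \<open>C\<close>, while the part of \<open>C'\<close> outside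
      \<open>C\<close> has no edge to \<open>C\<close>. That part would therefore be separated from
      the rest of the connected set \<open>B\<close>.\<close>
    have "C' \<inter> (B - {w} - C) = {}"
    proof (rule ccontr)
      assume "C' \<inter> (B - {w} - C) \<noteq> {}"
      then have "joined (C' \<inter> (B - {w} - C)) (B - C' \<inter> (B - {w} - C))"
        using AB(5) wB by (intro conn_joined) auto
      then obtain x y where xy: "x \<in> C'" "x \<in> B - {w} - C" "y \<in> B" "\<not> (y \<in> C' \<and> y \<in> B - {w} - C)" "adj x y"
        by (auto simp: joined_def)
      then have "y \<notin> C"
        using w(5) adj_sym unfolding joined_def by blast
      then have "y \<in> B - {w'} - C'"
        using xy wB w'(1) by blast
      then show False
        using xy C'(4) unfolding joined_def by blast
    qed
    then have "C' \<subset> C"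
      using C' w'(1) wB by blast
    moreover have "finite C"
      using w(2) AB(6) finite_V by (meson finite_subset subset_trans Diff_subset)
    ultimately have "card C' < card C"
      by (rule psubset_card_mono[rotated])
    moreover have "cuts (w', C')"
      using C' w' by (auto simp: cuts_def)
    ultimately show False
      using wC(2)[of "(w', C')"] by (simp add: wCeq)
  qed
  then obtain w where w: "w \<in> N" "conn (B - {w})"
    by blast
  then have "conn (insert w A)"
    using conn_insert AB by (auto simp: N_def)
  moreover have "V - insert w A = B - {w}" "w \<in> V - A"
    using w by (auto simp: N_def B_def)
  moreover have "B - {w} \<noteq> {}"
  proof
    assume "B - {w} = {}"
    then have "card B \<le> card {w}"
      by (intro card_mono) auto
    then show False
      using two by (simp add: B_def)
  qed
  ultimately show thesis
    using that[of w] w AB unfolding halved_def by auto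
qed

lemma halved_singleton: "s \<in> V \<Longrightarrow> halved {s}"
proof -
  assume s: "s \<in> V"
  have "V - {s} \<noteq> {}"
  proof
    assume "V - {s} = {}"
    then have "card V \<le> card {s}"
      by (intro card_mono) auto
    then show False using card_V by simp
  qed
  moreover have "conn {s}"
    by (rule connI) (use s in auto)
  ultimately show ?thesis
    using s conn_minus[of "{s}"] by (auto simp: halved_def)
qed

lemma halved_of_card:
  "Suc k < card V \<Longrightarrow> \<exists>A. halved A \<and> card A = Suc k"
proof (induction k)
  case 0
  obtain s where "s \<in> V"
    using card_V by fastforce
  then show ?case
    using halved_singleton by (intro exI[of _ "{s}"]) auto
next
  case (Suc k)
  then obtain A where A: "halved A" "card A = Suc k"
    by auto
  then have "A \<subseteq> V" "finite A"
    using finite_V finite_subset by (auto simp: halved_def)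
  then have "2 \<le> card (V - A)"
    using A Suc.prems by (simp add: card_Diff_subset)
  then obtain w where "w \<in> V - A" "halved (insert w A)"
    using grow A by blast
  then show ?case
    using A \<open>finite A\<close> by (intro exI[of _ "insert w A"]) auto
qed

text \<open>Choosing \<open>A\<close> as large as possible with a long path outside fixes the moment
  at which long paths change sides: after one more vertex they exist only inside.\<close>

lemma halved_not_spacious_large:
  assumes p: "7 \<le> p"
  shows "\<exists>A. halved A \<and> \<not> spacious A \<and> \<not> spacious (V - A)"
proof (rule ccontr)
  assume none: "\<not> ?thesis"
  obtain s where s: "s \<in> V"
    using card_V by fastforce
  have "\<not> spacious {s}"
    using p by (intro not_spacious) auto
  then have "halved {s} \<and> spacious (V - {s})"
    using none halved_singleton[OF s] by blast
  moreover have "\<forall>A. halved A \<and> spacious (V - A) \<longrightarrow> card A < Suc (card V)"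
    using card_mono[OF finite_V] by (auto simp: halved_def less_Suc_eq_le)
  ultimately obtain A where A: "halved A" "spacious (V - A)"
    and max: "\<And>A'. halved A' \<and> spacious (V - A') \<Longrightarrow> card A' \<le> card A"
    using ex_has_greatest_nat[of "\<lambda>A. halved A \<and> spacious (V - A)" "{s}" card "Suc (card V)"] by blast
  have fin: "finite A" "A \<subseteq> V"
    using A finite_V finite_subset by (auto simp: halved_def)
  have "\<not> card (V - A) < p - 1"
    using not_spacious A(2) finite_V by blast
  then have "2 \<le> card (V - A)"
    using p by linarith
  then obtain w where w: "w \<in> V - A" "halved (insert w A)"
    using grow[OF A(1)] by blast
  have "\<not> spacious (V - insert w A)"
    using max[of "insert w A"] w fin by auto
  then have "spacious (insert w A)"
    using none w by blast
  then obtain P where P: "is_path V E P" "set P \<subseteq> insert w A" "p - 1 \<le> length P"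
    by (auto simp: spacious_def)
  obtain Q where Q: "is_path V E Q" "set Q \<subseteq> V - A" "p - 1 \<le> length Q"
    using A(2) by (auto simp: spacious_def)
  \<comment> \<open>Without \<open>w\<close>, \<open>Q\<close> would lie outside
    \<open>insert w A\<close>, against maximality; without \<open>w\<close>, \<open>P\<close> would
    be a long path disjoint from \<open>Q\<close>.\<close>
  have "w \<in> set Q"
    using \<open>\<not> spacious (V - insert w A)\<close> Q unfolding spacious_def by blast
  moreover have "w \<in> set P"
    using no_disjoint_long_paths[OF P(1,3) Q(1,3)] P(2) Q(2) p by auto
  ultimately have "set P \<inter> set Q = {w}"
    using P(2) Q(2) by blast
  then show False
    by (rule no_long_paths_meeting_once[OF P(1,3) Q(1,3) _ p, of w A "V - insert w A"])
      (use A w P Q in \<open>auto simp: halved_def\<close>)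
qed

text \<open>The parts have 3 and \<open>p - 2\<close> vertices, both fewer than
  \<open>p - 1\<close>.\<close>

lemma halved_not_spacious_spanning:
  assumes "card V = Suc p" "5 \<le> p"
  shows "\<exists>A. halved A \<and> \<not> spacious A \<and> \<not> spacious (V - A)"
proof -
  obtain A where A: "halved A" "card A = 3"
    using halved_of_card[of 2] assms by auto
  then have "A \<subseteq> V" "finite A"
    using finite_V finite_subset by (auto simp: halved_def)
  then show ?thesis
    using A assms finite_V by (intro exI[of _ A] conjI not_spacious) (auto simp: card_Diff_subset)
qed

end

section \<open>Short longest paths\<close>

context three_connected_graph
begin

lemma third_neighbour:
  assumes "x \<in> V" "x \<noteq> u" "x \<noteq> w"
  obtains y where "adj x y" "y \<noteq> u" "y \<noteq> w"
proof -
  \<comment> \<open>The vertices \<open>u\<close> and \<open>w\<close> may lie outside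
    \<open>V\<close>, hence the intersection.\<close>
  let ?W = "V - {u, w} \<inter> V"
  have c: "card ({u, w} \<inter> V) \<le> 2"
    by (rule order_trans[OF card_mono[of "{u, w}"]]) (auto simp: card_insert_if)
  then have "conn ?W"
    by (intro conn_minus) auto
  moreover have "?W - {x} \<noteq> {}"
  proof
    assume "?W - {x} = {}"
    then have "V \<subseteq> {u, w, x}" by auto
    then have "card V \<le> card {u, w, x}"
      by (intro card_mono) auto
    then show False
      using card_V by (auto simp: card_insert_if split: if_splits)
  qed
  ultimately have "joined {x} (?W - {x})"
    using assms by (intro conn_joined) auto
  then show thesis
    using that by (auto simp: joined_def)
qed

lemma three_neighbours:
  assumes "x \<in> V"
  obtains y1 y2 y3 where "adj x y1" "adj x y2" "adj x y3" "distinct [y1, y2, y3]"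
proof -
  obtain w where w: "w \<noteq> x"
    using halved_singleton[OF assms] by (auto simp: halved_def)
  obtain y1 where y1: "adj x y1"
    using third_neighbour[of x w w] assms w by metis
  obtain y2 where y2: "adj x y2" "y2 \<noteq> y1"
    using third_neighbour[of x y1 y1] assms y1 adj_irrefl by metis
  obtain y3 where "adj x y3" "y3 \<noteq> y1" "y3 \<noteq> y2"
    using third_neighbour[of x y1 y2] assms y1 y2 adj_irrefl by metis
  then show thesis
    using that y1 y2 by auto
qed

lemma longest_path_neighbours:
  assumes "is_path V E xs" "length xs = Suc p" "adj (hd xs) y"
  shows "y \<in> set xs"
proof (rule ccontr)
  assume "y \<notin> set xs"
  then have "is_path V E (y # xs)"
    using assms adj_sym adj_in_V by (auto simp: is_path_iff_walk successively_Cons)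
  then show False
    using bounded[of "y # xs"] assms(2) by simp
qed

text \<open>Otherwise the path closes to a cycle on \<open>p + 1\<close> vertices; opened next to a
  vertex with a neighbour outside, it yields a path with \<open>p + 2\<close> vertices.\<close>

lemma no_spanning_cycle:
  assumes xs: "is_path V E xs" "length xs = Suc p" and V: "Suc p < card V"
  shows "\<not> adj (hd xs) (last xs)"
proof
  assume cl: "adj (hd xs) (last xs)"
  have p: "xs \<noteq> []" "distinct xs" "set xs \<subseteq> V" "walk xs"
    using xs by (auto simp: is_path_iff_walk)
  have "V - set xs \<noteq> {}"
  proof
    assume "V - set xs = {}"
    then have "card V \<le> card (set xs)"
      by (intro card_mono) auto
    then show False
      using V xs p by (simp add: distinct_card)
  qed
  then have "joined (set xs) (V - set xs)"
    using p by (intro conn_joined[OF conn_V]) auto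
  then obtain x y where xy: "x \<in> set xs" "y \<in> V" "y \<notin> set xs" "adj x y"
    by (auto simp: joined_def)
  then obtain as bs where ab: "xs = as @ x # bs"
    by (meson split_list)
  have "walk as" "walk (x # bs)"
    using p(4) unfolding ab successively_append_iff by blast+
  moreover have "as = [] \<or> adj (last (x # bs)) (hd as)"
    using cl adj_sym unfolding ab by (cases as) auto
  ultimately have "walk ((x # bs) @ as)"
    unfolding successively_append_iff[of adj "x # bs"] by blast
  then have "is_path V E (y # x # bs @ as)"
    using xy p adj_sym by (auto simp: is_path_iff_walk ab)
  then show False
    using bounded[of "y # x # bs @ as"] xs(2) by (simp add: ab)
qed

text \<open>The crossing argument of Dirac and Ore. \<open>I\<close> and \<open>J\<close> record the
  neighbours of the two ends, those of the first end shifted by one. Each has at least three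
  elements, and a common element would turn the path into a cycle on the same vertices.\<close>

lemma length_of_nonspanning_longest_path:
  assumes xs: "is_path V E xs" "length xs = Suc p" and V: "Suc p < card V"
  shows "6 \<le> p"
proof -
  have p: "xs \<noteq> []" "distinct xs" "set xs \<subseteq> V" "walk xs"
    using xs by (auto simp: is_path_iff_walk)
  have ends: "hd xs = xs ! 0" "last xs = xs ! p"
    using p(1) xs(2) by (simp_all add: hd_conv_nth last_conv_nth)
  define I where "I = {i. i < p \<and> adj (xs ! 0) (xs ! Suc i)}"
  define J where "J = {i. i < p \<and> adj (xs ! p) (xs ! i)}"
  have three: "3 \<le> card K"
    if ys: "is_path V E ys" "length ys = Suc p" "finite K" and K: "\<And>y. adj (hd ys) y \<Longrightarrow> \<exists>i \<in> K. y = f i"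
    for ys K and f :: "nat \<Rightarrow> 'a"
  proof -
    have "hd ys \<in> V"
      using ys by (auto simp: is_path_iff_walk)
    then obtain y1 y2 y3 where y: "adj (hd ys) y1" "adj (hd ys) y2" "adj (hd ys) y3" "distinct [y1, y2, y3]"
      using three_neighbours by blast
    then have "{y1, y2, y3} \<subseteq> f ` K"
      using K by blast
    then have "card {y1, y2, y3} \<le> card (f ` K)"
      using ys(3) by (intro card_mono) auto
    then show ?thesis
      using y(4) card_image_le[OF ys(3), of f] by auto
  qed
  have I: "3 \<le> card I"
  proof (rule three[OF xs])
    fix y assume y: "adj (hd xs) y"
    then obtain i where i: "i < Suc p" "y = xs ! i"
      using longest_path_neighbours[OF xs y] xs(2) by (auto simp: in_set_conv_nth)
    moreover have "i \<noteq> 0"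
      using y adj_irrefl i ends by metis
    ultimately show "\<exists>i \<in> I. y = xs ! Suc i"
      using y ends by (intro bexI[of _ "i - 1"]) (auto simp: I_def)
  qed (simp add: I_def)
  have rxs: "is_path V E (rev xs)" "length (rev xs) = Suc p"
    using xs walk_rev[of xs] by (auto simp: is_path_iff_walk simp del: successively_rev)
  have J: "3 \<le> card J"
  proof (rule three[OF rxs])
    fix y assume y: "adj (hd (rev xs)) y"
    then have y': "adj (xs ! p) y"
      using p ends by (simp add: hd_rev)
    obtain i where i: "i < Suc p" "y = xs ! i"
      using longest_path_neighbours[OF rxs y] xs(2) by (auto simp: in_set_conv_nth)
    moreover have "i \<noteq> p"
      using y' adj_irrefl i by metis
    ultimately show "\<exists>i \<in> J. y = xs ! i"
      using y' by (intro bexI[of _ i]) (auto simp: J_def)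
  qed (simp add: J_def)
  have "I \<inter> J = {}"
  proof (rule ccontr)
    assume "I \<inter> J \<noteq> {}"
    then obtain i where i: "i < p" "adj (xs ! 0) (xs ! Suc i)" "adj (xs ! p) (xs ! i)"
      by (auto simp: I_def J_def)
    \<comment> \<open>Reversing the part behind position \<open>i\<close> gives a path on the same
      vertices whose ends are adjacent.\<close>
    let ?a = "take (Suc i) xs" and ?b = "drop (Suc i) xs"
    have ab: "xs = ?a @ ?b" "?a \<noteq> []" "?b \<noteq> []"
      using i xs(2) by auto
    have "walk ?a" "walk (rev ?b)"
      using p(4) ab(1) walk_rev[of ?b] successively_append_iff[of adj ?a ?b] by (auto simp del: successively_rev)
    moreover have "last ?a = xs ! i" "hd (rev ?b) = xs ! p"
      using ab i xs(2) ends by (auto simp: last_conv_nth hd_rev)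
    ultimately have "walk (?a @ rev ?b)"
      using i adj_sym by (auto simp: successively_append_iff simp del: successively_rev)
    moreover have "distinct (?a @ rev ?b)" "set (?a @ rev ?b) \<subseteq> V"
      using p(2,3) ab(1) by (metis distinct_append distinct_rev set_rev, metis set_append set_rev)
    ultimately have "is_path V E (?a @ rev ?b)"
      using ab(2) by (simp add: is_path_iff_walk)
    moreover have "length (?a @ rev ?b) = Suc p"
      using xs(2) i by simp
    moreover have "hd (?a @ rev ?b) = xs ! 0"
      using p(1) by (cases xs) auto
    moreover have "last (?a @ rev ?b) = xs ! Suc i"
      using ab(3) i xs(2) by (simp add: last_rev hd_drop_conv_nth)
    ultimately show False
      using no_spanning_cycle[of "?a @ rev ?b"] V i(2) by metis
  qed
  moreover have "I \<union> J \<subseteq> {..<p}" "finite I" "finite J"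
    by (auto simp: I_def J_def)
  ultimately have "card I + card J \<le> p"
    using card_mono[of "{..<p}" "I \<union> J"] by (simp add: card_Un_disjoint)
  then show ?thesis
    using I J by linarith
qed

section \<open>The case \<open>p = 6\<close>: a graph around a 6-cycle\<close>

definition hexagon :: "'a \<Rightarrow> 'a \<Rightarrow> 'a \<Rightarrow> 'a \<Rightarrow> 'a \<Rightarrow> 'a \<Rightarrow> bool" where
  "hexagon c0 c1 c2 c3 c4 c5 \<longleftrightarrow> is_path V E [c0, c1, c2, c3, c4, c5] \<and> adj c5 c0"

lemma explicit_path:
  "is_path V E (x # xs) \<longleftrightarrow> distinct (x # xs) \<and> set (x # xs) \<subseteq> V \<and> walk (x # xs)"
  by (auto simp: is_path_iff_walk)

text \<open>Without a 6-cycle and without a 7-cycle, the neighbourhoods of the ends \<open>a\<close>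
  and \<open>g\<close> are forced to triangles at both ends of the path, hinged at \<open>d\<close>;
  then an edge bypassing \<open>d\<close> closes a 7-cycle after all.\<close>

lemma obtain_hexagon:
  assumes xs: "is_path V E xs" "length xs = 7" and p: "p = 6" and V: "7 < card V"
  obtains c0 c1 c2 c3 c4 c5 where "hexagon c0 c1 c2 c3 c4 c5"
proof (rule ccontr)
  assume "\<not> thesis"
  then have none: "\<not> hexagon c0 c1 c2 c3 c4 c5" for c0 c1 c2 c3 c4 c5
    using that by blast
  obtain a b c d e f g where "xs = [a, b, c, d, e, f, g]"
    using xs(2) by (auto simp: length_Suc_conv eval_nat_numeral)
  with xs have P: "distinct [a, b, c, d, e, f, g]" "set [a, b, c, d, e, f, g] \<subseteq> V"
    "adj a b" "adj b c" "adj c d" "adj d e" "adj e f" "adj f g"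
    by (auto simp: explicit_path)
  note P' = P P(3-8)[THEN adj_sym]
  have cyc: "\<not> adj (hd ys) (last ys)" if "mset ys = mset [a, b, c, d, e, f, g]" "walk ys" for ys
  proof -
    have "distinct ys" "set ys \<subseteq> V" "length ys = 7" "ys \<noteq> []"
      using P(1,2) mset_eq_imp_distinct_iff[OF that(1)] mset_eq_setD[OF that(1)] mset_eq_length[OF that(1)] by auto
    then show ?thesis
      using no_spanning_cycle[of ys] that(2) p V by (auto simp: is_path_iff_walk)
  qed
  have nb: "y \<in> set ys" if "mset ys = mset [a, b, c, d, e, f, g]" "walk ys" "adj (hd ys) y" for ys y
  proof -
    have "distinct ys" "set ys \<subseteq> V" "length ys = 7" "ys \<noteq> []"
      using P(1,2) mset_eq_imp_distinct_iff[OF that(1)] mset_eq_setD[OF that(1)] mset_eq_length[OF that(1)] by auto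
    then show ?thesis
      using longest_path_neighbours[of ys y] that p by (auto simp: is_path_iff_walk)
  qed
  have hex: "\<not> adj a f" "\<not> adj b g" "\<not> (adj a e \<and> adj c g)"
    using none[of a b c d e f] none[of b c d e f g] none[of a b c g f e] P
    by (auto simp: hexagon_def explicit_path adj_commute)
  have ag: "\<not> adj a g"
    using cyc[of "[a, b, c, d, e, f, g]"] P by auto
  have cross: "\<not> (adj a d \<and> adj c g)" "\<not> (adj a e \<and> adj d g)"
    using cyc[of "[a, b, c, g, f, e, d]"] cyc[of "[a, b, c, d, g, f, e]"] P' adj_sym by auto
  have a_nb: "y \<in> {b, c, d, e}" if "adj a y" for y
    using nb[of "[a, b, c, d, e, f, g]" y] P that hex ag adj_irrefl by auto
  have g_nb: "y \<in> {c, d, e, f}" if "adj g y" for y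
    using nb[of "[g, f, e, d, c, b, a]" y] P' that hex ag adj_irrefl adj_sym by auto
  have a2: "\<exists>y \<in> {c, d, e} - {z}. adj a y" if z: "z \<in> {c, d, e}" for z
  proof -
    obtain y where "adj a y" "y \<noteq> b" "y \<noteq> z"
      by (rule third_neighbour[of a b z]) (use P z in auto)
    then show ?thesis
      using a_nb by blast
  qed
  have g2: "\<exists>y \<in> {c, d, e} - {z}. adj g y" if z: "z \<in> {c, d, e}" for z
  proof -
    obtain y where "adj g y" "y \<noteq> f" "y \<noteq> z"
      by (rule third_neighbour[of g f z]) (use P z in auto)
    then show ?thesis
      using g_nb by blast
  qed
  \<comment> \<open>Each of \<open>a\<close> and \<open>g\<close> has two neighbours among
    \<open>c\<close>, \<open>d\<close>, \<open>e\<close>. The excluded pairs leave \<open>c\<close>,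
    \<open>d\<close> for \<open>a\<close> and \<open>d\<close>, \<open>e\<close> for
    \<open>g\<close>.\<close>
  have "adj a d \<or> adj a e" "adj a c \<or> adj a e" "adj a c \<or> adj a d"
    "adj g d \<or> adj g e" "adj g c \<or> adj g e" "adj g c \<or> adj g d"
    using a2[of c] a2[of d] a2[of e] g2[of c] g2[of d] g2[of e] by auto
  then have acd: "\<not> adj a e" "adj a c" "adj a d" and gde: "adj g d" "adj g e"
    using hex cross adj_commute by blast+
  have "conn (V - {d})"
    using P by (intro conn_minus) auto
  then have "joined {a, b, c} (V - {d} - {a, b, c})"
    by (rule conn_joined) (use P in auto)
  then obtain x y where xy: "x \<in> {a, b, c}" "y \<notin> {a, b, c, d}" "adj x y"
    by (auto simp: joined_def)
  note Q = P' acd(2,3) gde acd(2,3)[THEN adj_sym] gde[THEN adj_sym]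
  have "y \<in> {e, f, g}"
    using nb[of "[a, b, c, d, e, f, g]" y] nb[of "[b, a, c, d, e, f, g]" y] nb[of "[c, b, a, d, e, f, g]" y] xy Q
    by auto
  \<comment> \<open>From each of \<open>a\<close>, \<open>b\<close>, \<open>c\<close> a path runs
    through all three and on to \<open>d\<close>, and likewise from \<open>e\<close>,
    \<open>f\<close>, \<open>g\<close>. So each of the nine possible edges \<open>xy\<close> closes
    a 7-cycle.\<close>
  then show False
    using xy(1,3) Q
      cyc[of "[a, b, c, d, g, f, e]"] cyc[of "[a, b, c, d, e, g, f]"] cyc[of "[a, b, c, d, e, f, g]"]
      cyc[of "[b, a, c, d, g, f, e]"] cyc[of "[b, a, c, d, e, g, f]"] cyc[of "[b, a, c, d, e, f, g]"]
      cyc[of "[c, b, a, d, g, f, e]"] cyc[of "[c, b, a, d, e, g, f]"] cyc[of "[c, b, a, d, e, f, g]"]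
    by auto
qed

lemma hexagon_rotate: "hexagon c0 c1 c2 c3 c4 c5 \<Longrightarrow> hexagon c1 c2 c3 c4 c5 c0"
  by (auto simp: hexagon_def explicit_path)

lemma hexagonD:
  assumes "hexagon c0 c1 c2 c3 c4 c5"
  shows "distinct [c0, c1, c2, c3, c4, c5]" "{c0, c1, c2, c3, c4, c5} \<subseteq> V"
    "adj c0 c1" "adj c1 c2" "adj c2 c3" "adj c3 c4" "adj c4 c5" "adj c5 c0"
    "adj c1 c0" "adj c2 c1" "adj c3 c2" "adj c4 c3" "adj c5 c4" "adj c0 c5"
  using assms adj_sym by (auto simp: hexagon_def explicit_path)

lemma hexagon_pendant_path:
  assumes h: "hexagon c0 c1 c2 c3 c4 c5" and p: "p = 6"
    and z: "z \<notin> {c0, c1, c2, c3, c4, c5}" "z' \<notin> {c0, c1, c2, c3, c4, c5}" "adj z c0" "adj z z'"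
  shows False
proof -
  have "z \<noteq> z'"
    using z(4) adj_irrefl by blast
  then have "is_path V E [z', z, c0, c1, c2, c3, c4, c5]"
    using hexagonD[OF h] z adj_in_V[OF z(4)] adj_sym by (auto simp: explicit_path)
  then show False
    using bounded p by fastforce
qed

text \<open>Let \<open>K\<close> be the set of outside vertices with an outside neighbour. An edge
  leaving \<open>K\<close> can only lead to the cycle; preceded by an outside edge and followed by
  the cycle, it gives a path on eight vertices.\<close>

lemma outside_hexagon_independent:
  assumes h: "hexagon c0 c1 c2 c3 c4 c5" and p: "p = 6"
    and z: "z \<notin> {c0, c1, c2, c3, c4, c5}" "z' \<notin> {c0, c1, c2, c3, c4, c5}"
  shows "\<not> adj z z'"
proof
  assume a: "adj z z'"
  let ?C = "{c0, c1, c2, c3, c4, c5}"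
  define K where "K = {x \<in> V - ?C. \<exists>y. y \<notin> ?C \<and> adj x y}"
  have "z \<in> K"
    using z a adj_in_V by (auto simp: K_def)
  moreover have "c0 \<in> V - K"
    using hexagonD(2)[OF h] by (auto simp: K_def)
  ultimately have "joined K (V - K)"
    by (intro conn_joined[OF conn_V]) (auto simp: K_def)
  then obtain x y where xy: "x \<in> K" "y \<in> V - K" "adj x y"
    by (auto simp: joined_def)
  then have "y \<in> ?C"
    using adj_sym by (auto simp: K_def)
  moreover obtain x' where "x \<notin> ?C" "x' \<notin> ?C" "adj x x'"
    using xy(1) by (auto simp: K_def)
  moreover note h1 = hexagon_rotate[OF h] and h2 = hexagon_rotate[OF hexagon_rotate[OF h]]
    and h3 = hexagon_rotate[OF hexagon_rotate[OF hexagon_rotate[OF h]]]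
  moreover note h4 = hexagon_rotate[OF h3] and h5 = hexagon_rotate[OF hexagon_rotate[OF h3]]
  ultimately show False
    using xy(3) hexagon_pendant_path[OF h p, of x x'] hexagon_pendant_path[OF h1 p, of x x']
      hexagon_pendant_path[OF h2 p, of x x'] hexagon_pendant_path[OF h3 p, of x x']
      hexagon_pendant_path[OF h4 p, of x x'] hexagon_pendant_path[OF h5 p, of x x'] by auto
qed

text \<open>Otherwise \<open>z\<close> could be inserted into the 6-cycle, giving a cycle on
  \<open>p + 1\<close> vertices.\<close>

lemma not_adj_consecutive:
  assumes h: "hexagon c0 c1 c2 c3 c4 c5" and p: "p = 6" "7 < card V"
    and z: "z \<notin> {c0, c1, c2, c3, c4, c5}" "adj z c0"
  shows "\<not> adj z c1"
proof
  assume "adj z c1"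
  moreover have "is_path V E [c1, c2, c3, c4, c5, c0, z]"
    using hexagonD[OF h] z adj_in_V[OF z(2)] adj_sym by (auto simp: explicit_path)
  ultimately show False
    using no_spanning_cycle[of "[c1, c2, c3, c4, c5, c0, z]"] p adj_sym by auto
qed

text \<open>At least three neighbours, all on the cycle and no two consecutive, leave just the two
  alternating triples.\<close>

lemma hexagon_neighbours:
  assumes h: "hexagon c0 c1 c2 c3 c4 c5" and p: "p = 6" "7 < card V"
    and z: "z \<in> V" "z \<notin> {c0, c1, c2, c3, c4, c5}"
  shows "(\<forall>y. adj z y \<longleftrightarrow> y \<in> {c0, c2, c4}) \<or> (\<forall>y. adj z y \<longleftrightarrow> y \<in> {c1, c3, c5})"
proof -
  let ?C = "{c0, c1, c2, c3, c4, c5}"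
  note h1 = hexagon_rotate[OF h]
  note h2 = hexagon_rotate[OF h1]
  note h3 = hexagon_rotate[OF h2]
  note h4 = hexagon_rotate[OF h3]
  note h5 = hexagon_rotate[OF h4]
  note n = not_adj_consecutive[OF h p z(2)] not_adj_consecutive[OF h1 p, of z] not_adj_consecutive[OF h2 p, of z]
    not_adj_consecutive[OF h3 p, of z] not_adj_consecutive[OF h4 p, of z] not_adj_consecutive[OF h5 p, of z]
  have cons: "adj z c0 \<Longrightarrow> \<not> adj z c1" "adj z c1 \<Longrightarrow> \<not> adj z c2" "adj z c2 \<Longrightarrow> \<not> adj z c3"
    "adj z c3 \<Longrightarrow> \<not> adj z c4" "adj z c4 \<Longrightarrow> \<not> adj z c5" "adj z c5 \<Longrightarrow> \<not> adj z c0"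
    using n z(2) by auto
  have inC: "y \<in> ?C" if "adj z y" for y
    using outside_hexagon_independent[OF h p(1) z(2)] that by blast
  have third: "\<exists>y. y \<in> ?C \<and> adj z y \<and> y \<noteq> u \<and> y \<noteq> w" if uw: "u \<in> ?C" "w \<in> ?C" for u w
  proof -
    obtain y where "adj z y" "y \<noteq> u" "y \<noteq> w"
      by (rule third_neighbour[of z u w]) (use z uw in auto)
    then show ?thesis
      using inC by blast
  qed
  have "adj z c1 \<or> adj z c3 \<or> adj z c4 \<or> adj z c5" "adj z c1 \<or> adj z c2 \<or> adj z c4 \<or> adj z c5"
    "adj z c1 \<or> adj z c2 \<or> adj z c3 \<or> adj z c5"
    using third[of c0 c2] third[of c0 c3] third[of c0 c4] by blast+
  moreover have "adj z c0 \<or> adj z c1 \<or> adj z c3 \<or> adj z c5" "adj z c0 \<or> adj z c1 \<or> adj z c3 \<or> adj z c4"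
    "adj z c0 \<or> adj z c2 \<or> adj z c3 \<or> adj z c5"
    using third[of c2 c4] third[of c2 c5] third[of c1 c4] by blast+
  moreover have "adj z c0 \<or> adj z c2 \<or> adj z c4 \<or> adj z c5" "adj z c0 \<or> adj z c1 \<or> adj z c2 \<or> adj z c4"
    "adj z c0 \<or> adj z c2 \<or> adj z c3 \<or> adj z c4"
    using third[of c1 c3] third[of c3 c5] third[of c1 c5] by blast+
  ultimately have "adj z c0 \<and> adj z c2 \<and> adj z c4 \<and> \<not> adj z c1 \<and> \<not> adj z c3 \<and> \<not> adj z c5 \<or>
    adj z c1 \<and> adj z c3 \<and> adj z c5 \<and> \<not> adj z c0 \<and> \<not> adj z c2 \<and> \<not> adj z c4"
    using cons by argo
  then show ?thesis
    using inC by blast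
qed

lemma conn_star:
  assumes "W \<subseteq> V" "c \<in> W" "\<And>x. x \<in> W - {c} \<Longrightarrow> adj x c"
  shows "conn W"
proof (rule connI[OF assms(1)])
  fix C assume "C \<subseteq> W" "C \<noteq> {}" "W - C \<noteq> {}"
  then show "joined C (W - C)"
    using assms(2,3) adj_sym unfolding joined_def by (cases "c \<in> C") blast+
qed

text \<open>Every vertex outside the triple has three neighbours, so it is adjacent to the whole
  triple. One part consists of two vertices of the triple and \<open>z\<close>, the other keeps the
  hub \<open>x1\<close>; both are connected through stars.\<close>

lemma halved_of_independent_complement:
  assumes X: "distinct [x1, x2, x3]" "{x1, x2, x3} \<subseteq> V"
    and indep: "\<And>x y. x \<notin> {x1, x2, x3} \<Longrightarrow> y \<notin> {x1, x2, x3} \<Longrightarrow> \<not> adj x y"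
    and p: "5 \<le> p" and z: "z \<in> V" "z \<notin> {x1, x2, x3}"
  shows "\<exists>A. halved A \<and> \<not> spacious A \<and> \<not> spacious (V - A)"
proof -
  have full: "adj x y" if x: "x \<in> V" "x \<notin> {x1, x2, x3}" and y: "y \<in> {x1, x2, x3}" for x y
  proof -
    obtain u w where uw: "{x1, x2, x3} = {u, w, y}" "u \<noteq> x" "w \<noteq> x"
    proof -
      consider "y = x1" | "y = x2" | "y = x3" using y by blast
      then show thesis
        by cases (use x in \<open>auto intro: that[of x2 x3] that[of x1 x3] that[of x1 x2]\<close>)
    qed
    obtain t where "adj x t" "t \<noteq> u" "t \<noteq> w"
      by (rule third_neighbour[of x u w]) (use x uw in auto)
    then show ?thesis
      using indep[of x t] x uw by blast
  qed
  let ?B = "{z, x2, x3}" and ?A = "V - {z, x2, x3}"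
  have VA: "V - ?A = ?B"
    using z X by blast
  have "conn ?B"
    by (rule conn_star[of _ z]) (use z X full adj_sym in auto)
  moreover have "conn ?A"
    by (rule conn_star[of _ x1]) (use z X full in auto)
  ultimately have "halved ?A"
    using X z by (auto simp: halved_def VA simp del: Diff_insert2)
  moreover have "\<not> spacious ?B"
    by (rule not_spacious) (use p in \<open>auto simp: card_insert_if\<close>)
  moreover have "\<not> spacious ?A"
  proof
    assume "spacious ?A"
    then obtain xs where xs: "is_path V E xs" "set xs \<subseteq> ?A" "p - 1 \<le> length xs"
      unfolding spacious_def by blast
    \<comment> \<open>All edges inside \<open>?A\<close> contain \<open>x1\<close>, whereas a path
      on four vertices has two disjoint edges.\<close>
    then have "4 \<le> length xs"
      using p by linarith
    then obtain a b c d ys where "xs = a # b # c # d # ys"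
      by (auto simp: Suc_le_length_iff eval_nat_numeral)
    with xs have "adj a b" "adj c d" "distinct [a, b, c, d]" "set [a, b, c, d] \<subseteq> ?A"
      by (auto simp: explicit_path)
    then show False
      using indep[of a b] indep[of c d] by auto
  qed
  ultimately show ?thesis
    using VA by metis
qed

text \<open>At least two vertices lie off the 6-cycle. The absence of paths on eight vertices forces
  all of them to have the same alternating triple as neighbours, and the other three cycle vertices
  to be independent.\<close>

lemma halved_not_spacious_small:
  assumes xs: "is_path V E xs" "length xs = 7" and p: "p = 6" and V: "7 < card V"
  shows "\<exists>A. halved A \<and> \<not> spacious A \<and> \<not> spacious (V - A)"
proof -
  obtain d0 d1 d2 d3 d4 d5 where d: "hexagon d0 d1 d2 d3 d4 d5"
    using obtain_hexagon[OF xs p V] .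
  have "2 \<le> card (V - {d0, d1, d2, d3, d4, d5})"
    using V hexagonD(1,2)[OF d] by (subst card_Diff_subset) auto
  then obtain z w where zw: "z \<in> V - {d0, d1, d2, d3, d4, d5}" "w \<in> V - {d0, d1, d2, d3, d4, d5}" "z \<noteq> w"
    by (metis card_le_Suc0_iff_eq card.infinite not_less_eq_eq numeral_2_eq_2 le0 finite_V finite_Diff)
  have "\<exists>c0 c1 c2 c3 c4 c5. hexagon c0 c1 c2 c3 c4 c5 \<and> {c0, c1, c2, c3, c4, c5} = {d0, d1, d2, d3, d4, d5} \<and>
    (\<forall>y. adj z y \<longleftrightarrow> y \<in> {c0, c2, c4})"
  proof -
    consider "\<forall>y. adj z y \<longleftrightarrow> y \<in> {d0, d2, d4}" | "\<forall>y. adj z y \<longleftrightarrow> y \<in> {d1, d3, d5}"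
      using hexagon_neighbours[OF d p V, of z] zw by blast
    then show ?thesis
    proof cases
      case 1
      with d show ?thesis by blast
    next
      case 2
      moreover have "{d1, d2, d3, d4, d5, d0} = {d0, d1, d2, d3, d4, d5}"
        by blast
      ultimately show ?thesis
        using hexagon_rotate[OF d] by blast
    qed
  qed
  then obtain c0 c1 c2 c3 c4 c5 where h: "hexagon c0 c1 c2 c3 c4 c5"
    and eq: "{c0, c1, c2, c3, c4, c5} = {d0, d1, d2, d3, d4, d5}" and z: "\<forall>y. adj z y \<longleftrightarrow> y \<in> {c0, c2, c4}"
    by blast
  have zw: "z \<in> V - {c0, c1, c2, c3, c4, c5}" "w \<in> V - {c0, c1, c2, c3, c4, c5}" "z \<noteq> w"
    using zw eq by auto
  have eight: False if "is_path V E ys" "length ys = 8" for ys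
    using bounded[OF that(1)] that(2) p by simp
  note D = hexagonD[OF h]
  have out: "adj u y \<longleftrightarrow> y \<in> {c0, c2, c4}" if u: "u \<in> V - {c0, c1, c2, c3, c4, c5}" for u y
  proof (cases "u = z")
    case False
    have "\<not> adj u c5"
    proof
      assume "adj u c5"
      \<comment> \<open>Since \<open>z\<close> is adjacent to \<open>c0\<close>, a neighbour
        \<open>c5\<close> of \<open>u\<close> would allow the cycle to be traversed between
        \<open>z\<close> and \<open>u\<close>.\<close>
      then have "is_path V E [z, c0, c1, c2, c3, c4, c5, u]"
        using z u zw False D adj_sym by (auto simp: explicit_path)
      then show False
        using eight by fastforce
    qed
    then show ?thesis
      using hexagon_neighbours[OF h p V, of u] u by auto
  qed (use z in simp)
  have odd: "\<not> adj b1 b3"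
    if h: "hexagon b0 b1 b2 b3 b4 b5" "{b0, b1, b2, b3, b4, b5} = {c0, c1, c2, c3, c4, c5}" "{b0, b2, b4} = {c0, c2, c4}"
    for b0 b1 b2 b3 b4 b5
  proof
    assume "adj b1 b3"
    moreover have b: "b0 \<in> {c0, c2, c4}" "b2 \<in> {c0, c2, c4}" "b4 \<in> {c0, c2, c4}"
      using that(3) by blast+
    then have "adj z b0" "adj w b2" "adj w b4"
      using out[OF zw(1)] out[OF zw(2)] by blast+
    moreover from this(2) have "adj b2 w"
      by (rule adj_sym)
    moreover have "z \<notin> {b0, b1, b2, b3, b4, b5}" "w \<notin> {b0, b1, b2, b3, b4, b5}" "z \<in> V" "w \<in> V"
      using zw that(2) by auto
    \<comment> \<open>The two outside vertices let the path go around the cycle with a detour: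
      \<open>z\<close> starts it and \<open>w\<close> bridges \<open>b2\<close> and
      \<open>b4\<close>, for eight vertices in all.\<close>
    ultimately have "is_path V E [z, b0, b1, b3, b2, w, b4, b5]"
      using hexagonD[OF that(1)] zw(3) by (auto simp: explicit_path)
    then show False
      using eight by fastforce
  qed
  note h2 = hexagon_rotate[OF hexagon_rotate[OF h]]
  note h4 = hexagon_rotate[OF hexagon_rotate[OF h2]]
  have "\<not> adj c1 c3" "\<not> adj c3 c5" "\<not> adj c5 c1"
    using odd[OF h] odd[OF h2] odd[OF h4] by blast+
  then have odd: "\<not> adj x y" if "x \<in> {c1, c3, c5}" "y \<in> {c1, c3, c5}" for x y
    using that adj_sym adj_irrefl by blast
  show ?thesis
  proof (rule halved_of_independent_complement[of c0 c2 c4 z])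
    fix x y assume x: "x \<notin> {c0, c2, c4}" and y: "y \<notin> {c0, c2, c4}"
    show "\<not> adj x y"
    proof
      assume a: "adj x y"
      then have "x \<in> V" "y \<in> V" "adj y x"
        using adj_in_V adj_sym by auto
      then have "x \<in> {c1, c3, c5}" "y \<in> {c1, c3, c5}"
        using out[of x y] out[of y x] a x y by auto
      then show False
        using odd a by blast
    qed
  qed (use D zw p in auto)
qed

section \<open>Assembling the cases\<close>

lemma halved_not_spacious:
  assumes xs: "is_path V E xs" "length xs = Suc p" and V: "6 \<le> card V"
  shows "\<exists>A. halved A \<and> \<not> spacious A \<and> \<not> spacious (V - A)"
proof -
  have "card (set xs) \<le> card V" "distinct xs"
    using xs finite_V by (auto simp: is_path_iff_walk intro: card_mono)
  then have "Suc p \<le> card V"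
    using xs(2) by (simp add: distinct_card)
  then consider "card V = Suc p" | "Suc p < card V" "p = 6" | "7 \<le> p"
    using length_of_nonspanning_longest_path[OF xs] by linarith
  then show ?thesis
  proof cases
    case 1
    then show ?thesis using halved_not_spacious_spanning V by simp
  next
    case 2
    then show ?thesis using halved_not_spacious_small[OF xs(1)] xs(2) by simp
  next
    case 3
    then show ?thesis by (rule halved_not_spacious_large)
  qed
qed

end

theorem theorem4:
  fixes V :: "'a set" and E :: "'a set set" and p :: nat
  assumes "simple_graph V E"
    and "k_connected 3 V E"
    and "card V \<ge> 6"
    and "p = Max (path_len ` {xs. is_path V E xs})"
  shows "\<exists>B. is_bond V E B \<and>
           (\<forall>xs. is_path V E xs \<and> int (path_len xs) \<ge> int p - 2 \<longrightarrow> meets B xs)"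
proof -
  let ?paths = "{xs. is_path V E xs}"
  have "finite V" "V \<noteq> {}"
    using assms(1,3) by (auto simp: simple_graph_def)
  from this(1) have "finite {xs. set xs \<subseteq> V \<and> distinct xs}"
    by (rule finite_subset_distinct)
  then have fin: "finite ?paths"
    by (rule rev_finite_subset) (auto simp: is_path_def)
  obtain s where "s \<in> V"
    using \<open>V \<noteq> {}\<close> by blast
  then have "[s] \<in> ?paths"
    by (simp add: is_path_def)
  then have "p \<in> path_len ` ?paths"
    unfolding assms(4) using fin by (intro Max_in) auto
  then obtain xs where "is_path V E xs" "p = path_len xs"
    by blast
  then have xs: "is_path V E xs" "length xs = Suc p"
    by (auto simp: is_path_def path_len_def)
  have "path_len ys \<le> p" if "is_path V E ys" for ys
    unfolding assms(4) using fin that by (intro Max_ge) auto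
  then have "length ys \<le> Suc p" if "is_path V E ys" for ys
    using that by (fastforce simp: path_len_def)
  then interpret three_connected_graph V E p
    using assms(1,2) by unfold_locales
  obtain A where "halved A" "\<not> spacious A" "\<not> spacious (V - A)"
    using halved_not_spacious[OF xs assms(3)] by blast
  then show ?thesis
    using bond_of_halved conn_V by blast
qed

end
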